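(* Let $\mathcal{B}$ be an arbitrary complete Boolean algebra, let $Q$ be the Stone space of $\mathcal{B}$, let $\mathbb{X}$ be an ideal in $\mathbb{C}(Q)$, and let $\mathbb{Y}$ be a solid space in $L^0_{\mathbb{C}}(\mathcal{B})$. Then: (i) There exists a non-zero band preserving derivation $\delta\colon\mathbb{X}\to\mathbb{Y}$ if and only if there exists a non-zero idempotent $e\in\mathcal{B}$ with $e\leqslant s(\mathbb{X})s(\mathbb{Y})$ such that $e\mathbb{Y}=eL^0_{\mathbb{C}}(\mathcal{B})$ and the Boolean algebra $\mathcal{B}_e$ is not $\sigma$-distributive. (ii) If $\mathbb{Y}$ is a quasi-normed solid space (equipped with a monotone quasi-norm), or if $\mathbb{Y}\subset\mathbb{C}(Q)$, then any band preserving derivation $\delta\colon\mathbb{X}\to\mathbb{Y}$ is trivial (identically zero).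
   Context: $L^0(\mathcal{B}):=C_\infty(Q)$ denotes the set of all continuous functions $x:Q\to[-\infty,+\infty]$ taking the values $\pm\infty$ at most on a nowhere dense set; with the usual operations (pointwise on a dense open set, extended by continuity) and pointwise order it is a commutative real algebra and a universally complete vector lattice. $L^0_{\mathbb{C}}(\mathcal{B})=L^0(\mathcal{B})\oplus iL^0(\mathcal{B})$ is its complexification, a commutative complex $*$-algebra with $\overline{x+iy}=x-iy$ and modulus $|z|=(\overline{z}z)^{1/2}\in L^0(\mathcal{B})$. $\mathbb{C}(Q)\subset L^0_{\mathbb{C}}(\mathcal{B})$ is the algebra of continuous complex-valued functions on $Q$. $\mathcal{B}$ is identified with the Boolean algebra of idempotents of $L^0(\mathcal{B})$ (characteristic functions of clopen sets); $\mathbf{1}$ is the constant function one; for $p,q\in\mathcal B$ the product $pq$ is the meet. For $e\in\mathcal{B}$, $\mathcal{B}_e=\{q\in\mathcal{B}:q\leqslant e\}$, a Boolean algebra with unit $e$. A $\sigma$-complete Boolean algebra is $\sigma$-distributive if $\bigvee_{n}\bigwedge_{m}e_{n,m}=\bigwedge_{\varphi\in\mathbb{N}^{\mathbb{N}}}\bigvee_{n}e_{n,\varphi(n)}$ for every double sequence $\{e_{n,m}\}_{n,m\in\mathbb{N}}$ in it. Support: for $z\in L^0_{\mathbb{C}}(\mathcal{B})$, $s(z)=s(|z|)=\mathbf{1}-\sup\{e\in\mathcal{B}:e|z|=0\}\in\mathcal{B}$; for non-empty $E$, $s(E)=\sup\{s(z):z\in E\}$; $eE=\{ez:z\in E\}$.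 A solid space in $L^0_{\mathbb{C}}(\mathcal{B})$ is a non-zero complex linear subspace $\mathbb{Y}$ such that $x\in\mathbb{Y}$, $y\in L^0_{\mathbb{C}}(\mathcal{B})$, $|y|\leqslant|x|$ imply $y\in\mathbb{Y}$ (then $ay\in\mathbb Y$ for $a\in\mathbb C(Q)$, $y\in\mathbb Y$). A quasi-norm on $\mathbb{Y}$ is a map $\|\cdot\|:\mathbb{Y}\to\mathbb{R}$ for which there is $C\geqslant1$ such that for all $x,y\in\mathbb{Y}$, $\alpha\in\mathbb{C}$: $\|x\|\geqslant0$, with $\|x\|=0$ iff $x=0$; $\|\alpha x\|=|\alpha|\|x\|$; $\|x+y\|\leqslant C(\|x\|+\|y\|)$. It is monotone if $|y|\leqslant|x|$ implies $\|y\|\leqslant\|x\|$. A quasi-normed solid space is a solid space with a monotone quasi-norm (completeness not required). An ideal in $\mathbb{C}(Q)$ is a complex subalgebra $\mathbb{X}\subset\mathbb{C}(Q)$ with $xa\in\mathbb{X}$ for all $x\in\mathbb{C}(Q)$, $a\in\mathbb{X}$. A derivation $\delta:\mathbb{X}\to\mathbb{Y}$ is a complex-linear map with $\delta(xy)=\delta(x)y+x\delta(y)$ for all $x,y\in\mathbb{X}$; it is band preserving if $s(\delta(x))\leqslant s(x)$ for all $x\in\mathbb{X}$. *)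

theory Defs
  imports "HOL-Analysis.Analysis"
begin

(* Complete Boolean algebras are types of sort {boolean_algebra, complete_lattice}. The library
   classes complete_distrib_lattice and complete_boolean_algebra are not suitable: they
   demand complete distributivity, that is, atomicity. *)

section \<open>The Stone space\<close>

definition bool_ultrafilter :: "'b::boolean_algebra set \<Rightarrow> bool" where
  "bool_ultrafilter U \<longleftrightarrow>
     top \<in> U \<and> bot \<notin> U \<and>
     (\<forall>a\<in>U. \<forall>b. a \<le> b \<longrightarrow> b \<in> U) \<and>
     (\<forall>a\<in>U. \<forall>b\<in>U. inf a b \<in> U) \<and>
     (\<forall>a. a \<in> U \<or> - a \<in> U)"

definition stone_clopen :: "'b::boolean_algebra \<Rightarrow> 'b set set" where
  "stone_clopen b = {U. bool_ultrafilter U \<and> b \<in> U}"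

definition stone_space :: "'b::boolean_algebra set topology" where
  "stone_space = topology_generated_by (range stone_clopen)"

abbreviation stone_points :: "'b::boolean_algebra set set" where
  "stone_points \<equiv> topspace stone_space"

lemma openin_stone_clopen: "openin stone_space (stone_clopen b)"
  unfolding stone_space_def by (rule topology_generated_by_Basis) simp

lemma topspace_stone_space: "topspace stone_space = {U. bool_ultrafilter U}"
proof -
  have "stone_clopen b \<subseteq> stone_clopen top" for b :: 'a
    by (auto simp: stone_clopen_def bool_ultrafilter_def)
  moreover have "stone_clopen top = {U :: 'a set. bool_ultrafilter U}"
    by (auto simp: stone_clopen_def bool_ultrafilter_def)
  ultimately show ?thesis
    unfolding stone_space_def topology_generated_by_topspace by blast
qed

lemma stone_clopen_compl: "stone_points - stone_clopen b = stone_clopen (- b)"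
proof -
  have "- b \<in> U \<longleftrightarrow> b \<notin> U" if U: "bool_ultrafilter U" for U :: "'a set"
  proof
    assume "- b \<in> U"
    show "b \<notin> U"
    proof
      assume "b \<in> U"
      with \<open>- b \<in> U\<close> U have "inf b (- b) \<in> U"
        unfolding bool_ultrafilter_def by blast
      with U show False
        unfolding bool_ultrafilter_def by simp
    qed
  next
    assume "b \<notin> U"
    with U show "- b \<in> U"
      unfolding bool_ultrafilter_def by blast
  qed
  then show ?thesis
    unfolding topspace_stone_space stone_clopen_def by blast
qed

lemma closedin_stone_clopen: "closedin stone_space (stone_clopen b)"
proof -
  have "stone_clopen b \<subseteq> stone_points"
    by (simp add: openin_stone_clopen openin_subset)
  then show ?thesis
    by (simp add: closedin_def stone_clopen_compl openin_stone_clopen)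
qed

section \<open>The real algebra of extended-real continuous functions\<close>

definition nowhere_dense_in :: "'a topology \<Rightarrow> 'a set \<Rightarrow> bool" where
  "nowhere_dense_in T S \<longleftrightarrow> T interior_of (T closure_of S) = {}"

(* The value 0 off the Stone space only serves to make functions that agree on it equal. *)
typedef (overloaded) ('b::"{boolean_algebra,complete_lattice}") L0 =
  "{x :: 'b set \<Rightarrow> ereal.
      continuous_map stone_space euclidean x \<and>
      nowhere_dense_in stone_space {U \<in> stone_points. \<bar>x U\<bar> = \<infinity>} \<and>
      (\<forall>U. U \<notin> stone_points \<longrightarrow> x U = 0)}"
  morphisms L0_fun Abs_L0
  by (rule exI[of _ "\<lambda>_. 0"]) (simp add: nowhere_dense_in_def)

setup_lifting type_definition_L0

lift_definition L0_const :: "real \<Rightarrow> 'b::{boolean_algebra,complete_lattice} L0" is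
  "\<lambda>r U. if U \<in> stone_points then ereal r else 0"
proof (intro CollectI conjI)
  fix r :: real
  show "continuous_map stone_space euclidean
          (\<lambda>U::'b set. if U \<in> stone_points then ereal r else 0)"
    by (rule continuous_map_eq[of _ _ "\<lambda>_. ereal r"]) simp_all
  have "{U \<in> stone_points. \<bar>if U \<in> stone_points then ereal r else 0\<bar> = \<infinity>} = ({} :: 'b set set)"
    by simp
  then show "nowhere_dense_in stone_space
      {U :: 'b set. U \<in> stone_points \<and> \<bar>if U \<in> stone_points then ereal r else 0\<bar> = \<infinity>}"
    by (simp only:) (simp add: nowhere_dense_in_def)
qed simp

(* Characteristic functions of clopen sets: the embedding of the Boolean algebra. *)
lift_definition L0_chi :: "'b \<Rightarrow> 'b::{boolean_algebra,complete_lattice} L0" is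
  "\<lambda>b U. if U \<in> stone_clopen b then 1 else 0"
proof (intro CollectI conjI)
  fix b :: 'b
  show "continuous_map stone_space euclidean
          (\<lambda>U. if U \<in> stone_clopen b then 1 else (0::ereal))"
  proof (unfold continuous_map, intro conjI allI impI)
    fix V :: "ereal set"
    have "{U \<in> stone_points. (if U \<in> stone_clopen b then 1 else 0) \<in> V} =
            (if 1 \<in> V then stone_clopen b else {}) \<union> (if 0 \<in> V then stone_clopen (- b) else {})"
      unfolding stone_clopen_compl[symmetric]
      using openin_subset[OF openin_stone_clopen, of b] by auto
    then show "openin stone_space
        {U \<in> stone_points. (if U \<in> stone_clopen b then 1 else 0) \<in> V}"
      by (simp add: openin_stone_clopen openin_Un)
  qed simp
  show "\<forall>U. U \<notin> stone_points \<longrightarrow> (if U \<in> stone_clopen b then 1 else (0::ereal)) = 0"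
    using openin_subset[OF openin_stone_clopen, of b] by auto
  have "{U \<in> stone_points. \<bar>if U \<in> stone_clopen b then 1 else (0::ereal)\<bar> = \<infinity>} = {}"
    by simp
  then show "nowhere_dense_in stone_space
      {U \<in> stone_points. \<bar>if U \<in> stone_clopen b then 1 else (0::ereal)\<bar> = \<infinity>}"
    by (simp only:) (simp add: nowhere_dense_in_def)
qed

(* Operations are computed pointwise on the dense open set where both arguments are finite and
   extended by continuity; the extension is unique by density and exists because the Stone
   space of a complete Boolean algebra is extremally disconnected. *)
definition L0_lift2 :: "(real \<Rightarrow> real \<Rightarrow> real) \<Rightarrow> 'b::{boolean_algebra,complete_lattice} L0 \<Rightarrow> 'b L0 \<Rightarrow> 'b L0"
  where
  "L0_lift2 f x y = (THE z. \<forall>U\<in>stone_points.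
      \<bar>L0_fun x U\<bar> \<noteq> \<infinity> \<and> \<bar>L0_fun y U\<bar> \<noteq> \<infinity> \<longrightarrow>
      L0_fun z U = ereal (f (real_of_ereal (L0_fun x U)) (real_of_ereal (L0_fun y U))))"

instantiation L0 :: ("{boolean_algebra,complete_lattice}")
  "{zero, one, plus, minus, uminus, times, scaleR, ord}"
begin

definition zero_L0 :: "'a L0" where "0 = L0_const 0"
definition one_L0 :: "'a L0" where "1 = L0_const 1"
definition plus_L0 :: "'a L0 \<Rightarrow> 'a L0 \<Rightarrow> 'a L0" where "x + y = L0_lift2 (+) x y"
definition minus_L0 :: "'a L0 \<Rightarrow> 'a L0 \<Rightarrow> 'a L0" where "x - y = L0_lift2 (-) x y"
definition uminus_L0 :: "'a L0 \<Rightarrow> 'a L0" where "- x = L0_lift2 (\<lambda>s _. - s) x x"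
definition times_L0 :: "'a L0 \<Rightarrow> 'a L0 \<Rightarrow> 'a L0" where "x * y = L0_lift2 (*) x y"
definition scaleR_L0 :: "real \<Rightarrow> 'a L0 \<Rightarrow> 'a L0"
  where "r *\<^sub>R x = L0_lift2 (\<lambda>s _. r * s) x x"
definition less_eq_L0 :: "'a L0 \<Rightarrow> 'a L0 \<Rightarrow> bool"
  where "x \<le> y \<longleftrightarrow> (\<forall>U\<in>stone_points. L0_fun x U \<le> L0_fun y U)"
definition less_L0 :: "'a L0 \<Rightarrow> 'a L0 \<Rightarrow> bool"
  where "x < y \<longleftrightarrow> x \<le> y \<and> \<not> y \<le> (x :: 'a L0)"

instance ..

end

section \<open>Complexification\<close>

declare [[typedef_overloaded]]

datatype ('b::"{boolean_algebra,complete_lattice}") L0C =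
  L0_Complex (ReL: "'b L0") (ImL: "'b L0")

instantiation L0C :: ("{boolean_algebra,complete_lattice}")
  "{zero, one, plus, minus, uminus, times}"
begin

definition zero_L0C :: "'a L0C" where "0 = L0_Complex 0 0"
definition one_L0C :: "'a L0C" where "1 = L0_Complex 1 0"
definition plus_L0C :: "'a L0C \<Rightarrow> 'a L0C \<Rightarrow> 'a L0C"
  where "z + w = L0_Complex (ReL z + ReL w) (ImL z + ImL w)"
definition minus_L0C :: "'a L0C \<Rightarrow> 'a L0C \<Rightarrow> 'a L0C"
  where "z - w = L0_Complex (ReL z - ReL w) (ImL z - ImL w)"
definition uminus_L0C :: "'a L0C \<Rightarrow> 'a L0C"
  where "- z = L0_Complex (- ReL z) (- ImL z)"
definition times_L0C :: "'a L0C \<Rightarrow> 'a L0C \<Rightarrow> 'a L0C"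
  where "z * w = L0_Complex (ReL z * ReL w - ImL z * ImL w) (ReL z * ImL w + ImL z * ReL w)"

instance ..

end

definition scaleL :: "complex \<Rightarrow> 'b::{boolean_algebra,complete_lattice} L0C \<Rightarrow> 'b L0C" where
  "scaleL c z = L0_Complex (Re c *\<^sub>R ReL z - Im c *\<^sub>R ImL z) (Re c *\<^sub>R ImL z + Im c *\<^sub>R ReL z)"

definition cnjL :: "'b::{boolean_algebra,complete_lattice} L0C \<Rightarrow> 'b L0C" where
  "cnjL z = L0_Complex (ReL z) (- ImL z)"

definition of_L0 :: "'b::{boolean_algebra,complete_lattice} L0 \<Rightarrow> 'b L0C" where
  "of_L0 x = L0_Complex x 0"

definition modulusL :: "'b::{boolean_algebra,complete_lattice} L0C \<Rightarrow> 'b L0" where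
  "modulusL z = (THE r. 0 \<le> r \<and> of_L0 (r * r) = cnjL z * z)"

definition idemL :: "'b \<Rightarrow> 'b::{boolean_algebra,complete_lattice} L0C" where
  "idemL e = of_L0 (L0_chi e)"

definition C_Stone :: "'b::{boolean_algebra,complete_lattice} L0C set" where
  "C_Stone = {z. \<forall>U\<in>stone_points. \<bar>L0_fun (ReL z) U\<bar> \<noteq> \<infinity> \<and> \<bar>L0_fun (ImL z) U\<bar> \<noteq> \<infinity>}"

section \<open>Supports and distributivity\<close>

definition support :: "'b::{boolean_algebra,complete_lattice} L0C \<Rightarrow> 'b" where
  "support z = - Sup {e. L0_chi e * modulusL z = 0}"

definition support_set :: "'b::{boolean_algebra,complete_lattice} L0C set \<Rightarrow> 'b" where
  "support_set E = (SUP z\<in>E. support z)"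

(* Sigma-distributivity of the algebra {q. q \<le> e}; the index sets are non-empty, so the suprema
   and infima taken in the whole algebra are those of the algebra below e. *)
definition sigma_distributive_below :: "'b::{boolean_algebra,complete_lattice} \<Rightarrow> bool" where
  "sigma_distributive_below e \<longleftrightarrow>
     (\<forall>q :: nat \<Rightarrow> nat \<Rightarrow> 'b. (\<forall>n m. q n m \<le> e) \<longrightarrow>
        (SUP n. INF m. q n m) = (INF \<phi>\<in>(UNIV :: (nat \<Rightarrow> nat) set). SUP n. q n (\<phi> n)))"

section \<open>Ideals, solid spaces, derivations\<close>

definition subspaceL :: "'b::{boolean_algebra,complete_lattice} L0C set \<Rightarrow> bool" where
  "subspaceL V \<longleftrightarrow> 0 \<in> V \<and> (\<forall>x\<in>V. \<forall>y\<in>V. x + y \<in> V) \<and> (\<forall>c. \<forall>x\<in>V. scaleL c x \<in> V)"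

definition ideal_C_Stone :: "'b::{boolean_algebra,complete_lattice} L0C set \<Rightarrow> bool" where
  "ideal_C_Stone X \<longleftrightarrow>
     X \<subseteq> C_Stone \<and> subspaceL X \<and> (\<forall>x\<in>X. \<forall>y\<in>X. x * y \<in> X) \<and>
     (\<forall>x\<in>C_Stone. \<forall>a\<in>X. x * a \<in> X)"

definition solid_space :: "'b::{boolean_algebra,complete_lattice} L0C set \<Rightarrow> bool" where
  "solid_space Y \<longleftrightarrow>
     subspaceL Y \<and> Y \<noteq> {0} \<and> (\<forall>x\<in>Y. \<forall>y. modulusL y \<le> modulusL x \<longrightarrow> y \<in> Y)"

definition quasi_norm_on ::
  "'b::{boolean_algebra,complete_lattice} L0C set \<Rightarrow> ('b L0C \<Rightarrow> real) \<Rightarrow> bool" where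
  "quasi_norm_on Y N \<longleftrightarrow>
     (\<exists>C\<ge>1. \<forall>x\<in>Y. \<forall>y\<in>Y. \<forall>c.
        N x \<ge> 0 \<and> (N x = 0 \<longleftrightarrow> x = 0) \<and> N (scaleL c x) = cmod c * N x \<and>
        N (x + y) \<le> C * (N x + N y))"

definition monotone_norm_on ::
  "'b::{boolean_algebra,complete_lattice} L0C set \<Rightarrow> ('b L0C \<Rightarrow> real) \<Rightarrow> bool" where
  "monotone_norm_on Y N \<longleftrightarrow> (\<forall>x\<in>Y. \<forall>y\<in>Y. modulusL y \<le> modulusL x \<longrightarrow> N y \<le> N x)"

definition derivation_on ::
  "'b::{boolean_algebra,complete_lattice} L0C set \<Rightarrow> 'b L0C set \<Rightarrow> ('b L0C \<Rightarrow> 'b L0C) \<Rightarrow> bool" where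
  "derivation_on X Y \<delta> \<longleftrightarrow>
     \<delta> ` X \<subseteq> Y \<and>
     (\<forall>x\<in>X. \<forall>y\<in>X. \<delta> (x + y) = \<delta> x + \<delta> y) \<and>
     (\<forall>c. \<forall>x\<in>X. \<delta> (scaleL c x) = scaleL c (\<delta> x)) \<and>
     (\<forall>x\<in>X. \<forall>y\<in>X. \<delta> (x * y) = \<delta> x * y + x * \<delta> y)"

definition band_preserving_on ::
  "'b::{boolean_algebra,complete_lattice} L0C set \<Rightarrow> ('b L0C \<Rightarrow> 'b L0C) \<Rightarrow> bool" where
  "band_preserving_on X \<delta> \<longleftrightarrow> (\<forall>x\<in>X. support (\<delta> x) \<le> support x)"

end

theory Submission
  imports Defs "HOL-Computational_Algebra.Polynomial"
begin

text \<open>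
  Write \<open>L\<close> for the algebra of extended complex functions on the Stone space and \<open>e L\<close> for the band
  of an idempotent \<open>e\<close>. Two things happen to a band preserving derivation \<open>\<delta>\<close>.

  First, \<open>\<delta>\<close> commutes with multiplication by idempotents and kills them, so it vanishes wherever its
  argument is constant. If the algebra below \<open>e\<close> is \<open>\<sigma>\<close>-distributive, then every element of \<open>L\<close> is
  constant on a dense set of pieces of \<open>e\<close>: for each \<open>n\<close> the sets where it is within \<open>1/n\<close> of a point of
  a countable dense set cover \<open>e\<close>, and distributivity chooses one of these sets for every \<open>n\<close> at once.
  Hence no part of the support of a value of \<open>\<delta>\<close> is \<open>\<sigma>\<close>-distributive
  (\<open>support_not_sigma_distributive\<close>).

  Secondly, \<open>\<delta>\<close> is wildly unbounded. Subtracting a locally constant \<open>t\<close> from \<open>x\<close> leaves \<open>\<delta> x\<close>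
  unchanged, and multiplying by a locally constant \<open>f\<close> multiplies the value by \<open>f\<close>. Choosing \<open>t\<close> with
  \<open>\<bar>x - t\<bar> \<le> 1/f\<close>, the element \<open>f (x - t)\<close> is bounded, hence in the ideal up to an idempotent factor,
  while \<open>\<delta> (f (x - t)) = f \<delta> x\<close> is as large as desired. Where \<open>\<delta> x\<close> is bounded away from zero,
  solidity therefore puts a whole band \<open>e L\<close> into the target space (\<open>values_fill_band\<close>). Such a band
  contains, for a disjoint sequence of non-zero idempotents, an element with any prescribed constants
  on the terms of the sequence. This is incompatible with a monotone quasi-norm and with boundedness
  (\<open>full_band_no_quasi_norm\<close>, \<open>full_band_unbounded\<close>), which gives the second part of the theorem.

  For the existence statement, failure of \<open>\<sigma>\<close>-distributivity below \<open>e\<close> yields a continuous function \<open>b\<close>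
  that is constant on no part of some non-zero \<open>e\<^sub>0 \<le> e\<close>: code the indicators of a violating
  double sequence into one series with ternary digits (\<open>nowhere_constant_element\<close>). Such a \<open>b\<close> satisfies
  no polynomial equation over the locally constant elements below \<open>e\<^sub>0\<close>, so the zero derivation on
  these extends to one that sends \<open>b\<close> to \<open>e\<^sub>0\<close>. It then extends to all of \<open>L\<close> by Zorn's lemma: a
  new element \<open>z\<close> is, on a dense set of pieces, either a root of a polynomial of minimal degree, whose
  derivative is invertible at \<open>z\<close> there and so determines the value, or free of relations, so that
  the value is arbitrary; the pieces are glued because \<open>L\<close> is closed under mixing
  (\<open>global_slope\<close>, \<open>derivation_graph_total\<close>, \<open>derivation_exists\<close>). Multiplying by \<open>e\<close> moves the values into
  the band contained in the target space.

  All computations in \<open>L\<close> are made with complex values on open dense subsets of the Stone space. This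
  rests on one topological fact: a continuous function on an open dense set extends to the whole
  space, because the closure of an open set is clopen (\<open>real_extension\<close>).
\<close>

section \<open>Ultrafilters and the Stone topology\<close>

lemma bool_ultrafilter_top [simp]: "bool_ultrafilter U \<Longrightarrow> top \<in> U"
  and bool_ultrafilter_bot [simp]: "bool_ultrafilter U \<Longrightarrow> bot \<notin> U"
  and bool_ultrafilter_mono: "bool_ultrafilter U \<Longrightarrow> a \<in> U \<Longrightarrow> a \<le> b \<Longrightarrow> b \<in> U"
  unfolding bool_ultrafilter_def by blast+

lemma bool_ultrafilter_inf: "bool_ultrafilter U \<Longrightarrow> inf a b \<in> U \<longleftrightarrow> a \<in> U \<and> b \<in> U"
  unfolding bool_ultrafilter_def by (meson inf_le1 inf_le2)

lemma bool_ultrafilter_compl: "bool_ultrafilter U \<Longrightarrow> - a \<in> U \<longleftrightarrow> a \<notin> U"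
  using bool_ultrafilter_inf[of U a "- a"] unfolding bool_ultrafilter_def by (metis inf_compl_bot)

definition bool_filter :: "'b::boolean_algebra set \<Rightarrow> bool" where
  "bool_filter F \<longleftrightarrow> top \<in> F \<and> bot \<notin> F \<and> (\<forall>a\<in>F. \<forall>b. a \<le> b \<longrightarrow> b \<in> F) \<and> (\<forall>a\<in>F. \<forall>b\<in>F. inf a b \<in> F)"

text \<open>A filter that is maximal among those above \<open>F\<close> is an ultrafilter: if it contains neither \<open>a\<close> nor its
complement, the filter generated by it and \<open>a\<close> is still proper.\<close>

lemma bool_filter_extend:
  fixes F :: "'b::boolean_algebra set"
  assumes "bool_filter F"
  obtains U where "bool_ultrafilter U" "F \<subseteq> U"
proof -
  have "\<exists>M\<in>{G. bool_filter G \<and> F \<subseteq> G}. \<forall>X\<in>{G. bool_filter G \<and> F \<subseteq> G}. M \<subseteq> X \<longrightarrow> X = M"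
  proof (rule subset_Zorn_nonempty)
    show "{G. bool_filter G \<and> F \<subseteq> G} \<noteq> {}" using assms by blast
    fix \<C> assume ne: "\<C> \<noteq> {}" and ch: "subset.chain {G. bool_filter G \<and> F \<subseteq> G} \<C>"
    have sub: "bool_filter G" "F \<subseteq> G" if "G \<in> \<C>" for G
      using ch that unfolding subset_chain_def by auto
    have "inf a b \<in> \<Union>\<C>" if "a \<in> \<Union>\<C>" "b \<in> \<Union>\<C>" for a b
    proof -
      obtain G H where "a \<in> G" "b \<in> H" "G \<in> \<C>" "H \<in> \<C>" using \<open>a \<in> \<Union>\<C>\<close> \<open>b \<in> \<Union>\<C>\<close> by blast
      moreover have "G \<subseteq> H \<or> H \<subseteq> G" using ch \<open>G \<in> \<C>\<close> \<open>H \<in> \<C>\<close> unfolding subset_chain_def by blast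
      ultimately obtain K where "K \<in> \<C>" "a \<in> K" "b \<in> K" by blast
      then have "inf a b \<in> K" using sub(1) unfolding bool_filter_def by blast
      then show ?thesis using \<open>K \<in> \<C>\<close> by blast
    qed
    moreover have "top \<in> \<Union>\<C>"
      using sub(1) ne unfolding bool_filter_def by blast
    moreover have "bot \<notin> \<Union>\<C>"
      using sub(1) unfolding bool_filter_def by blast
    moreover have "b \<in> \<Union>\<C>" if "a \<in> \<Union>\<C>" "a \<le> b" for a b
      using sub(1) that unfolding bool_filter_def by (meson UnionE UnionI)
    ultimately have "bool_filter (\<Union>\<C>)"
      unfolding bool_filter_def by simp
    then show "\<Union>\<C> \<in> {G. bool_filter G \<and> F \<subseteq> G}"
      using sub(2) ne by blast
  qed
  then obtain M where M0: "M \<in> {G. bool_filter G \<and> F \<subseteq> G}"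
    and M1: "\<forall>X\<in>{G. bool_filter G \<and> F \<subseteq> G}. M \<subseteq> X \<longrightarrow> X = M" ..
  from M0 have M: "bool_filter M" "F \<subseteq> M" by simp_all
  have maximal: "G = M" if "bool_filter G" "M \<subseteq> G" for G
  proof -
    have "F \<subseteq> G" using M(2) that(2) by (rule order_trans)
    with M1 that show ?thesis by simp
  qed
  have "a \<in> M \<or> - a \<in> M" for a
  proof (rule ccontr)
    assume "\<not> (a \<in> M \<or> - a \<in> M)"
    then have a: "a \<notin> M" "- a \<notin> M" by auto
    define G where "G = {x. \<exists>m\<in>M. inf m a \<le> x}"
    have "bot \<notin> G"
    proof
      assume "bot \<in> G"
      then obtain m where "m \<in> M" "inf m a \<le> bot" by (auto simp: G_def)
      then have "m \<le> - a" by (simp add: inf_shunt bot_unique)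
      with \<open>m \<in> M\<close> a(2) M(1) show False unfolding bool_filter_def by blast
    qed
    moreover have "inf x y \<in> G" if xy: "x \<in> G" "y \<in> G" for x y
    proof -
      obtain m n where "m \<in> M" "n \<in> M" "inf m a \<le> x" "inf n a \<le> y"
        using xy by (auto simp: G_def)
      then have "inf m n \<in> M" "inf (inf m n) a \<le> inf x y"
        using M(1) by (auto simp: bool_filter_def intro: le_infI1 le_infI2)
          (meson inf.cobounded1 inf.cobounded2 inf_mono le_infI order_trans order_refl)+
      then show ?thesis by (auto simp: G_def)
    qed
    moreover have "top \<in> G" "\<forall>x\<in>G. \<forall>y. x \<le> y \<longrightarrow> y \<in> G" "M \<subseteq> G"
      using M(1) by (auto simp: G_def bool_filter_def intro: order_trans le_infI1)
    ultimately have "G = M" using maximal by (simp add: bool_filter_def)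
    moreover have "a \<in> G" using M(1) by (auto simp: G_def bool_filter_def)
    ultimately show False using a by simp
  qed
  with M that show ?thesis unfolding bool_filter_def bool_ultrafilter_def by blast
qed

lemma stone_pointI: "U \<in> stone_clopen b \<Longrightarrow> U \<in> stone_points"
  by (simp add: topspace_stone_space stone_clopen_def)

lemma stone_clopen_inf: "stone_clopen (inf a b) = stone_clopen a \<inter> stone_clopen b"
  by (auto simp: stone_clopen_def bool_ultrafilter_inf)

lemma stone_clopen_mono: "a \<le> b \<Longrightarrow> stone_clopen a \<subseteq> stone_clopen b"
  by (auto simp: stone_clopen_def intro: bool_ultrafilter_mono)

lemma stone_clopen_compl_iff: "U \<in> stone_points \<Longrightarrow> U \<in> stone_clopen (- b) \<longleftrightarrow> U \<notin> stone_clopen b"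
  using stone_clopen_compl by blast

lemma stone_clopen_top: "stone_clopen top = stone_points"
  by (auto simp: stone_clopen_def topspace_stone_space)

lemma stone_clopen_bot [simp]: "stone_clopen bot = {}"
  by (auto simp: stone_clopen_def)

lemma stone_clopen_nonempty: "b \<noteq> bot \<Longrightarrow> stone_clopen b \<noteq> {}"
proof -
  assume "b \<noteq> bot"
  then have "bool_filter {x. b \<le> x}" by (auto simp: bool_filter_def bot_unique)
  then obtain U where "bool_ultrafilter U" "{x. b \<le> x} \<subseteq> U" by (rule bool_filter_extend)
  then show ?thesis by (auto simp: stone_clopen_def)
qed

lemma stone_clopen_disjoint: "stone_clopen a \<inter> stone_clopen b = {} \<longleftrightarrow> inf a b = bot"
  using stone_clopen_nonempty stone_clopen_inf by (metis stone_clopen_bot)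

lemma stone_clopen_subset: "stone_clopen a \<subseteq> stone_clopen b \<longleftrightarrow> a \<le> b"
proof
  assume "stone_clopen a \<subseteq> stone_clopen b"
  then have "stone_clopen a \<inter> stone_clopen (- b) = {}" using stone_clopen_compl by blast
  from iffD1[OF stone_clopen_disjoint this] show "a \<le> b" by (simp add: inf_shunt)
qed (rule stone_clopen_mono)

text \<open>The clopen sets are closed under intersection, so the subbasis that generates the topology is a basis.\<close>

lemma openin_stone_space:
  "openin stone_space O' \<longleftrightarrow> (\<forall>U\<in>O'. \<exists>b. U \<in> stone_clopen b \<and> stone_clopen b \<subseteq> O')"
proof
  assume "openin stone_space O'"
  then have "generate_topology_on (range stone_clopen) O'"
    by (simp add: stone_space_def openin_topology_generated_by)
  then show "\<forall>U\<in>O'. \<exists>b. U \<in> stone_clopen b \<and> stone_clopen b \<subseteq> O'"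
  proof induction
    case (Int A B)
    show ?case
    proof
      fix U assume "U \<in> A \<inter> B"
      then obtain a b where "U \<in> stone_clopen a" "stone_clopen a \<subseteq> A" "U \<in> stone_clopen b" "stone_clopen b \<subseteq> B"
        using Int by blast
      then have "U \<in> stone_clopen (inf a b)" "stone_clopen (inf a b) \<subseteq> A \<inter> B"
        by (auto simp: stone_clopen_inf)
      then show "\<exists>b. U \<in> stone_clopen b \<and> stone_clopen b \<subseteq> A \<inter> B" by blast
    qed
  qed (auto, meson Sup_upper order_trans)
next
  assume "\<forall>U\<in>O'. \<exists>b. U \<in> stone_clopen b \<and> stone_clopen b \<subseteq> O'"
  then show "openin stone_space O'"
    by (subst openin_subopen) (use openin_stone_clopen in blast)
qed

lemma eventually_nhdsin_stone:
  assumes "U \<in> stone_points"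
  shows "eventually P (nhdsin stone_space U) \<longleftrightarrow> (\<exists>b. U \<in> stone_clopen b \<and> (\<forall>V\<in>stone_clopen b. P V))"
proof
  assume "eventually P (nhdsin stone_space U)"
  then obtain S where S: "openin stone_space S" "U \<in> S" "\<forall>V\<in>S. P V"
    using assms unfolding eventually_nhdsin by blast
  from S(1,2) obtain b where "U \<in> stone_clopen b" "stone_clopen b \<subseteq> S"
    unfolding openin_stone_space by blast
  with S(3) show "\<exists>b. U \<in> stone_clopen b \<and> (\<forall>V\<in>stone_clopen b. P V)" by blast
next
  assume "\<exists>b. U \<in> stone_clopen b \<and> (\<forall>V\<in>stone_clopen b. P V)"
  then show "eventually P (nhdsin stone_space U)"
    unfolding eventually_nhdsin using openin_stone_clopen by metis
qed

text \<open>Continuity as convergence along neighbourhood filters gives access to the limit calculus of the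
library, also at the points of an open subset only.\<close>

lemma continuous_map_stone:
  fixes f :: "'b::boolean_algebra set \<Rightarrow> 'a::topological_space"
  shows "continuous_map stone_space euclidean f \<longleftrightarrow> (\<forall>U\<in>stone_points. (f \<longlongrightarrow> f U) (nhdsin stone_space U))"
proof
  assume f: "continuous_map stone_space euclidean f"
  show "\<forall>U\<in>stone_points. (f \<longlongrightarrow> f U) (nhdsin stone_space U)"
  proof (intro ballI topological_tendstoI)
    fix U :: "'b set" and S assume "U \<in> stone_points" "open S" "f U \<in> S"
    then have "openin stone_space {V \<in> stone_points. f V \<in> S}" "U \<in> {V \<in> stone_points. f V \<in> S}"
      using f by (auto simp: continuous_map)
    then show "\<forall>\<^sub>F V in nhdsin stone_space U. f V \<in> S" unfolding eventually_nhdsin by blast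
  qed
next
  assume f: "\<forall>U\<in>stone_points. (f \<longlongrightarrow> f U) (nhdsin stone_space U)"
  have "openin stone_space {U \<in> stone_points. f U \<in> S}" if "open S" for S
    unfolding openin_stone_space
  proof
    fix U assume U: "U \<in> {U \<in> stone_points. f U \<in> S}"
    then have "\<forall>\<^sub>F V in nhdsin stone_space U. f V \<in> S" using f \<open>open S\<close> topological_tendstoD by blast
    then show "\<exists>b. U \<in> stone_clopen b \<and> stone_clopen b \<subseteq> {U \<in> stone_points. f U \<in> S}"
      using U stone_pointI by (auto simp: eventually_nhdsin_stone)
  qed
  then show "continuous_map stone_space euclidean f" by (auto simp: continuous_map)
qed

lemma nhdsin_stone_neq_bot: "U \<in> stone_points \<Longrightarrow> nhdsin stone_space U \<noteq> bot"
  by (auto simp: trivial_limit_def eventually_nhdsin_stone)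

section \<open>Open dense sets\<close>

definition open_dense :: "'b::boolean_algebra set set \<Rightarrow> bool" where
  "open_dense W \<longleftrightarrow> openin stone_space W \<and> (\<forall>b. b \<noteq> bot \<longrightarrow> stone_clopen b \<inter> W \<noteq> {})"

lemma open_dense_subset: "open_dense W \<Longrightarrow> W \<subseteq> stone_points"
  unfolding open_dense_def by (simp add: openin_subset)

lemma open_dense_nbhd:
  assumes "open_dense W" "U \<in> W"
  obtains b where "U \<in> stone_clopen b" "stone_clopen b \<subseteq> W"
  using assms unfolding open_dense_def openin_stone_space by blast

lemma open_dense_refine:
  assumes "open_dense W" "b \<noteq> bot"
  obtains c where "c \<noteq> bot" "c \<le> b" "stone_clopen c \<subseteq> W"
proof -
  obtain U where U: "U \<in> stone_clopen b" "U \<in> W" using assms unfolding open_dense_def by blast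
  then obtain a where a: "U \<in> stone_clopen a" "stone_clopen a \<subseteq> W" using open_dense_nbhd assms by blast
  show thesis
  proof (rule that)
    show "inf a b \<noteq> bot" using U a by (metis IntI empty_iff stone_clopen_disjoint)
  qed (use a stone_clopen_inf in auto)
qed

lemma open_denseI:
  assumes "\<And>U. U \<in> W \<Longrightarrow> \<exists>b. U \<in> stone_clopen b \<and> stone_clopen b \<subseteq> W"
    and "\<And>b. b \<noteq> bot \<Longrightarrow> \<exists>U. U \<in> stone_clopen b \<and> U \<in> W"
  shows "open_dense W"
  unfolding open_dense_def openin_stone_space using assms by blast

lemma open_dense_Int [intro]:
  assumes "open_dense V" "open_dense W"
  shows "open_dense (V \<inter> W)"
  unfolding open_dense_def
proof (intro conjI allI impI)
  show "openin stone_space (V \<inter> W)" using assms by (simp add: open_dense_def openin_Int)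
  fix b :: 'a assume "b \<noteq> bot"
  then obtain c where "c \<noteq> bot" "c \<le> b" "stone_clopen c \<subseteq> V" using assms(1) open_dense_refine by blast
  then show "stone_clopen b \<inter> (V \<inter> W) \<noteq> {}"
    using assms(2) stone_clopen_mono[of c b] unfolding open_dense_def by blast
qed

lemma open_dense_points [simp]: "open_dense stone_points"
  unfolding open_dense_def using stone_clopen_nonempty stone_pointI by (metis disjoint_iff ex_in_conv openin_topspace)

lemma open_dense_eventually:
  "open_dense W \<Longrightarrow> U \<in> W \<Longrightarrow> \<forall>\<^sub>F V in nhdsin stone_space U. V \<in> W"
  unfolding open_dense_def eventually_nhdsin by blast

lemma open_dense_complI:
  assumes "closedin stone_space S" "nowhere_dense_in stone_space S"
  shows "open_dense (stone_points - S)"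
  unfolding open_dense_def
proof (intro conjI allI impI)
  fix b :: 'a assume "b \<noteq> bot"
  show "stone_clopen b \<inter> (stone_points - S) \<noteq> {}"
  proof
    assume "stone_clopen b \<inter> (stone_points - S) = {}"
    then have "stone_clopen b \<subseteq> S" using stone_pointI by blast
    then have "stone_clopen b \<subseteq> stone_space interior_of S"
      by (simp add: interior_of_maximal openin_stone_clopen)
    with assms show False using stone_clopen_nonempty[OF \<open>b \<noteq> bot\<close>]
      by (simp add: nowhere_dense_in_def closure_of_closedin)
  qed
qed (use assms in auto)

lemma nowhere_denseI:
  assumes "closedin stone_space S" "open_dense W" "S \<inter> W = {}"
  shows "nowhere_dense_in stone_space S"
proof -
  have "stone_space interior_of S = {}"
  proof (rule ccontr)
    assume "stone_space interior_of S \<noteq> {}"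
    then obtain U where "U \<in> stone_space interior_of S" by blast
    then obtain b where "U \<in> stone_clopen b" "stone_clopen b \<subseteq> stone_space interior_of S"
      using openin_interior_of openin_stone_space by metis
    moreover from this have "b \<noteq> bot" by auto
    ultimately have "S \<inter> W \<noteq> {}"
      using assms(2) interior_of_subset[of stone_space S] unfolding open_dense_def by fast
    with assms show False by simp
  qed
  then show ?thesis using assms by (simp add: nowhere_dense_in_def closure_of_closedin)
qed

subsection \<open>Closures of open sets\<close>

text \<open>The one instance of infinite distributivity that holds in every complete Boolean algebra, in the form
in which it is used throughout.\<close>

lemma Sup_disjoint:
  fixes c :: "'b::{boolean_algebra,complete_lattice}"
  shows "inf (Sup D) c = bot \<longleftrightarrow> (\<forall>d\<in>D. inf d c = bot)"
proof -
  have "Sup D \<le> - c \<longleftrightarrow> (\<forall>d\<in>D. d \<le> - c)" by (simp add: Sup_le_iff)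
  then show ?thesis by (simp add: inf_shunt)
qed

text \<open>The clopen set of \<open>open_hull S\<close> is the closure of the interior of \<open>S\<close>. This is where completeness of
the Boolean algebra enters: it makes the Stone space extremally disconnected.\<close>

definition open_hull :: "'b::{boolean_algebra,complete_lattice} set set \<Rightarrow> 'b" where
  "open_hull S = Sup {b. stone_clopen b \<subseteq> S}"

lemma open_hull_upper: "stone_clopen b \<subseteq> S \<Longrightarrow> b \<le> open_hull S"
  by (simp add: open_hull_def Sup_upper)

lemma open_hull_disjoint: "stone_clopen c \<inter> S = {} \<Longrightarrow> inf (open_hull S) c = bot"
  unfolding open_hull_def Sup_disjoint by (rule ballI, rule iffD1[OF stone_clopen_disjoint]) blast

lemma open_hull_mono: "S \<subseteq> T \<Longrightarrow> open_hull S \<le> open_hull T"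
  unfolding open_hull_def by (rule Sup_subset_mono) auto

lemma open_hull_nbhd:
  assumes "\<forall>\<^sub>F V in nhdsin stone_space U. V \<in> S" "U \<in> stone_points"
  shows "U \<in> stone_clopen (open_hull S)"
proof -
  obtain b where b: "U \<in> stone_clopen b" "\<forall>V\<in>stone_clopen b. V \<in> S"
    using assms(1) unfolding eventually_nhdsin_stone[OF assms(2)] by blast
  then have "b \<le> open_hull S" by (intro open_hull_upper subsetI) blast
  with b(1) show ?thesis using stone_clopen_mono by blast
qed

section \<open>Extension of continuous functions\<close>

lemma closed_infinite_ereal: "closed {x::ereal. \<bar>x\<bar> = \<infinity>}"
proof -
  have "{x::ereal. \<bar>x\<bar> = \<infinity>} = {-\<infinity>, \<infinity>}" by auto
  then show ?thesis by simp
qed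

text \<open>The extension is built from its upper level sets: for each real \<open>r\<close> the closure \<open>S r\<close> of the set
\<open>f > r\<close> is clopen, these sets decrease with \<open>r\<close>, and the value at \<open>U\<close> is the supremum of the \<open>r\<close> with
\<open>U\<close> in \<open>S r\<close>. That the \<open>S r\<close> are open makes the extension lower semicontinuous; that they are closed
makes it upper semicontinuous.\<close>

theorem real_extension:
  fixes f :: "'b::{boolean_algebra,complete_lattice} set \<Rightarrow> real"
  assumes W: "open_dense W" and f: "\<And>U. U \<in> W \<Longrightarrow> (f \<longlongrightarrow> f U) (nhdsin stone_space U)"
  obtains x :: "'b L0" where "\<And>U. U \<in> W \<Longrightarrow> L0_fun x U = ereal (f U)"
proof -
  define S where "S r = open_hull {U \<in> W. f U > r}" for r
  define F where "F U = (if U \<in> stone_points then SUP r\<in>{r. U \<in> stone_clopen (S r)}. ereal r else 0)" for U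
  have S_anti: "S r' \<le> S r" if "r \<le> r'" for r r'
    unfolding S_def using that by (intro open_hull_mono) auto
  have F_greater: "F U > a \<longleftrightarrow> (\<exists>r. ereal r > a \<and> U \<in> stone_clopen (S r))" if "U \<in> stone_points" for a U
    using that by (auto simp: F_def less_SUP_iff)
  have F_less: "F U < a \<longleftrightarrow> (\<exists>r. ereal r < a \<and> U \<notin> stone_clopen (S r))" if "U \<in> stone_points" for a U
  proof
    assume "F U < a"
    then obtain r where r: "F U < ereal r" "ereal r < a" using ereal_dense2 by blast
    then have "U \<notin> stone_clopen (S r)" using that SUP_lessD[of ereal "{r. U \<in> stone_clopen (S r)}" "ereal r" r]
      by (auto simp: F_def)
    with r show "\<exists>r. ereal r < a \<and> U \<notin> stone_clopen (S r)" by blast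
  next
    assume "\<exists>r. ereal r < a \<and> U \<notin> stone_clopen (S r)"
    then obtain r where r: "ereal r < a" "U \<notin> stone_clopen (S r)" by blast
    have "r' \<le> r" if "U \<in> stone_clopen (S r')" for r'
      using that r S_anti[of r r'] stone_clopen_mono by (meson linear subsetD)
    then have "F U \<le> ereal r" using that by (auto simp: F_def intro!: SUP_least)
    with r show "F U < a" by simp
  qed
  have cont: "continuous_map stone_space euclidean F"
    unfolding continuous_map_stone
  proof (intro ballI order_tendstoI)
    fix U :: "'b set" and a assume U: "U \<in> stone_points"
    show "\<forall>\<^sub>F V in nhdsin stone_space U. a < F V" if "a < F U"
    proof -
      obtain r where "ereal r > a" "U \<in> stone_clopen (S r)" using iffD1[OF F_greater[OF U] \<open>a < F U\<close>] by blast
      moreover have "a < F V" if "V \<in> stone_clopen (S r)" for V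
        using iffD2[OF F_greater[OF stone_pointI[OF that]]] that \<open>ereal r > a\<close> by blast
      ultimately show ?thesis unfolding eventually_nhdsin_stone[OF U] by blast
    qed
    show "\<forall>\<^sub>F V in nhdsin stone_space U. F V < a" if "F U < a"
    proof -
      obtain r where "ereal r < a" "U \<notin> stone_clopen (S r)" using iffD1[OF F_less[OF U] \<open>F U < a\<close>] by blast
      moreover have "U \<in> stone_clopen (- S r)"
        using U stone_clopen_compl_iff \<open>U \<notin> stone_clopen (S r)\<close> by blast
      moreover have "F V < a" if V: "V \<in> stone_clopen (- S r)" for V
      proof -
        have "V \<notin> stone_clopen (S r)" using V stone_clopen_compl_iff[OF stone_pointI[OF V]] by blast
        then show ?thesis using iffD2[OF F_less[OF stone_pointI[OF V]]] \<open>ereal r < a\<close> by blast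
      qed
      ultimately show ?thesis unfolding eventually_nhdsin_stone[OF U] by blast
    qed
  qed
  have F: "F U = ereal (f U)" if U: "U \<in> W" for U
  proof (rule antisym)
    have Up: "U \<in> stone_points" using U W open_dense_subset by blast
    note ev = open_dense_eventually[OF W U]
    show "F U \<le> ereal (f U)"
    proof (rule dense_ge)
      fix a assume "a > ereal (f U)"
      then obtain r where r: "r > f U" "ereal r < a" using ereal_dense2 by fastforce
      then have "\<forall>\<^sub>F V in nhdsin stone_space U. f V < r" using f[OF U] by (simp add: order_tendsto_iff)
      then obtain b where b: "U \<in> stone_clopen b" "\<forall>V\<in>stone_clopen b. f V < r"
        using Up eventually_nhdsin_stone by blast
      then have "stone_clopen b \<inter> {U \<in> W. f U > r} = {}" by fastforce
      then have "inf (S r) b = bot" unfolding S_def by (rule open_hull_disjoint)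
      then have "U \<notin> stone_clopen (S r)" using b(1) iffD2[OF stone_clopen_disjoint, of "S r" b] by blast
      then show "F U \<le> a" using r(2) iffD2[OF F_less[OF Up, of a]] by (meson order_less_imp_le)
    qed
    show "ereal (f U) \<le> F U"
    proof (rule dense_le)
      fix a assume "a < ereal (f U)"
      then obtain r where r: "r < f U" "ereal r > a" using ereal_dense2 by fastforce
      then have "\<forall>\<^sub>F V in nhdsin stone_space U. f V > r" using f[OF U] by (simp add: order_tendsto_iff)
      then have "\<forall>\<^sub>F V in nhdsin stone_space U. V \<in> {U \<in> W. f U > r}" using ev by eventually_elim auto
      then have "U \<in> stone_clopen (S r)" unfolding S_def using Up by (rule open_hull_nbhd)
      then show "a \<le> F U" using r(2) iffD2[OF F_greater[OF Up, of a]] by (meson order_less_imp_le)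
    qed
  qed
  have "closedin stone_space {U \<in> stone_points. F U \<in> {x. \<bar>x\<bar> = \<infinity>}}"
    using cont closed_infinite_ereal closedin_continuous_map_preimage by fastforce
  then have "nowhere_dense_in stone_space {U \<in> stone_points. \<bar>F U\<bar> = \<infinity>}"
    using F by (intro nowhere_denseI[OF _ W]) auto
  with cont have "L0_fun (Abs_L0 F) = F" by (intro Abs_L0_inverse) (auto simp: F_def)
  with F that show thesis by metis
qed

section \<open>Values of elements of the algebra\<close>

lemma L0_fun_tendsto: "U \<in> stone_points \<Longrightarrow> (L0_fun x \<longlongrightarrow> L0_fun x U) (nhdsin stone_space U)"
  using L0_fun[of x] continuous_map_stone by blast

definition L0_dom :: "'b::{boolean_algebra,complete_lattice} L0 \<Rightarrow> 'b set set" where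
  "L0_dom x = {U \<in> stone_points. \<bar>L0_fun x U\<bar> \<noteq> \<infinity>}"

definition L0_val :: "'b::{boolean_algebra,complete_lattice} L0 \<Rightarrow> 'b set \<Rightarrow> real" where
  "L0_val x U = real_of_ereal (L0_fun x U)"

lemma L0_dom_point: "U \<in> L0_dom x \<Longrightarrow> U \<in> stone_points"
  by (simp add: L0_dom_def)

text \<open>The domain of an element is the open dense set where it is finite; all arithmetic takes place there.\<close>

lemma L0_fun_eq_val: "U \<in> L0_dom x \<Longrightarrow> L0_fun x U = ereal (L0_val x U)"
  by (simp add: L0_dom_def L0_val_def ereal_real)

lemma L0_dom_valI: "U \<in> stone_points \<Longrightarrow> L0_fun x U = ereal r \<Longrightarrow> U \<in> L0_dom x \<and> L0_val x U = r"
  by (simp add: L0_dom_def L0_val_def)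

lemma open_dense_L0_dom [simp]: "open_dense (L0_dom x)"
proof -
  have cont: "continuous_map stone_space euclidean (L0_fun x)"
    and nd: "nowhere_dense_in stone_space {U \<in> stone_points. \<bar>L0_fun x U\<bar> = \<infinity>}"
    using L0_fun[of x] by blast+
  then have "closedin stone_space {U \<in> stone_points. L0_fun x U \<in> {x. \<bar>x\<bar> = \<infinity>}}"
    using closed_infinite_ereal closedin_continuous_map_preimage by fastforce
  then have "open_dense (stone_points - {U \<in> stone_points. \<bar>L0_fun x U\<bar> = \<infinity>})"
    using nd by (intro open_dense_complI) auto
  moreover have "stone_points - {U \<in> stone_points. \<bar>L0_fun x U\<bar> = \<infinity>} = L0_dom x"
    by (auto simp: L0_dom_def)
  ultimately show ?thesis by simp
qed

lemma L0_val_tendsto: "U \<in> L0_dom x \<Longrightarrow> (L0_val x \<longlongrightarrow> L0_val x U) (nhdsin stone_space U)"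
  unfolding L0_val_def
  by (rule lim_real_of_ereal) (metis L0_dom_point L0_fun_eq_val L0_fun_tendsto L0_val_def)

lemma L0_le_dense:
  assumes W: "open_dense W" and le: "\<And>U. U \<in> W \<Longrightarrow> L0_fun x U \<le> L0_fun y U"
  shows "x \<le> y"
  unfolding less_eq_L0_def
proof (intro ballI leI notI)
  fix U :: "'a set" assume U: "U \<in> stone_points" and "L0_fun y U < L0_fun x U"
  then obtain a where a: "L0_fun y U < a" "a < L0_fun x U" using dense by blast
  have "\<forall>\<^sub>F V in nhdsin stone_space U. L0_fun y V < a" "\<forall>\<^sub>F V in nhdsin stone_space U. a < L0_fun x V"
    using L0_fun_tendsto[OF U] a by (simp_all add: order_tendsto_iff)
  then have "\<forall>\<^sub>F V in nhdsin stone_space U. L0_fun y V < L0_fun x V"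
    by eventually_elim simp
  then obtain b where b: "U \<in> stone_clopen b" "\<forall>V\<in>stone_clopen b. L0_fun y V < L0_fun x V"
    unfolding eventually_nhdsin_stone[OF U] by blast
  then have "b \<noteq> bot" by auto
  then obtain V where "V \<in> stone_clopen b" "V \<in> W" using W unfolding open_dense_def by blast
  with b(2) le[of V] show False by force
qed

lemma L0_eq_dense:
  assumes W: "open_dense W" and eq: "\<And>U. U \<in> W \<Longrightarrow> L0_fun x U = L0_fun y U"
  shows "x = y"
proof -
  have "x \<le> y" "y \<le> x" using eq by (auto intro!: L0_le_dense[OF W])
  then have "L0_fun x U = L0_fun y U" if "U \<in> stone_points" for U
    using that unfolding less_eq_L0_def by (meson antisym)
  moreover have "L0_fun x U = L0_fun y U" if "U \<notin> stone_points" for U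
    using that L0_fun[of x] L0_fun[of y] by simp
  ultimately show ?thesis by (metis L0_fun_inject ext)
qed

text \<open>The definite description in \<open>L0_lift2\<close> is met: the pointwise result is continuous on the common
domain, extends by \<open>real_extension\<close>, and density makes the extension unique.\<close>

lemma L0_lift2_val:
  assumes f: "continuous_on UNIV (\<lambda>p. f (fst p) (snd p))"
    and U: "U \<in> L0_dom x" "U \<in> L0_dom y"
  shows "U \<in> L0_dom (L0_lift2 f x y) \<and> L0_val (L0_lift2 f x y) U = f (L0_val x U) (L0_val y U)"
proof -
  let ?W = "L0_dom x \<inter> L0_dom y"
  have "((\<lambda>V. f (L0_val x V) (L0_val y V)) \<longlongrightarrow> f (L0_val x V) (L0_val y V)) (nhdsin stone_space V)"
    if "V \<in> ?W" for V
  proof -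
    have "((\<lambda>V. (L0_val x V, L0_val y V)) \<longlongrightarrow> (L0_val x V, L0_val y V)) (nhdsin stone_space V)"
      using that by (intro tendsto_Pair L0_val_tendsto) auto
    from continuous_on_tendsto_compose[OF f this] show ?thesis by simp
  qed
  then obtain z where z: "\<And>V. V \<in> ?W \<Longrightarrow> L0_fun z V = ereal (f (L0_val x V) (L0_val y V))"
    by (rule real_extension[OF open_dense_Int[OF open_dense_L0_dom[of x] open_dense_L0_dom[of y]]]) blast+
  have "L0_lift2 f x y = z"
    unfolding L0_lift2_def
  proof (rule the_equality)
    show "\<forall>U\<in>stone_points. \<bar>L0_fun x U\<bar> \<noteq> \<infinity> \<and> \<bar>L0_fun y U\<bar> \<noteq> \<infinity> \<longrightarrow>
      L0_fun z U = ereal (f (real_of_ereal (L0_fun x U)) (real_of_ereal (L0_fun y U)))"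
      using z by (simp add: L0_dom_def L0_val_def)
  next
    fix z' assume z': "\<forall>U\<in>stone_points. \<bar>L0_fun x U\<bar> \<noteq> \<infinity> \<and> \<bar>L0_fun y U\<bar> \<noteq> \<infinity> \<longrightarrow>
      L0_fun z' U = ereal (f (real_of_ereal (L0_fun x U)) (real_of_ereal (L0_fun y U)))"
    show "z' = z"
      by (rule L0_eq_dense[OF open_dense_Int[OF open_dense_L0_dom[of x] open_dense_L0_dom[of y]]])
        (use z' z in \<open>auto simp: L0_dom_def L0_val_def\<close>)
  qed
  with z[of U] U L0_dom_valI[OF L0_dom_point] show ?thesis by blast
qed

lemma L0_val_simps [simp]:
  "U \<in> L0_dom x \<Longrightarrow> U \<in> L0_dom y \<Longrightarrow> U \<in> L0_dom (x + y)"
  "U \<in> L0_dom x \<Longrightarrow> U \<in> L0_dom y \<Longrightarrow> L0_val (x + y) U = L0_val x U + L0_val y U"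
  "U \<in> L0_dom x \<Longrightarrow> U \<in> L0_dom y \<Longrightarrow> U \<in> L0_dom (x - y)"
  "U \<in> L0_dom x \<Longrightarrow> U \<in> L0_dom y \<Longrightarrow> L0_val (x - y) U = L0_val x U - L0_val y U"
  "U \<in> L0_dom x \<Longrightarrow> U \<in> L0_dom y \<Longrightarrow> U \<in> L0_dom (x * y)"
  "U \<in> L0_dom x \<Longrightarrow> U \<in> L0_dom y \<Longrightarrow> L0_val (x * y) U = L0_val x U * L0_val y U"
  "U \<in> L0_dom x \<Longrightarrow> U \<in> L0_dom (- x)"
  "U \<in> L0_dom x \<Longrightarrow> L0_val (- x) U = - L0_val x U"
  "U \<in> L0_dom x \<Longrightarrow> U \<in> L0_dom (r *\<^sub>R x)"
  "U \<in> L0_dom x \<Longrightarrow> L0_val (r *\<^sub>R x) U = r * L0_val x U"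
  unfolding plus_L0_def minus_L0_def times_L0_def uminus_L0_def scaleR_L0_def
  by (intro conjunct1[OF L0_lift2_val] conjunct2[OF L0_lift2_val] continuous_intros; assumption)+

lemma L0_val_const [simp]:
  "U \<in> stone_points \<Longrightarrow> U \<in> L0_dom (L0_const r)"
  "U \<in> stone_points \<Longrightarrow> L0_val (L0_const r) U = r"
  "U \<in> stone_points \<Longrightarrow> U \<in> L0_dom 0"
  "U \<in> stone_points \<Longrightarrow> L0_val 0 U = 0"
  "U \<in> stone_points \<Longrightarrow> U \<in> L0_dom 1"
  "U \<in> stone_points \<Longrightarrow> L0_val 1 U = 1"
  unfolding zero_L0_def one_L0_def by (simp_all add: L0_dom_def L0_val_def L0_const.rep_eq)

lemma L0_val_chi [simp]:
  "U \<in> stone_points \<Longrightarrow> U \<in> L0_dom (L0_chi e)"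
  "U \<in> stone_points \<Longrightarrow> L0_val (L0_chi e) U = (if U \<in> stone_clopen e then 1 else 0)"
  by (simp_all add: L0_dom_def L0_val_def L0_chi.rep_eq)

definition fin_dom :: "'b::{boolean_algebra,complete_lattice} L0C \<Rightarrow> 'b set set" where
  "fin_dom z = L0_dom (ReL z) \<inter> L0_dom (ImL z)"

definition cval :: "'b::{boolean_algebra,complete_lattice} L0C \<Rightarrow> 'b set \<Rightarrow> complex" where
  "cval z U = Complex (L0_val (ReL z) U) (L0_val (ImL z) U)"

definition constL :: "complex \<Rightarrow> 'b::{boolean_algebra,complete_lattice} L0C" where
  "constL c = L0_Complex (L0_const (Re c)) (L0_const (Im c))"

lemma fin_dom_point: "U \<in> fin_dom z \<Longrightarrow> U \<in> stone_points"
  by (auto simp: fin_dom_def dest: L0_dom_point)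

lemma open_dense_fin_dom [simp]: "open_dense (fin_dom z)"
  unfolding fin_dom_def by (intro open_dense_Int open_dense_L0_dom)

lemma cval_tendsto: "U \<in> fin_dom z \<Longrightarrow> (cval z \<longlongrightarrow> cval z U) (nhdsin stone_space U)"
  unfolding cval_def by (intro tendsto_Complex L0_val_tendsto) (auto simp: fin_dom_def)

lemma cval_simps [simp]:
  "U \<in> fin_dom z \<Longrightarrow> U \<in> fin_dom w \<Longrightarrow> U \<in> fin_dom (z + w)"
  "U \<in> fin_dom z \<Longrightarrow> U \<in> fin_dom w \<Longrightarrow> cval (z + w) U = cval z U + cval w U"
  "U \<in> fin_dom z \<Longrightarrow> U \<in> fin_dom w \<Longrightarrow> U \<in> fin_dom (z - w)"
  "U \<in> fin_dom z \<Longrightarrow> U \<in> fin_dom w \<Longrightarrow> cval (z - w) U = cval z U - cval w U"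
  "U \<in> fin_dom z \<Longrightarrow> U \<in> fin_dom w \<Longrightarrow> U \<in> fin_dom (z * w)"
  "U \<in> fin_dom z \<Longrightarrow> U \<in> fin_dom w \<Longrightarrow> cval (z * w) U = cval z U * cval w U"
  "U \<in> fin_dom z \<Longrightarrow> U \<in> fin_dom (- z)"
  "U \<in> fin_dom z \<Longrightarrow> cval (- z) U = - cval z U"
  "U \<in> fin_dom z \<Longrightarrow> U \<in> fin_dom (cnjL z)"
  "U \<in> fin_dom z \<Longrightarrow> cval (cnjL z) U = cnj (cval z U)"
  "U \<in> fin_dom z \<Longrightarrow> U \<in> fin_dom (scaleL c z)"
  "U \<in> fin_dom z \<Longrightarrow> cval (scaleL c z) U = c * cval z U"
  unfolding fin_dom_def plus_L0C_def minus_L0C_def times_L0C_def uminus_L0C_def cnjL_def scaleL_def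
  by (auto simp: cval_def complex_eq_iff)

lemma cval_const [simp]:
  "U \<in> stone_points \<Longrightarrow> U \<in> fin_dom (constL c)"
  "U \<in> stone_points \<Longrightarrow> cval (constL c) U = c"
  "U \<in> stone_points \<Longrightarrow> U \<in> fin_dom 0"
  "U \<in> stone_points \<Longrightarrow> cval 0 U = 0"
  "U \<in> stone_points \<Longrightarrow> U \<in> fin_dom 1"
  "U \<in> stone_points \<Longrightarrow> cval 1 U = 1"
  "U \<in> stone_points \<Longrightarrow> U \<in> fin_dom (idemL e)"
  "U \<in> stone_points \<Longrightarrow> cval (idemL e) U = (if U \<in> stone_clopen e then 1 else 0)"
  unfolding fin_dom_def zero_L0C_def one_L0C_def idemL_def constL_def of_L0_def
  by (simp_all add: cval_def complex_eq_iff)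

text \<open>The working principle for all identities: two elements agree if their values agree on an open dense
set.\<close>

lemma L0C_eqI:
  assumes "open_dense W"
    and eq: "\<And>U. U \<in> W \<Longrightarrow> U \<in> stone_points \<Longrightarrow> U \<in> fin_dom z \<Longrightarrow> U \<in> fin_dom w \<Longrightarrow> cval z U = cval w U"
  shows "z = w"
proof -
  let ?W = "W \<inter> (fin_dom z \<inter> fin_dom w)"
  have W: "open_dense ?W" using assms by (intro open_dense_Int) auto
  have "L0_fun (ReL z) U = L0_fun (ReL w) U \<and> L0_fun (ImL z) U = L0_fun (ImL w) U" if "U \<in> ?W" for U
    using that eq[of U] fin_dom_point[of U z] by (simp add: fin_dom_def cval_def L0_fun_eq_val)
  then have "ReL z = ReL w" "ImL z = ImL w" by (auto intro: L0_eq_dense[OF W])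
  then show ?thesis by (rule L0C.expand[rule_format, OF conjI])
qed

theorem complex_extension:
  fixes f :: "'b::{boolean_algebra,complete_lattice} set \<Rightarrow> complex"
  assumes W: "open_dense W" and f: "\<And>U. U \<in> W \<Longrightarrow> (f \<longlongrightarrow> f U) (nhdsin stone_space U)"
  obtains z :: "'b L0C" where "\<And>U. U \<in> W \<Longrightarrow> U \<in> fin_dom z" "\<And>U. U \<in> W \<Longrightarrow> cval z U = f U"
proof -
  obtain x :: "'b L0" where x: "\<And>U. U \<in> W \<Longrightarrow> L0_fun x U = ereal (Re (f U))"
    using real_extension[OF W, of "\<lambda>U. Re (f U)"] f by (metis tendsto_Re)
  obtain y :: "'b L0" where y: "\<And>U. U \<in> W \<Longrightarrow> L0_fun y U = ereal (Im (f U))"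
    using real_extension[OF W, of "\<lambda>U. Im (f U)"] f by (metis tendsto_Im)
  have "U \<in> fin_dom (L0_Complex x y) \<and> cval (L0_Complex x y) U = f U" if "U \<in> W" for U
    using that x[OF that] y[OF that] L0_dom_valI open_dense_subset[OF W]
    by (auto simp: fin_dom_def cval_def complex_eq_iff)
  then show thesis using that by blast
qed

text \<open>Over the one-element Boolean algebra \<open>1 = 0\<close>, so these classes, which leave room for the zero ring,
are the right ones.\<close>

instance L0C :: ("{boolean_algebra,complete_lattice}") "{comm_ring, comm_monoid_mult}"
proof
  fix a b c :: "'a L0C"
  note dense = open_dense_Int[OF open_dense_fin_dom open_dense_Int[OF open_dense_fin_dom open_dense_fin_dom]]
  note eqI = L0C_eqI[OF dense[of a b c]]
  show "a * b * c = a * (b * c)" by (rule eqI) (simp add: algebra_simps)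
  show "a * b = b * a" by (rule eqI) (simp add: algebra_simps)
  show "a + b + c = a + (b + c)" by (rule eqI) (simp add: algebra_simps)
  show "a + b = b + a" by (rule eqI) (simp add: algebra_simps)
  show "0 + a = a" by (rule eqI) simp
  show "- a + a = 0" by (rule eqI) simp
  show "a - b = a + - b" by (rule eqI) simp
  show "(a + b) * c = a * c + b * c" by (rule eqI) (simp add: algebra_simps)
  show "1 * a = a" by (rule eqI) simp
qed

lemma scaleL_eq_const: "scaleL c z = constL c * z"
  by (rule L0C_eqI[OF open_dense_fin_dom[of z]]) simp

lemma constL_simps:
  "constL c + constL d = constL (c + d)"
  "constL c * constL d = constL (c * d)"
  "constL 0 = 0" "constL 1 = 1"
  by (rule L0C_eqI[OF open_dense_points]; simp)+

lemma idemL_simps: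
  "idemL e * idemL q = idemL (inf e q)"
  "idemL bot = 0" "idemL top = 1" "idemL (- e) = 1 - idemL e"
  by (rule L0C_eqI[OF open_dense_points]; simp add: stone_clopen_inf stone_clopen_top stone_clopen_compl_iff)+

section \<open>Comparing elements on a clopen set\<close>

text \<open>Equality after multiplication by an idempotent is equality of values on its clopen set. It is the
form in which local statements are made.\<close>

lemma idem_mult_eqI:
  assumes "open_dense W"
    and "\<And>U. U \<in> W \<Longrightarrow> U \<in> stone_clopen e \<Longrightarrow> U \<in> fin_dom z \<Longrightarrow> U \<in> fin_dom w \<Longrightarrow> cval z U = cval w U"
  shows "idemL e * z = idemL e * w"
proof (rule L0C_eqI)
  show "open_dense (W \<inter> (fin_dom z \<inter> fin_dom w))" using assms(1) by (intro open_dense_Int) auto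
qed (use assms(2) in auto)

lemma idem_mult_eqD:
  assumes eq: "idemL e * z = idemL e * w" and U: "U \<in> stone_clopen e" "U \<in> fin_dom z" "U \<in> fin_dom w"
  shows "cval z U = cval w U"
proof -
  have Up: "U \<in> stone_points" using U fin_dom_point by blast
  have "cval (idemL e * z) U = cval (idemL e * w) U" using eq by simp
  then show ?thesis using U Up by simp
qed

lemma idem_mult_mono: "e \<le> e' \<Longrightarrow> idemL e' * z = idemL e' * w \<Longrightarrow> idemL e * z = idemL e * w"
  by (metis idemL_simps(1) inf.absorb1 mult.assoc)

lemma idem_mult_zero_mono: "e \<le> e' \<Longrightarrow> idemL e' * z = 0 \<Longrightarrow> idemL e * z = 0"
  using idem_mult_mono[of e e' z 0] by simp

lemma open_dense_partition:
  fixes D :: "'b::{boolean_algebra,complete_lattice} set"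
  shows "open_dense ((\<Union>e\<in>D. stone_clopen e) \<union> stone_clopen (- Sup D))"
proof (rule open_denseI)
  fix b :: 'b assume "b \<noteq> bot"
  have "\<exists>e \<in> insert (- Sup D) D. inf e b \<noteq> bot"
  proof (rule ccontr)
    assume "\<not> ?thesis"
    then have "inf (Sup D) b = bot" "inf (- Sup D) b = bot" by (auto simp: Sup_disjoint)
    then have "b = bot" by (metis inf.commute inf_compl_bot inf_shunt inf.absorb1 double_compl)
    with \<open>b \<noteq> bot\<close> show False ..
  qed
  then obtain e where e: "e \<in> insert (- Sup D) D" "inf e b \<noteq> bot" ..
  then obtain U where "U \<in> stone_clopen (inf e b)" using stone_clopen_nonempty by blast
  with e(1) show "\<exists>U. U \<in> stone_clopen b \<and> U \<in> (\<Union>e\<in>D. stone_clopen e) \<union> stone_clopen (- Sup D)"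
    by (auto simp: stone_clopen_inf)
qed blast

text \<open>Local equalities glue: by continuity they pass from the union of clopen sets to its closure.\<close>

lemma idem_mult_Sup:
  assumes eq: "\<And>e. e \<in> D \<Longrightarrow> idemL e * z = idemL e * w"
  shows "idemL (Sup D) * z = idemL (Sup D) * w"
proof (rule idem_mult_eqI[OF open_dense_partition])
  fix U assume U: "U \<in> (\<Union>e\<in>D. stone_clopen e) \<union> stone_clopen (- Sup D)"
    "U \<in> stone_clopen (Sup D)" "U \<in> fin_dom z" "U \<in> fin_dom w"
  then have "U \<notin> stone_clopen (- Sup D)" using stone_clopen_compl_iff fin_dom_point by blast
  with U obtain e where "e \<in> D" "U \<in> stone_clopen e" by blast
  with eq[of e] U show "cval z U = cval w U" using idem_mult_eqD by blast
qed

section \<open>Modulus and support\<close>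

text \<open>The pointwise absolute value satisfies the defining equation, and a non-negative solution is
determined by its square.\<close>

lemma modulusL_fun: "U \<in> fin_dom z \<Longrightarrow> L0_fun (modulusL z) U = ereal (cmod (cval z U))"
proof -
  obtain r :: "'a L0" where r: "\<And>U. U \<in> fin_dom z \<Longrightarrow> L0_fun r U = ereal (cmod (cval z U))"
    using real_extension[OF open_dense_fin_dom, of z "\<lambda>U. cmod (cval z U)"] cval_tendsto tendsto_norm by metis
  have val_r: "U \<in> L0_dom r \<and> L0_val r U = cmod (cval z U)" if "U \<in> fin_dom z" for U
    using r[OF that] fin_dom_point[OF that] by (intro L0_dom_valI)
  have of_L0: "U \<in> fin_dom (of_L0 s) \<and> cval (of_L0 s) U = of_real (L0_val s U)"
    if "U \<in> L0_dom s" for U and s :: "'a L0"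
    using that L0_dom_point[OF that] by (simp add: fin_dom_def of_L0_def cval_def complex_eq_iff)
  have "modulusL z = r"
    unfolding modulusL_def
  proof (rule the_equality, intro conjI)
    show "0 \<le> r"
      by (rule L0_le_dense[OF open_dense_fin_dom[of z]])
        (simp add: r L0_fun_eq_val fin_dom_point)
    show "of_L0 (r * r) = cnjL z * z"
      by (rule L0C_eqI[OF open_dense_fin_dom[of z]])
        (use val_r of_L0 in \<open>simp add: complex_norm_square[symmetric] power2_eq_square mult.commute\<close>)
  next
    fix s assume s: "0 \<le> s \<and> of_L0 (s * s) = cnjL z * z"
    show "s = r"
    proof (rule L0_eq_dense[OF open_dense_Int[OF open_dense_L0_dom[of s] open_dense_fin_dom[of z]]])
      fix U assume U: "U \<in> L0_dom s \<inter> fin_dom z"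
      have "cval (of_L0 (s * s)) U = cval (cnjL z * z) U" using s by simp
      then have "complex_of_real (L0_val s U * L0_val s U) = cnj (cval z U) * cval z U"
        using U of_L0[of U "s * s"] by simp
      then have "(L0_val s U)\<^sup>2 = (cmod (cval z U))\<^sup>2"
        by (metis complex_norm_square mult.commute of_real_eq_iff power2_eq_square)
      moreover have "0 \<le> L0_val s U"
        using s U L0_fun_eq_val[of U s] L0_fun_eq_val[of U 0] L0_dom_point[of U s]
        unfolding less_eq_L0_def by auto
      ultimately have "L0_val s U = cmod (cval z U)" by simp
      then show "L0_fun s U = L0_fun r U" using U r by (simp add: L0_fun_eq_val)
    qed
  qed
  then show "U \<in> fin_dom z \<Longrightarrow> L0_fun (modulusL z) U = ereal (cmod (cval z U))" using r by simp
qed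

lemma modulusL_leI:
  assumes "open_dense W"
    and "\<And>U. U \<in> W \<Longrightarrow> U \<in> fin_dom y \<Longrightarrow> U \<in> fin_dom x \<Longrightarrow> cmod (cval y U) \<le> cmod (cval x U)"
  shows "modulusL y \<le> modulusL x"
proof (rule L0_le_dense)
  show "open_dense (W \<inter> (fin_dom y \<inter> fin_dom x))" using assms(1) by (intro open_dense_Int) auto
qed (use assms(2) in \<open>auto simp: modulusL_fun\<close>)

lemma chi_modulus_zero: "L0_chi e * modulusL z = 0 \<longleftrightarrow> idemL e * z = 0"
proof -
  have mod: "U \<in> L0_dom (modulusL z) \<and> L0_val (modulusL z) U = cmod (cval z U)" if "U \<in> fin_dom z" for U
    using modulusL_fun[OF that] fin_dom_point[OF that] by (intro L0_dom_valI)
  show ?thesis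
  proof
    assume eq: "L0_chi e * modulusL z = 0"
    have "idemL e * z = idemL e * 0"
    proof (rule idem_mult_eqI[OF open_dense_fin_dom[of z]])
      fix U assume U: "U \<in> stone_clopen e" "U \<in> fin_dom z"
      then have "L0_val (L0_chi e * modulusL z) U = cmod (cval z U)"
        using mod[of U] fin_dom_point[of U z] by simp
      then have "cmod (cval z U) = 0" using eq fin_dom_point[OF U(2)] by simp
      then show "cval z U = cval 0 U" using fin_dom_point[OF U(2)] by simp
    qed
    then show "idemL e * z = 0" by simp
  next
    assume eq: "idemL e * z = 0"
    show "L0_chi e * modulusL z = 0"
    proof (rule L0_eq_dense[OF open_dense_fin_dom[of z]])
      fix U assume U: "U \<in> fin_dom z"
      have Up: "U \<in> stone_points" using U fin_dom_point by blast
      have "cval (idemL e * z) U = cval 0 U" using eq by simp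
      then have "L0_val (L0_chi e * modulusL z) U = 0" using U Up mod[OF U] by auto
      then show "L0_fun (L0_chi e * modulusL z) U = L0_fun 0 U"
        using Up mod[OF U] by (simp add: L0_fun_eq_val)
    qed
  qed
qed

text \<open>By gluing, the supremum that defines the support is attained, so the support decides when an
idempotent annihilates an element.\<close>

lemma idem_mult_zero_iff: "idemL e * z = 0 \<longleftrightarrow> inf e (support z) = bot"
proof -
  let ?S = "{e. idemL e * z = 0}"
  have supp: "support z = - Sup ?S" by (simp add: support_def chi_modulus_zero)
  have "idemL (Sup ?S) * z = 0" using idem_mult_Sup[of ?S z 0] by simp
  then have "idemL e * z = 0 \<longleftrightarrow> e \<le> Sup ?S"
    using idem_mult_zero_mono[of e "Sup ?S" z] Sup_upper[of e ?S] by (metis mem_Collect_eq)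
  then show ?thesis by (simp add: supp inf_shunt)
qed

lemma support_le_iff: "support w \<le> support z \<longleftrightarrow> (\<forall>e. idemL e * z = 0 \<longrightarrow> idemL e * w = 0)"
proof
  assume "support w \<le> support z"
  then show "\<forall>e. idemL e * z = 0 \<longrightarrow> idemL e * w = 0"
    unfolding idem_mult_zero_iff by (metis bot.extremum_uniqueI inf_mono order_refl)
next
  assume "\<forall>e. idemL e * z = 0 \<longrightarrow> idemL e * w = 0"
  then have "inf (- support z) (support w) = bot" unfolding idem_mult_zero_iff by simp
  then show "support w \<le> support z" by (metis double_compl inf.commute inf_shunt)
qed

lemma idem_support_mult [simp]: "idemL (support z) * z = z"
proof -
  have "idemL (- support z) * z = 0" by (simp add: idem_mult_zero_iff)
  then show ?thesis by (simp add: idemL_simps algebra_simps)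
qed

lemma cval_support: "U \<in> fin_dom z \<Longrightarrow> U \<notin> stone_clopen (support z) \<Longrightarrow> cval z U = 0"
proof -
  assume U: "U \<in> fin_dom z" "U \<notin> stone_clopen (support z)"
  then have "cval (idemL (support z) * z) U = 0" using fin_dom_point[OF U(1)] by (simp del: idem_support_mult)
  then show ?thesis by simp
qed

section \<open>Exhaustion and mixing\<close>

text \<open>A maximal disjoint family of elements with the property has supremum \<open>a\<close>, since otherwise the
remainder would contain another one. It turns local constructions on a dense set of pieces into
simultaneous ones on a partition.\<close>

lemma exhaustion:
  fixes a :: "'b::{boolean_algebra,complete_lattice}"
  assumes dense: "\<And>e. e \<noteq> bot \<Longrightarrow> e \<le> a \<Longrightarrow> \<exists>e'. e' \<noteq> bot \<and> e' \<le> e \<and> P e'"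
  obtains D where "Sup D = a" "\<And>e. e \<in> D \<Longrightarrow> P e"
    "\<And>e e'. e \<in> D \<Longrightarrow> e' \<in> D \<Longrightarrow> e \<noteq> e' \<Longrightarrow> inf e e' = bot"
proof -
  let ?A = "{D. (\<forall>e\<in>D. P e \<and> e \<le> a) \<and> (\<forall>e\<in>D. \<forall>e'\<in>D. e \<noteq> e' \<longrightarrow> inf e e' = bot)}"
  have "\<exists>M\<in>?A. \<forall>X\<in>?A. M \<subseteq> X \<longrightarrow> X = M"
  proof (rule subset_Zorn')
    fix C assume C: "subset.chain ?A C"
    have "inf e e' = bot" if "e \<in> \<Union>C" "e' \<in> \<Union>C" "e \<noteq> e'" for e e'
    proof -
      obtain G H where "e \<in> G" "e' \<in> H" "G \<in> C" "H \<in> C" using \<open>e \<in> \<Union>C\<close> \<open>e' \<in> \<Union>C\<close> by blast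
      moreover have "G \<subseteq> H \<or> H \<subseteq> G" using C \<open>G \<in> C\<close> \<open>H \<in> C\<close> unfolding subset_chain_def by blast
      ultimately obtain K where "K \<in> C" "e \<in> K" "e' \<in> K" by blast
      then show ?thesis using C \<open>e \<noteq> e'\<close> unfolding subset_chain_def by blast
    qed
    moreover have "P e \<and> e \<le> a" if "e \<in> \<Union>C" for e
      using C that unfolding subset_chain_def by blast
    ultimately show "\<Union>C \<in> ?A" by simp
  qed
  then obtain M where M: "M \<in> ?A" and M_max: "\<forall>X\<in>?A. M \<subseteq> X \<longrightarrow> X = M" ..
  have "Sup M \<le> a" using M by (simp add: Sup_le_iff)
  moreover have "a \<le> Sup M"
  proof (rule ccontr)
    assume "\<not> a \<le> Sup M"
    then have "inf a (- Sup M) \<noteq> bot" by (simp add: inf_shunt)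
    then obtain e where e: "e \<noteq> bot" "e \<le> inf a (- Sup M)" "P e" using dense[of "inf a (- Sup M)"] by auto
    have disj: "inf d e = bot" if "d \<in> M" for d
    proof -
      have "e \<le> - d" using e(2) compl_mono[OF Sup_upper[OF that]] by (metis le_inf_iff order_trans)
      then show ?thesis using compl_le_swap1 inf_shunt by blast
    qed
    then have "insert e M \<in> ?A" using M e by (auto simp: inf.commute)
    then have "insert e M = M" using M_max[THEN bspec] by (meson subset_insertI)
    then have "e \<in> M" by blast
    then show False using disj e(1) by fastforce
  qed
  ultimately show thesis using that[of M] M by auto
qed

text \<open>The elements are used on the pieces to which they belong, and zero outside their supremum; this is
continuous on an open dense set because the pieces are clopen and disjoint.\<close>

lemma mixing:
  fixes D :: "'b::{boolean_algebra,complete_lattice} set"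
  assumes disj: "\<And>e e'. e \<in> D \<Longrightarrow> e' \<in> D \<Longrightarrow> e \<noteq> e' \<Longrightarrow> inf e e' = bot"
  obtains z where "\<And>e. e \<in> D \<Longrightarrow> idemL e * z = idemL e * x e" "idemL (- Sup D) * z = 0"
proof -
  let ?W = "{U. \<exists>e\<in>D. U \<in> stone_clopen e \<and> U \<in> fin_dom (x e)} \<union> stone_clopen (- Sup D)"
  define f where "f U = (if \<exists>e\<in>D. U \<in> stone_clopen e then cval (x (THE e. e \<in> D \<and> U \<in> stone_clopen e)) U else 0)" for U
  have f1: "f U = cval (x e) U" if e: "e \<in> D" "U \<in> stone_clopen e" for e U
  proof -
    have "(THE e. e \<in> D \<and> U \<in> stone_clopen e) = e"
    proof (rule the_equality)
      fix e' assume e': "e' \<in> D \<and> U \<in> stone_clopen e'"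
      then have "U \<in> stone_clopen (inf e e')" using e by (simp add: stone_clopen_inf)
      then show "e' = e" using disj[of e e'] e e' by fastforce
    qed (use e in simp)
    then show ?thesis using e by (auto simp: f_def)
  qed
  have f2: "f U = 0" if "U \<in> stone_clopen (- Sup D)" for U
  proof -
    have "U \<notin> stone_clopen e" if "e \<in> D" for e
      using stone_clopen_mono[OF Sup_upper[OF that]] \<open>U \<in> stone_clopen (- Sup D)\<close>
        stone_clopen_compl_iff[OF stone_pointI] by blast
    then show ?thesis by (auto simp: f_def)
  qed
  have W: "open_dense ?W"
  proof (rule open_denseI)
    fix U assume "U \<in> ?W"
    then show "\<exists>b. U \<in> stone_clopen b \<and> stone_clopen b \<subseteq> ?W"
    proof
      assume "U \<in> {U. \<exists>e\<in>D. U \<in> stone_clopen e \<and> U \<in> fin_dom (x e)}"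
      then obtain e where e: "e \<in> D" "U \<in> stone_clopen e" "U \<in> fin_dom (x e)" by blast
      obtain b where "U \<in> stone_clopen b" "stone_clopen b \<subseteq> fin_dom (x e)"
        using open_dense_nbhd[OF open_dense_fin_dom e(3)] .
      with e show ?thesis by (intro exI[of _ "inf b e"]) (auto simp: stone_clopen_inf)
    qed blast
  next
    fix b :: 'b assume "b \<noteq> bot"
    then obtain U where "U \<in> stone_clopen b" "U \<in> (\<Union>e\<in>D. stone_clopen e) \<union> stone_clopen (- Sup D)"
      using open_dense_partition[of D] unfolding open_dense_def by blast
    then consider e where "e \<in> D" "U \<in> stone_clopen (inf b e)" | "U \<in> ?W"
      by (auto simp: stone_clopen_inf)
    then show "\<exists>U. U \<in> stone_clopen b \<and> U \<in> ?W"
    proof cases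
      case (1 e)
      then have "inf b e \<noteq> bot" by auto
      then obtain V where "V \<in> stone_clopen (inf b e)" "V \<in> fin_dom (x e)"
        using open_dense_fin_dom[of "x e"] unfolding open_dense_def by blast
      with 1 show ?thesis by (auto simp: stone_clopen_inf)
    qed (use \<open>U \<in> stone_clopen b\<close> in blast)
  qed
  have "(f \<longlongrightarrow> f U) (nhdsin stone_space U)" if "U \<in> ?W" for U
    using that
  proof
    assume "U \<in> {U. \<exists>e\<in>D. U \<in> stone_clopen e \<and> U \<in> fin_dom (x e)}"
    then obtain e where e: "e \<in> D" "U \<in> stone_clopen e" "U \<in> fin_dom (x e)" by blast
    have "\<forall>\<^sub>F V in nhdsin stone_space U. cval (x e) V = f V"
      using e f1[OF e(1)] by (auto simp: eventually_nhdsin_stone[OF fin_dom_point[OF e(3)]] intro!: exI[of _ e])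
    then show ?thesis using cval_tendsto[OF e(3)] f1[OF e(1,2)] by (simp add: tendsto_cong)
  next
    assume U: "U \<in> stone_clopen (- Sup D)"
    have "\<forall>\<^sub>F V in nhdsin stone_space U. f V = 0"
      using U f2 by (auto simp: eventually_nhdsin_stone[OF stone_pointI[OF U]] intro!: exI[of _ "- Sup D"])
    then show ?thesis using f2[OF U] by (simp add: tendsto_eventually)
  qed
  then obtain z where z: "\<And>U. U \<in> ?W \<Longrightarrow> U \<in> fin_dom z" "\<And>U. U \<in> ?W \<Longrightarrow> cval z U = f U"
    by (rule complex_extension[OF W]) blast+
  show thesis
  proof (rule that)
    fix e assume e: "e \<in> D"
    show "idemL e * z = idemL e * x e"
    proof (rule idem_mult_eqI[OF open_dense_points])
      fix U assume U: "U \<in> stone_clopen e" "U \<in> fin_dom (x e)"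
      then have "U \<in> ?W" using e by blast
      then show "cval z U = cval (x e) U" using z(2)[of U] f1[OF e U(1)] by simp
    qed
  next
    have "idemL (- Sup D) * z = idemL (- Sup D) * 0"
      by (rule idem_mult_eqI[OF open_dense_points]) (use z(2) f2 in auto)
    then show "idemL (- Sup D) * z = 0" by simp
  qed
qed

lemma idem_mult_nonzero:
  assumes "idemL e * z \<noteq> 0"
  obtains U where "U \<in> stone_clopen e" "U \<in> fin_dom z" "cval z U \<noteq> 0"
proof -
  have "\<not> (\<forall>U\<in>stone_clopen e \<inter> fin_dom z. cval z U = 0)"
  proof
    assume "\<forall>U\<in>stone_clopen e \<inter> fin_dom z. cval z U = 0"
    then have "idemL e * z = idemL e * 0"
      by (intro idem_mult_eqI[OF open_dense_fin_dom[of z]]) (auto dest: fin_dom_point)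
    with assms show False by simp
  qed
  with that show thesis by blast
qed

text \<open>The algebra is von Neumann regular: the reciprocal of the values, put to zero off the support, is
continuous on an open dense set.\<close>

lemma L0C_local_inverse:
  obtains w where "z * w = idemL (support z)"
proof -
  let ?s = "support z"
  \<comment> \<open>Inside the clopen set of the support, the points with value zero are left out; they are nowhere
    dense there.\<close>
  let ?W = "fin_dom z \<inter> {U. U \<in> stone_clopen (- ?s) \<or> cval z U \<noteq> 0}"
  have W: "open_dense ?W"
  proof (rule open_denseI)
    fix U assume U: "U \<in> ?W"
    then have Up: "U \<in> stone_points" using fin_dom_point by blast
    obtain a where a: "U \<in> stone_clopen a" "stone_clopen a \<subseteq> fin_dom z"
      using U open_dense_nbhd[OF open_dense_fin_dom] by blast
    have "\<exists>b. U \<in> stone_clopen b \<and> stone_clopen b \<subseteq> {U. U \<in> stone_clopen (- ?s) \<or> cval z U \<noteq> 0}"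
    proof (cases "cval z U = 0")
      case True
      with U show ?thesis by blast
    next
      case False
      then have "\<forall>\<^sub>F V in nhdsin stone_space U. cval z V \<noteq> 0"
        using U cval_tendsto tendsto_imp_eventually_ne by blast
      then show ?thesis unfolding eventually_nhdsin_stone[OF Up] by blast
    qed
    then obtain b where "U \<in> stone_clopen b" "stone_clopen b \<subseteq> {U. U \<in> stone_clopen (- ?s) \<or> cval z U \<noteq> 0}" by blast
    with a show "\<exists>b. U \<in> stone_clopen b \<and> stone_clopen b \<subseteq> ?W"
      by (intro exI[of _ "inf a b"]) (auto simp: stone_clopen_inf)
  next
    fix b :: 'a assume b: "b \<noteq> bot"
    show "\<exists>U. U \<in> stone_clopen b \<and> U \<in> ?W"
    proof (cases "idemL b * z = 0")
      case True
      then have "b \<le> - ?s" by (simp add: idem_mult_zero_iff inf_shunt)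
      obtain U where "U \<in> stone_clopen b" "U \<in> fin_dom z"
        using open_dense_fin_dom[of z] b unfolding open_dense_def by blast
      with stone_clopen_mono[OF \<open>b \<le> - ?s\<close>] show ?thesis by blast
    next
      case False
      then show ?thesis using idem_mult_nonzero by blast
    qed
  qed
  have zero: "cval z U = 0" if "U \<in> fin_dom z" "U \<in> stone_clopen (- ?s)" for U
    using that cval_support stone_clopen_compl_iff fin_dom_point by metis
  have "((\<lambda>V. inverse (cval z V)) \<longlongrightarrow> inverse (cval z U)) (nhdsin stone_space U)" if U: "U \<in> ?W" for U
  proof (cases "cval z U = 0")
    case True
    with U have Us: "U \<in> stone_clopen (- ?s)" "U \<in> fin_dom z" by auto
    then have "\<forall>\<^sub>F V in nhdsin stone_space U. V \<in> stone_clopen (- ?s)"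
      unfolding eventually_nhdsin_stone[OF fin_dom_point[OF Us(2)]] by blast
    then have "\<forall>\<^sub>F V in nhdsin stone_space U. inverse (cval z V) = inverse (cval z U)"
      using open_dense_eventually[OF open_dense_fin_dom Us(2)]
      by eventually_elim (simp add: zero True)
    then show ?thesis by (rule tendsto_eventually)
  next
    case False
    then show ?thesis using U cval_tendsto by (intro tendsto_inverse) auto
  qed
  then obtain w where w: "\<And>U. U \<in> ?W \<Longrightarrow> U \<in> fin_dom w" "\<And>U. U \<in> ?W \<Longrightarrow> cval w U = inverse (cval z U)"
    by (rule complex_extension[OF W]) blast+
  have "z * w = idemL ?s"
  proof (rule L0C_eqI[OF W])
    fix U assume U: "U \<in> ?W" "U \<in> stone_points"
    show "cval (z * w) U = cval (idemL ?s) U"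
    proof (cases "cval z U = 0")
      case True
      then have "U \<in> stone_clopen (- ?s)" using U(1) by blast
      then have "U \<notin> stone_clopen ?s" using stone_clopen_compl_iff[OF U(2)] by blast
      then show ?thesis using True U w[OF U(1)] by simp
    next
      case False
      then have "U \<in> stone_clopen ?s" using U cval_support by blast
      then show ?thesis using False U w[OF U(1)] by simp
    qed
  qed
  then show thesis by (rule that)
qed

section \<open>Bounded elements and local estimates\<close>

lemma C_Stone_iff: "z \<in> C_Stone \<longleftrightarrow> fin_dom z = stone_points"
  unfolding C_Stone_def fin_dom_def L0_dom_def set_eq_iff by simp metis

text \<open>A bound that holds on a dense set holds everywhere and excludes infinite values.\<close>

lemma bounded_in_C_Stone:
  assumes W: "open_dense W" and le: "\<And>U. U \<in> W \<Longrightarrow> U \<in> fin_dom z \<Longrightarrow> cmod (cval z U) \<le> r"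
  shows "z \<in> C_Stone"
proof -
  have W': "open_dense (W \<inter> fin_dom z)" using W by (intro open_dense_Int) auto
  have *: "L0_fun x U \<noteq> \<infinity> \<and> L0_fun x U \<noteq> -\<infinity>"
    if x: "\<And>V. V \<in> W \<inter> fin_dom z \<Longrightarrow> V \<in> L0_dom x \<and> \<bar>L0_val x V\<bar> \<le> cmod (cval z V)" and U: "U \<in> stone_points" for x U
  proof -
    have bd: "V \<in> L0_dom x" "\<bar>L0_val x V\<bar> \<le> r" "V \<in> stone_points" if V: "V \<in> W \<inter> fin_dom z" for V
    proof -
      show "V \<in> L0_dom x" using x[OF V] by blast
      show "\<bar>L0_val x V\<bar> \<le> r" using x[OF V] le[of V] V by simp
      show "V \<in> stone_points" using V fin_dom_point by blast
    qed
    have "x \<le> L0_const r"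
      by (rule L0_le_dense[OF W']) (use bd in \<open>fastforce simp: L0_fun_eq_val L0_const.rep_eq abs_le_iff\<close>)
    moreover have "L0_const (- r) \<le> x"
      by (rule L0_le_dense[OF W']) (use bd in \<open>fastforce simp: L0_fun_eq_val L0_const.rep_eq abs_le_iff\<close>)
    ultimately have "L0_fun x U \<le> ereal r" "ereal (- r) \<le> L0_fun x U"
      using U unfolding less_eq_L0_def by (auto simp: L0_const.rep_eq)
    then show ?thesis by auto
  qed
  have "V \<in> L0_dom (ReL z) \<and> \<bar>L0_val (ReL z) V\<bar> \<le> cmod (cval z V)"
    "V \<in> L0_dom (ImL z) \<and> \<bar>L0_val (ImL z) V\<bar> \<le> cmod (cval z V)" if "V \<in> W \<inter> fin_dom z" for V
    using that abs_Re_le_cmod[of "cval z V"] abs_Im_le_cmod[of "cval z V"]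
    by (auto simp: fin_dom_def cval_def)
  then show ?thesis unfolding C_Stone_def using * by auto
qed

lemma idemL_C_Stone [simp]: "idemL e \<in> C_Stone"
  unfolding C_Stone_iff by (auto dest: fin_dom_point)

lemma locally_close:
  assumes "e \<noteq> bot" "0 < \<epsilon>"
  obtains e' c where "e' \<noteq> bot" "e' \<le> e" "stone_clopen e' \<subseteq> fin_dom z"
    "\<And>U. U \<in> stone_clopen e' \<Longrightarrow> cmod (cval z U - c) < \<epsilon>"
proof -
  obtain U where U: "U \<in> stone_clopen e" "U \<in> fin_dom z"
    using open_dense_fin_dom[of z] assms(1) unfolding open_dense_def by blast
  note Up = fin_dom_point[OF U(2)]
  have "\<forall>\<^sub>F V in nhdsin stone_space U. dist (cval z V) (cval z U) < \<epsilon>"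
    using cval_tendsto[OF U(2)] assms(2) by (rule tendstoD)
  then have "\<forall>\<^sub>F V in nhdsin stone_space U. V \<in> fin_dom z \<and> cmod (cval z V - cval z U) < \<epsilon>"
    using open_dense_eventually[OF open_dense_fin_dom U(2)] by eventually_elim (simp add: dist_norm)
  then obtain b where b: "U \<in> stone_clopen b" "\<forall>V\<in>stone_clopen b. V \<in> fin_dom z \<and> cmod (cval z V - cval z U) < \<epsilon>"
    unfolding eventually_nhdsin_stone[OF Up] by blast
  show thesis
  proof (rule that[of "inf b e" "cval z U"])
    have "U \<in> stone_clopen (inf b e)" using b U by (simp add: stone_clopen_inf)
    then show "inf b e \<noteq> bot" by auto
  qed (use b in \<open>auto simp: stone_clopen_inf\<close>)
qed

lemma locally_bounded_below:
  assumes "idemL e * z \<noteq> 0"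
  obtains e' r where "e' \<noteq> bot" "e' \<le> e" "stone_clopen e' \<subseteq> fin_dom z" "0 < r"
    "\<And>U. U \<in> stone_clopen e' \<Longrightarrow> r \<le> cmod (cval z U)"
proof -
  obtain U where U: "U \<in> stone_clopen e" "U \<in> fin_dom z" "cval z U \<noteq> 0"
    using idem_mult_nonzero[OF assms] .
  let ?r = "cmod (cval z U) / 2"
  have "\<forall>\<^sub>F V in nhdsin stone_space U. ?r < cmod (cval z V)"
    using tendsto_norm[OF cval_tendsto[OF U(2)]] by (rule order_tendstoD) (use U in simp)
  then have "\<forall>\<^sub>F V in nhdsin stone_space U. V \<in> fin_dom z \<and> ?r < cmod (cval z V)"
    using open_dense_eventually[OF open_dense_fin_dom U(2)] by eventually_elim simp
  then obtain b where b: "U \<in> stone_clopen b" "\<forall>V\<in>stone_clopen b. V \<in> fin_dom z \<and> ?r < cmod (cval z V)"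
    unfolding eventually_nhdsin_stone[OF fin_dom_point[OF U(2)]] by blast
  show thesis
  proof (rule that[of "inf b e" ?r])
    have "U \<in> stone_clopen (inf b e)" using b U by (simp add: stone_clopen_inf)
    then show "inf b e \<noteq> bot" by auto
  qed (use b U in \<open>auto simp: stone_clopen_inf less_imp_le\<close>)
qed

section \<open>Local constancy and distributivity\<close>

definition const_on :: "'b \<Rightarrow> 'b::{boolean_algebra,complete_lattice} L0C \<Rightarrow> bool" where
  "const_on e z \<longleftrightarrow> (\<exists>c. idemL e * z = idemL e * constL c)"

lemma open_hull_eventually:
  assumes "U \<in> stone_clopen (open_hull S)" "\<forall>\<^sub>F V in nhdsin stone_space U. P V"
  obtains V where "V \<in> S" "P V"
proof -
  obtain b where b: "U \<in> stone_clopen b" "\<forall>V\<in>stone_clopen b. P V"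
    using assms(2) unfolding eventually_nhdsin_stone[OF stone_pointI[OF assms(1)]] by blast
  have "stone_clopen b \<inter> S \<noteq> {}"
  proof
    assume "stone_clopen b \<inter> S = {}"
    then have "stone_clopen (open_hull S) \<inter> stone_clopen b = {}"
      by (intro iffD2[OF stone_clopen_disjoint] open_hull_disjoint)
    with b assms(1) show False by blast
  qed
  with b that show thesis by blast
qed

text \<open>For each \<open>n\<close> the sets \<open>S n m\<close>, where \<open>z\<close> is within \<open>1 / (n + 1)\<close> of the \<open>m\<close>-th point of a countable
dense set, have supremum one. Distributivity, applied to their complements, gives a choice \<open>\<phi>\<close> such
that the sets \<open>S n (\<phi> n)\<close> have a common non-zero part of \<open>e0\<close>; there \<open>z\<close> oscillates by less than
every positive number.\<close>

theorem sigma_distributive_locally_constant: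
  fixes z :: "'b::{boolean_algebra,complete_lattice} L0C"
  assumes sd: "sigma_distributive_below e" and e0: "e0 \<noteq> bot" "e0 \<le> e"
  obtains e' where "e' \<noteq> bot" "e' \<le> e0" "const_on e' z"
proof -
  obtain R :: "complex set" where R: "countable R" "\<And>X. open X \<Longrightarrow> X \<noteq> {} \<Longrightarrow> \<exists>d\<in>R. d \<in> X"
    using countable_dense_exists by blast
  define r where "r = from_nat_into R"
  have r: "\<exists>m. cmod (w - r m) < \<epsilon>" if "0 < \<epsilon>" for w \<epsilon>
  proof -
    obtain d where "d \<in> R" "d \<in> ball w \<epsilon>" using R(2)[of "ball w \<epsilon>"] \<open>0 < \<epsilon>\<close> by auto
    then show ?thesis using from_nat_into_surj[OF R(1)] by (auto simp: r_def dist_norm)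
  qed
  define S where "S n m = {U \<in> fin_dom z. cmod (cval z U - r m) < inverse (Suc n)}" for n m :: nat
  define q where "q n m = inf e (- open_hull (S n m))" for n m
  have "(INF m. q n m) = bot" for n
  proof (rule ccontr)
    assume ne: "(INF m. q n m) \<noteq> bot"
    then obtain U where U: "U \<in> stone_clopen (INF m. q n m)" "U \<in> fin_dom z"
      using open_dense_fin_dom[of z] unfolding open_dense_def by blast
    obtain m where m: "cmod (cval z U - r m) < inverse (Suc n)" using r[of "inverse (Suc n)"] by auto
    have "((\<lambda>V. cmod (cval z V - r m)) \<longlongrightarrow> cmod (cval z U - r m)) (nhdsin stone_space U)"
      using cval_tendsto[OF U(2)] by (intro tendsto_intros)
    then have "\<forall>\<^sub>F V in nhdsin stone_space U. cmod (cval z V - r m) < inverse (Suc n)"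
      using m by (rule order_tendstoD)
    then have "\<forall>\<^sub>F V in nhdsin stone_space U. V \<in> S n m"
      using open_dense_eventually[OF open_dense_fin_dom U(2)] by eventually_elim (simp add: S_def)
    then have "U \<in> stone_clopen (open_hull (S n m))" using fin_dom_point[OF U(2)] by (rule open_hull_nbhd)
    moreover have "(INF m. q n m) \<le> - open_hull (S n m)"
      by (rule INF_lower2[of m]) (simp_all add: q_def)
    ultimately show False
      using U stone_clopen_mono stone_clopen_compl_iff[OF fin_dom_point[OF U(2)]] by blast
  qed
  moreover have "\<forall>n m. q n m \<le> e" by (simp add: q_def)
  moreover from this have "(SUP n. INF m. q n m) = (INF \<phi>. SUP n. q n (\<phi> n))"
    using sd unfolding sigma_distributive_below_def by blast
  ultimately have "(INF \<phi>. SUP n. q n (\<phi> n)) = bot" by simp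
  then have "\<not> e0 \<le> (INF \<phi>. SUP n. q n (\<phi> n))" using e0 by (simp add: bot_unique)
  then obtain \<phi> where \<phi>: "\<not> e0 \<le> (SUP n. q n (\<phi> n))" by (auto simp: le_INF_iff)
  define e' where "e' = inf e0 (- (SUP n. q n (\<phi> n)))"
  have ne: "e' \<noteq> bot" using \<phi> by (simp add: e'_def inf_shunt)
  have le: "e' \<le> open_hull (S n (\<phi> n))" for n
  proof -
    have "inf e' (q n (\<phi> n)) = bot"
    proof -
      have "q n (\<phi> n) \<le> (SUP n. q n (\<phi> n))" by (rule SUP_upper) simp
      then have "e' \<le> - q n (\<phi> n)" unfolding e'_def by (meson compl_le_compl_iff inf.coboundedI2)
      then show ?thesis by (simp add: inf_shunt)
    qed
    moreover have "e' \<le> e" using e0 by (simp add: e'_def le_infI1)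
    ultimately have "inf e' (- open_hull (S n (\<phi> n))) = bot"
      by (simp add: q_def inf.absorb1 flip: inf.assoc)
    then show ?thesis by (simp add: inf_shunt)
  qed
  have close: "cmod (cval z U - r (\<phi> n)) \<le> inverse (Suc n)" if U: "U \<in> stone_clopen e'" "U \<in> fin_dom z" for U n
  proof (rule ccontr)
    assume "\<not> ?thesis"
    then have *: "inverse (Suc n) < cmod (cval z U - r (\<phi> n))" by simp
    have "((\<lambda>V. cmod (cval z V - r (\<phi> n))) \<longlongrightarrow> cmod (cval z U - r (\<phi> n))) (nhdsin stone_space U)"
      using cval_tendsto[OF U(2)] by (intro tendsto_intros)
    then have ev: "\<forall>\<^sub>F V in nhdsin stone_space U. inverse (Suc n) < cmod (cval z V - r (\<phi> n))"
      using * by (rule order_tendstoD)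
    have "U \<in> stone_clopen (open_hull (S n (\<phi> n)))" using U(1) stone_clopen_mono[OF le] by blast
    then obtain V where "V \<in> S n (\<phi> n)" "inverse (Suc n) < cmod (cval z V - r (\<phi> n))"
      using ev by (rule open_hull_eventually)
    then show False by (simp add: S_def)
  qed
  obtain U where U: "U \<in> stone_clopen e'" "U \<in> fin_dom z"
    using open_dense_fin_dom[of z] ne unfolding open_dense_def by blast
  have "idemL e' * z = idemL e' * constL (cval z U)"
  proof (rule idem_mult_eqI[OF open_dense_fin_dom[of z]])
    fix V assume V: "V \<in> stone_clopen e'" "V \<in> fin_dom z"
    have le: "cmod (cval z V - cval z U) \<le> 2 * inverse (Suc n)" for n
      using norm_triangle_ineq4[of "cval z V - r (\<phi> n)" "cval z U - r (\<phi> n)"]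
        close[OF V, of n] close[OF U, of n] by simp
    have lim: "(\<lambda>n. 2 * inverse (real (Suc n))) \<longlonglongrightarrow> 0"
      using tendsto_mult_right_zero[OF LIMSEQ_inverse_real_of_nat] by simp
    have "cmod (cval z V - cval z U) \<le> 0" using le by (intro LIMSEQ_le_const[OF lim]) blast
    then show "cval z V = cval (constL (cval z U)) V" using fin_dom_point[OF V(2)] by simp
  qed
  then have "const_on e' z" unfolding const_on_def by blast
  with that ne show thesis by (simp add: e'_def)
qed

text \<open>Weights \<open>3\<close> to the power \<open>-k\<close> rather than \<open>2\<close> to the power \<open>-k\<close>: each weight exceeds the sum of
all later ones, so a set can be recovered from its code.\<close>

definition ternary_code :: "nat set \<Rightarrow> real" where
  "ternary_code A = (\<Sum>k. (if k \<in> A then (1/3) ^ k else 0))"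

lemma ternary_code_inject: "ternary_code A = ternary_code B \<Longrightarrow> A = B"
proof (rule ccontr)
  assume eq: "ternary_code A = ternary_code B" and "A \<noteq> B"
  let ?d = "\<lambda>C k. if k \<in> C then (1/3::real) ^ k else 0"
  let ?h = "\<lambda>k. ?d A k - ?d B k"
  \<comment> \<open>At the first place where the sets differ, the difference outweighs everything that follows.\<close>
  define k where "k = (LEAST k. (k \<in> A) \<noteq> (k \<in> B))"
  have "\<exists>k. (k \<in> A) \<noteq> (k \<in> B)" using \<open>A \<noteq> B\<close> by blast
  then have k: "(k \<in> A) \<noteq> (k \<in> B)" unfolding k_def by (rule LeastI_ex)
  have below: "?h j = 0" if "j < k" for j
    using not_less_Least[OF that[unfolded k_def]] by simp
  have sum3: "summable (\<lambda>j. (1/3::real) ^ j)" by (rule summable_geometric) simp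
  have summ: "summable (?d C)" for C
    by (rule summable_comparison_test'[OF sum3]) simp
  have summ_h: "summable ?h" by (intro summable_diff summ)
  have "suminf ?h = 0"
    using eq suminf_diff[OF summ[of A] summ[of B]] by (simp add: ternary_code_def)
  moreover have "suminf ?h = (\<Sum>j. ?h (j + Suc k)) + sum ?h {..<Suc k}"
    by (rule suminf_split_initial_segment[OF summ_h])
  moreover have "sum ?h {..<Suc k} = ?h k" using below by simp
  ultimately have "\<bar>?h k\<bar> = \<bar>\<Sum>j. ?h (j + Suc k)\<bar>" by simp
  also have "\<dots> \<le> (\<Sum>j. (1/3::real) ^ Suc k * (1/3) ^ j)"
  proof -
    have "norm (\<Sum>j. ?h (j + Suc k)) \<le> (\<Sum>j. (1/3::real) ^ Suc k * (1/3) ^ j)"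
      by (rule norm_suminf_le) (auto simp: power_add intro!: summable_mult sum3)
    then show ?thesis by simp
  qed
  also have "\<dots> = (1/3) ^ Suc k * (3/2)"
    by (subst suminf_mult[OF sum3]) (simp add: suminf_geometric)
  also have "\<dots> < (1/3) ^ k" by simp
  also have "(1/3) ^ k = \<bar>?h k\<bar>" using k by auto
  finally show False by simp
qed

text \<open>A double sequence that violates distributivity leaves a non-zero \<open>e0\<close> between the two sides. If the
codes were constant on a part \<open>e'\<close> of \<open>e0\<close>, every complement of a \<open>q n m\<close> would contain \<open>e'\<close> or be
disjoint from it. For each \<open>n\<close> some complement is not disjoint from \<open>e'\<close>, as \<open>e'\<close> avoids the left-hand
side; choosing it for each \<open>n\<close> gives a \<open>\<phi>\<close> for which \<open>e'\<close> is disjoint from the supremum of the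
\<open>q n (\<phi> n)\<close>, although it lies below the right-hand side.\<close>

theorem nowhere_constant_element:
  fixes e :: "'b::{boolean_algebra,complete_lattice}"
  assumes "\<not> sigma_distributive_below e"
  obtains b :: "'b L0C" and e0 where "b \<in> C_Stone" "e0 \<noteq> bot" "e0 \<le> e"
    "\<And>e'. e' \<noteq> bot \<Longrightarrow> e' \<le> e0 \<Longrightarrow> \<not> const_on e' b"
proof -
  obtain q :: "nat \<Rightarrow> nat \<Rightarrow> 'b" where q: "\<And>n m. q n m \<le> e"
    and neq: "(SUP n. INF m. q n m) \<noteq> (INF \<phi>. SUP n. q n (\<phi> n))"
    using assms unfolding sigma_distributive_below_def by blast
  let ?L = "SUP n. INF m. q n m" and ?R = "INF \<phi>. SUP n. q n (\<phi> n)"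
  have "?L \<le> (SUP n. q n (\<phi> n))" for \<phi>
    by (intro SUP_mono) (auto intro: INF_lower)
  then have "?L \<le> ?R" by (intro INF_greatest)
  with neq have "\<not> ?R \<le> ?L" by (meson antisym)
  define e0 where "e0 = inf ?R (- ?L)"
  have ne: "e0 \<noteq> bot" using \<open>\<not> ?R \<le> ?L\<close> by (simp add: e0_def inf_shunt)
  have "?R \<le> (SUP n. q n 0)" by (rule INF_lower2[of "\<lambda>_. 0"]) simp_all
  also have "\<dots> \<le> e" using q by (simp add: SUP_le_iff)
  finally have "e0 \<le> e" by (simp add: e0_def le_infI1)
  define cs where "cs k = - (case prod_decode k of (n, m) \<Rightarrow> q n m)" for k
  define f where "f U = ternary_code {k. U \<in> stone_clopen (cs k)}" for U
  have f_lim: "((\<lambda>V. complex_of_real (f V)) \<longlongrightarrow> complex_of_real (f U)) (nhdsin stone_space U)"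
    if U: "U \<in> stone_points" for U
  proof (rule tendsto_of_real)
    let ?d = "\<lambda>k V. if V \<in> stone_clopen (cs k) then (1/3::real) ^ k else 0"
    have "(?d k \<longlongrightarrow> ?d k U) (nhdsin stone_space U)" for k
    proof (rule tendsto_eventually)
      let ?c = "if U \<in> stone_clopen (cs k) then cs k else - cs k"
      have "U \<in> stone_clopen ?c" using stone_clopen_compl_iff[OF U] by simp
      moreover have "?d k V = ?d k U" if "V \<in> stone_clopen ?c" for V
        using that stone_clopen_compl_iff[OF stone_pointI[OF that]] by (auto split: if_splits)
      ultimately show "\<forall>\<^sub>F V in nhdsin stone_space U. ?d k V = ?d k U"
        unfolding eventually_nhdsin_stone[OF U] by blast
    qed
    moreover have "\<forall>\<^sub>F (k, V) in at_top \<times>\<^sub>F nhdsin stone_space U. norm (?d k V) \<le> (1/3) ^ k"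
      by (intro always_eventually) simp
    moreover have "summable (\<lambda>k. (1/3::real) ^ k)" by (rule summable_geometric) simp
    ultimately have "((\<lambda>V. \<Sum>k. ?d k V) \<longlongrightarrow> (\<Sum>k. ?d k U)) (nhdsin stone_space U)"
      using tannerys_theorem[of ?d "\<lambda>k. ?d k U" "nhdsin stone_space U"] nhdsin_stone_neq_bot[OF U] by blast
    then show "(f \<longlongrightarrow> f U) (nhdsin stone_space U)" by (simp add: f_def[abs_def] ternary_code_def)
  qed
  obtain b :: "'b L0C" where b: "\<And>U. U \<in> stone_points \<Longrightarrow> U \<in> fin_dom b"
    "\<And>U. U \<in> stone_points \<Longrightarrow> cval b U = complex_of_real (f U)"
    using complex_extension[OF open_dense_points f_lim] by blast
  have "\<not> const_on e' b" if e': "e' \<noteq> bot" "e' \<le> e0" for e'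
  proof
    assume "const_on e' b"
    then obtain c where c: "idemL e' * b = idemL e' * constL c" unfolding const_on_def by blast
    have "complex_of_real (f U) = c" if "U \<in> stone_clopen e'" for U
      using idem_mult_eqD[OF c that] stone_pointI[OF that] b by simp
    then have same: "U \<in> stone_clopen (cs k) \<longleftrightarrow> V \<in> stone_clopen (cs k)"
      if "U \<in> stone_clopen e'" "V \<in> stone_clopen e'" for U V k
      using that ternary_code_inject unfolding f_def by (metis (no_types, lifting) mem_Collect_eq of_real_eq_iff)
    have "\<exists>m. e' \<le> - q n m" for n
    proof -
      have "\<exists>m. \<not> e' \<le> q n m"
      proof (rule ccontr)
        assume "\<not> ?thesis"
        then have "e' \<le> (INF m. q n m)" by (simp add: le_INF_iff)
        also have "\<dots> \<le> ?L" by (rule SUP_upper) simp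
        finally have "e' \<le> ?L" .
        moreover have "e' \<le> - ?L" using e'(2) by (simp add: e0_def)
        ultimately have "e' \<le> inf ?L (- ?L)" by (rule le_infI)
        with e' show False by (simp add: bot_unique)
      qed
      then obtain m where "inf e' (- q n m) \<noteq> bot" by (auto simp: inf_shunt)
      then obtain V where V: "V \<in> stone_clopen e'" "V \<in> stone_clopen (- q n m)"
        using stone_clopen_nonempty stone_clopen_inf by blast
      have "cs (prod_encode (n, m)) = - q n m" by (simp add: cs_def)
      then have "stone_clopen e' \<subseteq> stone_clopen (- q n m)"
        using V same[of _ V "prod_encode (n, m)"] by auto
      then show ?thesis by (auto simp: stone_clopen_subset)
    qed
    then obtain \<phi> where "\<And>n. e' \<le> - q n (\<phi> n)" by metis
    then have "(SUP n. q n (\<phi> n)) \<le> - e'" by (intro SUP_least) (simp add: compl_le_swap1)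
    moreover have "e' \<le> (SUP n. q n (\<phi> n))"
    proof -
      have "?R \<le> (SUP n. q n (\<phi> n))" by (rule INF_lower) simp
      moreover have "e' \<le> ?R" using e'(2) by (simp add: e0_def)
      ultimately show ?thesis by (rule order_trans[rotated])
    qed
    ultimately have "e' \<le> - e'" by (rule order_trans[rotated])
    then have "inf e' e' = bot" unfolding inf_shunt .
    with e'(1) show False by simp
  qed
  moreover have "b \<in> C_Stone" unfolding C_Stone_iff using b(1) fin_dom_point by blast
  ultimately show thesis using that ne \<open>e0 \<le> e\<close> by blast
qed

section \<open>Band preserving derivations\<close>

locale band_preserving_derivation =
  fixes X Y :: "'b::{boolean_algebra,complete_lattice} L0C set" and \<delta>
  assumes ideal: "ideal_C_Stone X" and solid: "solid_space Y"
    and derivation: "derivation_on X Y \<delta>" and band: "band_preserving_on X \<delta>"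
begin

lemma X_C_Stone: "x \<in> X \<Longrightarrow> x \<in> C_Stone"
  and X_add: "x \<in> X \<Longrightarrow> y \<in> X \<Longrightarrow> x + y \<in> X"
  and X_const: "x \<in> X \<Longrightarrow> constL c * x \<in> X"
  and X_ideal: "a \<in> C_Stone \<Longrightarrow> x \<in> X \<Longrightarrow> a * x \<in> X"
  using ideal unfolding ideal_C_Stone_def subspaceL_def scaleL_eq_const by blast+

lemma \<delta>_add: "x \<in> X \<Longrightarrow> y \<in> X \<Longrightarrow> \<delta> (x + y) = \<delta> x + \<delta> y"
  and \<delta>_const: "x \<in> X \<Longrightarrow> \<delta> (constL c * x) = constL c * \<delta> x"
  and \<delta>_mult: "x \<in> X \<Longrightarrow> y \<in> X \<Longrightarrow> \<delta> (x * y) = \<delta> x * y + x * \<delta> y"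
  and \<delta>_Y: "x \<in> X \<Longrightarrow> \<delta> x \<in> Y"
  using derivation unfolding derivation_on_def scaleL_eq_const by blast+

lemma \<delta>_vanish: "x \<in> X \<Longrightarrow> idemL e * x = 0 \<Longrightarrow> idemL e * \<delta> x = 0"
  using band unfolding band_preserving_on_def support_le_iff by blast

lemma \<delta>_idem_mult: "x \<in> X \<Longrightarrow> \<delta> (idemL e * x) = idemL e * \<delta> x"
proof -
  assume x: "x \<in> X"
  let ?y = "idemL e * x" and ?z = "idemL (- e) * x"
  have X: "?y \<in> X" "?z \<in> X" using x X_ideal by auto
  have "idemL e * ?z = 0" "idemL (- e) * ?y = 0"
    by (simp_all add: idemL_simps(1,2) flip: mult.assoc)
  then have "idemL e * \<delta> ?z = 0" and y: "idemL (- e) * \<delta> ?y = 0"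
    using X by (auto intro: \<delta>_vanish simp del: idemL_simps)
  moreover have "x = ?y + ?z" by (simp add: idemL_simps algebra_simps)
  then have "\<delta> x = \<delta> ?y + \<delta> ?z" using \<delta>_add[OF X] by simp
  ultimately have "idemL e * \<delta> x = idemL e * \<delta> ?y" by (simp add: algebra_simps)
  also have "\<dots> = \<delta> ?y" using y by (simp add: idemL_simps algebra_simps)
  finally show ?thesis by simp
qed

lemma \<delta>_local: "x \<in> X \<Longrightarrow> y \<in> X \<Longrightarrow> idemL e * x = idemL e * y \<Longrightarrow> idemL e * \<delta> x = idemL e * \<delta> y"
  using \<delta>_idem_mult by metis

lemma \<delta>_idem: "idemL e \<in> X \<Longrightarrow> \<delta> (idemL e) = 0"
proof -
  assume e: "idemL e \<in> X"
  have "\<delta> (idemL e * idemL e) = idemL e * \<delta> (idemL e) + idemL e * \<delta> (idemL e)"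
    using \<delta>_mult[OF e e] by (simp add: mult.commute)
  moreover have "\<delta> (idemL e * idemL e) = idemL e * \<delta> (idemL e)" by (rule \<delta>_idem_mult[OF e])
  ultimately have "idemL e * \<delta> (idemL e) = 0" by simp
  with \<delta>_idem_mult[OF e, of e] show ?thesis by (simp add: idemL_simps)
qed

text \<open>If \<open>x\<close> has a non-zero constant value on \<open>e\<close>, then \<open>e\<close> itself is a multiple of \<open>x\<close> and lies in the
ideal, and a derivation kills idempotents.\<close>

lemma \<delta>_const_on: "x \<in> X \<Longrightarrow> const_on e x \<Longrightarrow> idemL e * \<delta> x = 0"
proof -
  assume x: "x \<in> X" and "const_on e x"
  then obtain c where c: "idemL e * x = idemL e * constL c" unfolding const_on_def by blast
  show ?thesis
  proof (cases "c = 0")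
    case True
    with c x show ?thesis by (intro \<delta>_vanish) (simp_all add: constL_simps)
  next
    case False
    have "constL (inverse c) * (idemL e * x) = constL (inverse c) * (idemL e * constL c)"
      by (simp only: c)
    also have "\<dots> = constL (inverse c * c) * idemL e"
      by (simp only: constL_simps(2)[symmetric] ac_simps)
    finally have "constL (inverse c) * (idemL e * x) = constL (inverse c * c) * idemL e" .
    then have e: "constL (inverse c) * (idemL e * x) = idemL e" using False by (simp add: constL_simps)
    then have "idemL e \<in> X" using x X_ideal X_const by (metis idemL_C_Stone)
    have "idemL e * \<delta> x = \<delta> (constL c * idemL e)"
      using c \<delta>_idem_mult[OF x] by (metis mult.commute)
    also have "\<dots> = 0" using \<delta>_const[OF \<open>idemL e \<in> X\<close>] \<delta>_idem[OF \<open>idemL e \<in> X\<close>] by simp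
    finally show ?thesis .
  qed
qed

lemma support_not_sigma_distributive:
  assumes x: "x \<in> X" and e: "e \<noteq> bot" "e \<le> support (\<delta> x)"
  shows "\<not> sigma_distributive_below e"
proof
  assume "sigma_distributive_below e"
  then obtain e' where e': "e' \<noteq> bot" "e' \<le> e" "const_on e' x"
    using e(1) by (rule sigma_distributive_locally_constant) auto
  then have "inf e' (support (\<delta> x)) = bot" using \<delta>_const_on[OF x e'(3)] idem_mult_zero_iff by blast
  with e e' show False by (metis inf.absorb1 order_trans)
qed

lemma Y_solid: "y \<in> Y \<Longrightarrow> modulusL z \<le> modulusL y \<Longrightarrow> z \<in> Y"
  using solid unfolding solid_space_def by meson

lemma Y_const: "y \<in> Y \<Longrightarrow> constL c * y \<in> Y"
  using solid unfolding solid_space_def subspaceL_def scaleL_eq_const by meson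

text \<open>On a suitable \<open>e\<close> both \<open>x\<close> and \<open>\<delta> x\<close> are bounded away from zero, so \<open>e\<close> is in the ideal. Given
\<open>y\<close>, partition \<open>e\<close> into pieces on which \<open>\<bar>y\<bar>\<close> is at most a number \<open>n\<close> and \<open>x\<close> is within \<open>1 / n\<close> of
a constant \<open>c\<close>. The mixture \<open>w\<close> of the elements \<open>n (x - c)\<close> is bounded by one, so \<open>e w\<close> is in
the ideal, while \<open>\<delta> (e w)\<close> is \<open>n \<delta> x\<close> on each piece and hence dominates \<open>e y\<close> up to a constant.\<close>

theorem values_fill_band:
  assumes x: "x \<in> X" and nz: "\<delta> x \<noteq> 0"
  obtains e where "e \<noteq> bot" "e \<le> support (\<delta> x)" "\<And>y. idemL e * y \<in> Y"
proof -
  have "idemL (support (\<delta> x)) * \<delta> x \<noteq> 0" using nz by simp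
  then obtain e1 r1 where e1: "e1 \<noteq> bot" "e1 \<le> support (\<delta> x)" "stone_clopen e1 \<subseteq> fin_dom (\<delta> x)"
    and r1: "0 < r1" "\<And>U. U \<in> stone_clopen e1 \<Longrightarrow> r1 \<le> cmod (cval (\<delta> x) U)"
    by (rule locally_bounded_below) blast
  have "inf e1 (support (\<delta> x)) \<noteq> bot" using e1 by (simp add: inf.absorb1)
  then have "idemL e1 * x \<noteq> 0" using \<delta>_vanish[OF x] idem_mult_zero_iff by blast
  then obtain e r2 where e: "e \<noteq> bot" "e \<le> e1" "stone_clopen e \<subseteq> fin_dom x"
    and r2: "0 < r2" "\<And>U. U \<in> stone_clopen e \<Longrightarrow> r2 \<le> cmod (cval x U)"
    by (rule locally_bounded_below) blast
  obtain v where v: "x * v = idemL (support x)" by (rule L0C_local_inverse)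
  have "inf (- support x) e = bot"
  proof -
    have "stone_clopen (- support x) \<inter> stone_clopen e = {}"
    proof (rule ccontr)
      assume "stone_clopen (- support x) \<inter> stone_clopen e \<noteq> {}"
      then obtain U where U: "U \<in> stone_clopen (- support x)" "U \<in> stone_clopen e" by blast
      then have "U \<notin> stone_clopen (support x)" using stone_clopen_compl_iff[OF stone_pointI] by blast
      then have "cval x U = 0" using cval_support e(3) U by blast
      with r2(1) r2(2)[OF U(2)] show False by simp
    qed
    then show ?thesis by (rule iffD1[OF stone_clopen_disjoint])
  qed
  then have e_supp: "e \<le> support x" by (simp add: inf.commute inf_shunt)
  then have ev: "idemL e * v * x = idemL e"
    by (metis v idemL_simps(1) inf.absorb1 mult.assoc mult.commute)
  have "idemL e * v \<in> C_Stone"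
  proof (rule bounded_in_C_Stone[OF open_dense_fin_dom[of v]])
    fix U assume U: "U \<in> fin_dom v"
    note Up = fin_dom_point[OF U]
    show "cmod (cval (idemL e * v) U) \<le> inverse r2"
    proof (cases "U \<in> stone_clopen e")
      case True
      have "cval (idemL e * v * x) U = cval (idemL e) U" by (simp only: ev)
      then have "cval v U * cval x U = 1" using True e(3) U Up by auto
      then have "cmod (cval v U) * cmod (cval x U) = 1" by (metis norm_mult norm_one)
      then have "cmod (cval v U) = inverse (cmod (cval x U))" by (simp add: inverse_unique mult.commute)
      also have "\<dots> \<le> inverse r2" using r2(1) r2(2)[OF True] by (intro le_imp_inverse_le)
      finally show ?thesis using True U Up by simp
    qed (use U Up r2 in simp)
  qed
  then have eX: "idemL e \<in> X" using X_ideal[OF _ x] ev by metis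
  have "idemL e * y \<in> Y" for y
  proof -
    define P where "P e' \<longleftrightarrow> (\<exists>n c. 0 < n \<and> (\<forall>U\<in>stone_clopen e' \<inter> fin_dom y. cmod (cval y U) \<le> n) \<and>
        (\<forall>U\<in>stone_clopen e'. n * cmod (cval x U - c) \<le> 1))" for e'
    have "\<exists>e''. e'' \<noteq> bot \<and> e'' \<le> e' \<and> P e''" if e': "e' \<noteq> bot" "e' \<le> e" for e'
    proof -
      obtain e2 d where e2: "e2 \<noteq> bot" "e2 \<le> e'" "stone_clopen e2 \<subseteq> fin_dom y"
        "\<And>U. U \<in> stone_clopen e2 \<Longrightarrow> cmod (cval y U - d) < 1"
        using locally_close[OF e'(1) zero_less_one, of y] by blast
      let ?n = "cmod d + 1"
      have n: "0 < ?n" by (simp add: add_nonneg_pos)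
      then have "0 < inverse ?n" by simp
      then obtain e3 c where e3: "e3 \<noteq> bot" "e3 \<le> e2" "stone_clopen e3 \<subseteq> fin_dom x"
        "\<And>U. U \<in> stone_clopen e3 \<Longrightarrow> cmod (cval x U - c) < inverse ?n"
        by (rule locally_close[where z = x, OF e2(1)]) blast
      have "cmod (cval y U) \<le> ?n" if "U \<in> stone_clopen e3" for U
        using e2(4)[of U] stone_clopen_mono[OF e3(2)] that norm_triangle_sub[of "cval y U" d] by fastforce
      moreover have "?n * cmod (cval x U - c) \<le> 1" if "U \<in> stone_clopen e3" for U
        using e3(4)[OF that] n by (simp add: field_simps)
      ultimately have "P e3" unfolding P_def using n by blast
      then show ?thesis using e3 e2 by (meson order_trans)
    qed
    then obtain D where D: "Sup D = e" "\<And>e'. e' \<in> D \<Longrightarrow> P e'"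
      "\<And>e' e''. e' \<in> D \<Longrightarrow> e'' \<in> D \<Longrightarrow> e' \<noteq> e'' \<Longrightarrow> inf e' e'' = bot"
      using exhaustion[of e P] by blast
    have "\<forall>e'\<in>D. \<exists>n c. 0 < n \<and> (\<forall>U\<in>stone_clopen e' \<inter> fin_dom y. cmod (cval y U) \<le> n) \<and>
        (\<forall>U\<in>stone_clopen e'. n * cmod (cval x U - c) \<le> 1)" using D(2) unfolding P_def by blast
    then obtain n c where nc: "\<And>e'. e' \<in> D \<Longrightarrow> 0 < n e'"
      "\<And>e' U. e' \<in> D \<Longrightarrow> U \<in> stone_clopen e' \<Longrightarrow> U \<in> fin_dom y \<Longrightarrow> cmod (cval y U) \<le> n e'"
      "\<And>e' U. e' \<in> D \<Longrightarrow> U \<in> stone_clopen e' \<Longrightarrow> n e' * cmod (cval x U - c e') \<le> 1"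
      by (metis IntI)
    \<comment> \<open>The factor \<open>idemL e\<close> keeps these elements in the ideal, which need not contain constants.\<close>
    let ?t = "\<lambda>e'. constL (of_real (n e')) * (idemL e * x + constL (- c e') * idemL e)"
    have tX: "?t e' \<in> X" for e' by (intro X_const X_add X_ideal idemL_C_Stone eX x)
    have t_val: "cval (?t e') U = of_real (n e') * (cval x U - c e')"
      if "e' \<in> D" "U \<in> stone_clopen e'" for e' U
    proof -
      have "e' \<le> e" using D(1) that(1) Sup_upper by blast
      then have "U \<in> stone_clopen e" using that(2) stone_clopen_mono by blast
      moreover from this have "U \<in> fin_dom x" using e(3) by blast
      moreover have "U \<in> stone_points" using that(2) by (rule stone_pointI)
      ultimately show ?thesis by simp
    qed
    obtain w where w: "\<And>e'. e' \<in> D \<Longrightarrow> idemL e' * w = idemL e' * ?t e'" "idemL (- Sup D) * w = 0"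
      using mixing[OF D(3), of D ?t] by blast
    have W: "open_dense ((\<Union>e'\<in>D. stone_clopen e') \<union> stone_clopen (- Sup D))" by (rule open_dense_partition)
    have "w \<in> C_Stone"
    proof (rule bounded_in_C_Stone[OF W])
      fix U assume U: "U \<in> (\<Union>e'\<in>D. stone_clopen e') \<union> stone_clopen (- Sup D)" "U \<in> fin_dom w"
      show "cmod (cval w U) \<le> 1"
        using U(1)
      proof
        assume "U \<in> (\<Union>e'\<in>D. stone_clopen e')"
        then obtain e' where e': "e' \<in> D" "U \<in> stone_clopen e'" by blast
        have "U \<in> fin_dom (?t e')" using tX X_C_Stone C_Stone_iff stone_pointI[OF e'(2)] by blast
        then have "cval w U = of_real (n e') * (cval x U - c e')"
          using idem_mult_eqD[OF w(1)[OF e'(1)] e'(2) U(2)] t_val[OF e'] by simp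
        then show ?thesis using nc(1)[OF e'(1)] nc(3)[OF e'] by (simp add: norm_mult)
      next
        assume "U \<in> stone_clopen (- Sup D)"
        then have "cval w U = cval 0 U"
          using w(2) U(2) fin_dom_point[OF U(2)] by (intro idem_mult_eqD[of "- Sup D"]) auto
        then show ?thesis using fin_dom_point[OF U(2)] by simp
      qed
    qed
    then have ewX: "w * idemL e \<in> X" using eX by (rule X_ideal)
    have \<delta>w: "idemL e' * \<delta> (w * idemL e) = idemL e' * (constL (of_real (n e')) * \<delta> x)" if "e' \<in> D" for e'
    proof -
      have "e' \<le> e" using D(1) that Sup_upper by blast
      then have ee: "idemL e' * idemL e = idemL e'" by (simp add: idemL_simps inf.absorb1)
      have "idemL e' * (w * idemL e) = idemL e' * w" by (metis ee mult.assoc mult.commute)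
      then have "idemL e' * \<delta> (w * idemL e) = idemL e' * \<delta> (?t e')"
        using w(1)[OF that] by (intro \<delta>_local ewX tX) simp
      also have "\<delta> (?t e') = constL (of_real (n e')) * (idemL e * \<delta> x)"
        using \<delta>_const \<delta>_add \<delta>_idem_mult \<delta>_idem X_const X_ideal X_add eX x by simp
      also have "idemL e' * \<dots> = idemL e' * (constL (of_real (n e')) * \<delta> x)"
        by (metis ee mult.assoc mult.left_commute)
      finally show ?thesis .
    qed
    have "modulusL (idemL e * y) \<le> modulusL (constL (of_real (inverse r1)) * \<delta> (w * idemL e))"
    proof (rule modulusL_leI)
      show "open_dense (((\<Union>e'\<in>D. stone_clopen e') \<union> stone_clopen (- Sup D)) \<inter> (fin_dom y \<inter> (fin_dom (\<delta> (w * idemL e)) \<inter> fin_dom (\<delta> x))))"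
        by (intro open_dense_Int W open_dense_fin_dom)
      fix U assume "U \<in> ((\<Union>e'\<in>D. stone_clopen e') \<union> stone_clopen (- Sup D)) \<inter> (fin_dom y \<inter> (fin_dom (\<delta> (w * idemL e)) \<inter> fin_dom (\<delta> x)))"
      then have U: "U \<in> (\<Union>e'\<in>D. stone_clopen e') \<union> stone_clopen (- Sup D)" "U \<in> fin_dom y"
        "U \<in> fin_dom (\<delta> (w * idemL e))" "U \<in> fin_dom (\<delta> x)" by blast+
      note Up = fin_dom_point[OF U(2)]
      show "cmod (cval (idemL e * y) U) \<le> cmod (cval (constL (of_real (inverse r1)) * \<delta> (w * idemL e)) U)"
        using U(1)
      proof
        assume "U \<in> (\<Union>e'\<in>D. stone_clopen e')"
        then obtain e' where e': "e' \<in> D" "U \<in> stone_clopen e'" by blast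
        have "e' \<le> e1" using D(1) e'(1) Sup_upper e(2) by (metis order_trans)
        then have U1: "U \<in> stone_clopen e1" using e'(2) stone_clopen_mono by blast
        have "cval (\<delta> (w * idemL e)) U = of_real (n e') * cval (\<delta> x) U"
          using idem_mult_eqD[OF \<delta>w[OF e'(1)] e'(2) U(3)] U(4) Up by simp
        then have "cmod (cval (constL (of_real (inverse r1)) * \<delta> (w * idemL e)) U) = inverse r1 * (n e' * cmod (cval (\<delta> x) U))"
          using U Up r1(1) nc(1)[OF e'(1)] by (simp add: norm_mult norm_inverse)
        moreover have "n e' \<le> inverse r1 * (n e' * cmod (cval (\<delta> x) U))"
          using r1(1) r1(2)[OF U1] nc(1)[OF e'(1)] by (simp add: field_simps)
        moreover have "cmod (cval (idemL e * y) U) \<le> n e'"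
          using nc(2)[OF e' U(2)] nc(1)[OF e'(1)] U(2) Up by (simp add: norm_mult)
        ultimately show ?thesis by simp
      next
        assume "U \<in> stone_clopen (- Sup D)"
        then have "U \<notin> stone_clopen e" using stone_clopen_compl_iff[OF Up] D(1) by blast
        then show ?thesis using U(2) Up by simp
      qed
    qed
    then show ?thesis by (rule Y_solid[rotated]) (intro Y_const \<delta>_Y ewX)
  qed
  moreover have "e \<le> support (\<delta> x)" using e(2) e1(2) by (rule order_trans)
  ultimately show thesis using that e(1) by blast
qed

end

section \<open>Spaces that contain no full band\<close>

lemma idemL_eq_zero_iff: "idemL e = 0 \<longleftrightarrow> e = bot"
proof
  assume "idemL e = 0"
  then have "cval (idemL e) U = cval 0 U" for U by simp
  moreover have "cval (idemL e) U = 1 \<and> cval 0 U = 0" if "U \<in> stone_clopen e" for U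
    using that stone_pointI[OF that] by simp
  ultimately have "stone_clopen e = {}" by fastforce
  then show "e = bot" using stone_clopen_nonempty by blast
qed (simp add: idemL_simps)

text \<open>At some point of \<open>e\<close> the function differs from its value at \<open>U\<close>; near that point it stays away from
this value, which yields a part that misses \<open>U\<close>.\<close>

lemma nowhere_constant_splits:
  assumes e: "e \<noteq> bot" "e \<le> e0" and nc: "\<And>e'. e' \<noteq> bot \<Longrightarrow> e' \<le> e0 \<Longrightarrow> \<not> const_on e' b"
  obtains a where "a \<noteq> bot" "a < e"
proof -
  obtain U where U: "U \<in> stone_clopen e" "U \<in> fin_dom b"
    using open_dense_fin_dom[of b] e(1) unfolding open_dense_def by blast
  have "idemL e * (b - constL (cval b U)) \<noteq> 0"
    using nc[OF e] unfolding const_on_def by (simp add: algebra_simps)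
  then obtain V where V: "V \<in> stone_clopen e" "V \<in> fin_dom (b - constL (cval b U))" "cval (b - constL (cval b U)) V \<noteq> 0"
    by (rule idem_mult_nonzero)
  obtain e' r where "e' \<noteq> bot" "e' \<le> e" and e': "stone_clopen e' \<subseteq> fin_dom (b - constL (cval b U))" "0 < r"
    "\<And>V. V \<in> stone_clopen e' \<Longrightarrow> r \<le> cmod (cval (b - constL (cval b U)) V)"
    using locally_bounded_below[OF \<open>idemL e * (b - constL (cval b U)) \<noteq> 0\<close>] by blast
  have "e' \<noteq> e"
  proof
    assume "e' = e"
    then have "r \<le> 0" using e'(3)[of U] U fin_dom_point[OF U(2)] by simp
    with e'(2) show False by simp
  qed
  with that \<open>e' \<noteq> bot\<close> \<open>e' \<le> e\<close> show thesis by (simp add: order_less_le)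
qed

text \<open>Below an idempotent on which some element is nowhere constant there are no atoms, so there is a strictly
decreasing sequence; its successive differences are disjoint.\<close>

lemma disjoint_sequence:
  assumes "\<not> sigma_distributive_below e"
  obtains k :: "nat \<Rightarrow> 'b::{boolean_algebra,complete_lattice}" where "\<And>n. k n \<noteq> bot" "\<And>n. k n \<le> e"
    "\<And>m n. m \<noteq> n \<Longrightarrow> inf (k m) (k n) = bot"
proof -
  obtain b :: "'b L0C" and e0 where e0: "e0 \<noteq> bot" "e0 \<le> e" and nc: "\<And>e'. e' \<noteq> bot \<Longrightarrow> e' \<le> e0 \<Longrightarrow> \<not> const_on e' b"
    using nowhere_constant_element[OF assms] by blast
  have "\<exists>a'. (a' \<noteq> bot \<and> a' \<le> e0) \<and> a' < a" if "a \<noteq> bot \<and> a \<le> e0" for a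
    using nowhere_constant_splits[of a e0 b] that nc by (metis less_imp_le order_trans)
  moreover have "e0 \<noteq> bot \<and> e0 \<le> e0" using e0 by simp
  ultimately obtain h where h: "\<And>n. h n \<noteq> bot \<and> h n \<le> e0" "\<And>n. h (Suc n) < h n"
    using dependent_nat_choice[of "\<lambda>_ a. a \<noteq> bot \<and> a \<le> e0" "\<lambda>_ a a'. a' < a"] by metis
  have dec: "h n \<le> h m" if "m \<le> n" for m n
    using h(2) that by (metis less_imp_le lift_Suc_antimono_le)
  define k where "k n = inf (h n) (- h (Suc n))" for n
  have "k n \<noteq> bot" for n using h(2)[of n] by (auto simp: k_def inf_shunt)
  moreover have "k n \<le> e" for n using h(1)[of n] e0(2) by (auto simp: k_def intro: le_infI1 order_trans)
  moreover have disj: "inf (k m) (k n) = bot" if "m < n" for m n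
  proof -
    have "k n \<le> h (Suc m)" using dec[of "Suc m" n] that by (simp add: k_def le_infI1)
    moreover have "k m \<le> - h (Suc m)" by (simp add: k_def)
    ultimately show ?thesis by (metis inf_shunt compl_le_swap1 inf.commute order_trans)
  qed
  moreover have "inf (k m) (k n) = bot" if "m \<noteq> n" for m n
    using disj[of m n] disj[of n m] that by (metis inf.commute linorder_neqE_nat)
  ultimately show thesis using that by blast
qed

lemma full_band_sequence:
  fixes k :: "nat \<Rightarrow> 'b::{boolean_algebra,complete_lattice}" and t :: "nat \<Rightarrow> complex"
  assumes ne: "\<And>n. k n \<noteq> bot" and disj: "\<And>m n. m \<noteq> n \<Longrightarrow> inf (k m) (k n) = bot"
  obtains z where "\<And>n. idemL (k n) * z = idemL (k n) * constL (t n)"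
proof -
  have "inj k"
  proof (rule injI)
    fix m n assume "k m = k n"
    then show "m = n" using disj[of m n] ne[of m] by auto
  qed
  obtain z where z: "\<And>e. e \<in> range k \<Longrightarrow> idemL e * z = idemL e * constL (t (inv k e))"
    using mixing[of "range k" "\<lambda>e. constL (t (inv k e))"] disj by (metis (no_types, lifting) rangeE)
  show thesis by (rule that[of z]) (use z \<open>inj k\<close> in simp)
qed

text \<open>Mix the multiples of the \<open>k n\<close> with quasi-norm \<open>n\<close>. The mixture dominates each of them, so its
quasi-norm would exceed every \<open>n\<close>.\<close>

theorem full_band_no_quasi_norm:
  assumes N: "quasi_norm_on Y N" "monotone_norm_on Y N"
    and Y: "\<And>y. idemL e * y \<in> Y" and nd: "\<not> sigma_distributive_below e"
  shows False
proof -
  obtain k :: "nat \<Rightarrow> _" where k: "\<And>n. k n \<noteq> bot" "\<And>n. k n \<le> e" "\<And>m n. m \<noteq> n \<Longrightarrow> inf (k m) (k n) = bot"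
    by (rule disjoint_sequence[OF nd]) blast
  have ek: "idemL e * idemL (k n) = idemL (k n)" for n using k(2)[of n] by (simp add: idemL_simps inf.absorb2)
  then have kY: "idemL (k n) \<in> Y" for n using Y[of "idemL (k n)"] by simp
  have pos: "0 < N (idemL (k n))" for n
  proof -
    have "idemL (k n) \<noteq> 0" using k(1) by (simp add: idemL_eq_zero_iff)
    then show ?thesis using N(1) kY unfolding quasi_norm_on_def by (metis order_le_less)
  qed
  let ?t = "\<lambda>n. real n / N (idemL (k n))"
  obtain z where z: "\<And>n. idemL (k n) * z = idemL (k n) * constL (of_real (?t n))"
    using full_band_sequence[of k "\<lambda>n. of_real (?t n)"] k by metis
  have "real n \<le> N (idemL e * z)" for n
  proof -
    have "scaleL (of_real (?t n)) (idemL (k n)) = idemL (k n) * (idemL e * z)"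
      unfolding scaleL_eq_const using z[of n] ek[of n] by (metis mult.assoc mult.commute)
    moreover have "modulusL (idemL (k n) * (idemL e * z)) \<le> modulusL (idemL e * z)"
      by (rule modulusL_leI[OF open_dense_fin_dom[of "idemL e * z"]]) (auto dest: fin_dom_point simp: norm_mult)
    moreover have "idemL (k n) * (idemL e * z) \<in> Y" using Y[of "idemL (k n) * z"] by (simp add: mult.left_commute)
    ultimately have "N (scaleL (of_real (?t n)) (idemL (k n))) \<le> N (idemL e * z)"
      using N(2) Y unfolding monotone_norm_on_def by metis
    moreover have "N (scaleL (of_real (?t n)) (idemL (k n))) = cmod (of_real (?t n)) * N (idemL (k n))"
      using N(1) kY unfolding quasi_norm_on_def by metis
    ultimately show ?thesis using pos[of n] by (simp add: norm_divide)
  qed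
  moreover obtain n where "N (idemL e * z) < real n" using reals_Archimedean2 by blast
  ultimately show False by (meson not_less)
qed

text \<open>The element with value \<open>n\<close> on \<open>k n\<close> is infinite somewhere: an ultrafilter that contains every element
above almost all \<open>k n\<close> is a point each of whose neighbourhoods meets infinitely many of them.\<close>

theorem full_band_unbounded:
  assumes Y: "\<And>y. idemL e * y \<in> C_Stone" and nd: "\<not> sigma_distributive_below e"
  shows False
proof -
  obtain k :: "nat \<Rightarrow> _" where k: "\<And>n. k n \<noteq> bot" "\<And>n. k n \<le> e" "\<And>m n. m \<noteq> n \<Longrightarrow> inf (k m) (k n) = bot"
    by (rule disjoint_sequence[OF nd]) blast
  obtain z where z: "\<And>n. idemL (k n) * z = idemL (k n) * constL (of_nat n)"
    using full_band_sequence[of k "\<lambda>n. of_nat n"] k by metis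
  let ?F = "{x. \<exists>n. \<forall>m\<ge>n. k m \<le> x}"
  have "bool_filter ?F"
    unfolding bool_filter_def
  proof (intro conjI ballI allI impI)
    show "bot \<notin> ?F" using k(1) by (auto simp: bot_unique)
    show "inf a b \<in> ?F" if "a \<in> ?F" "b \<in> ?F" for a b
    proof -
      obtain n n' where "\<forall>m\<ge>n. k m \<le> a" "\<forall>m\<ge>n'. k m \<le> b" using \<open>a \<in> ?F\<close> \<open>b \<in> ?F\<close> by blast
      then have "\<forall>m\<ge>max n n'. k m \<le> inf a b" by simp
      then show ?thesis by blast
    qed
  qed (auto intro: order_trans)
  then obtain U where U: "bool_ultrafilter U" "?F \<subseteq> U" by (rule bool_filter_extend)
  then have Up: "U \<in> stone_points" by (simp add: topspace_stone_space)
  let ?z = "idemL e * z"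
  have fin: "U \<in> fin_dom ?z" using Y[of z] Up unfolding C_Stone_iff by blast
  have "((\<lambda>V. cmod (cval ?z V)) \<longlongrightarrow> cmod (cval ?z U)) (nhdsin stone_space U)"
    using cval_tendsto[OF fin] by (intro tendsto_intros)
  then have "\<forall>\<^sub>F V in nhdsin stone_space U. cmod (cval ?z V) < cmod (cval ?z U) + 1"
    by (rule order_tendstoD) simp
  then obtain c where c: "U \<in> stone_clopen c" "\<forall>V\<in>stone_clopen c. cmod (cval ?z V) < cmod (cval ?z U) + 1"
    unfolding eventually_nhdsin_stone[OF Up] by blast
  obtain n where n: "cmod (cval ?z U) + 1 < real n" using reals_Archimedean2 by blast
  have "\<exists>m\<ge>n. inf (k m) c \<noteq> bot"
  proof (rule ccontr)
    assume "\<not> ?thesis"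
    then have "- c \<in> ?F" by (auto simp: inf_shunt)
    then have "- c \<in> U" using U(2) by blast
    then show False using c(1) U(1) by (auto simp: stone_clopen_def bool_ultrafilter_compl)
  qed
  then obtain m V where m: "m \<ge> n" and V: "V \<in> stone_clopen (inf (k m) c)"
    using stone_clopen_nonempty by blast
  then have Vk: "V \<in> stone_clopen (k m)" "V \<in> stone_clopen c" by (auto simp: stone_clopen_inf)
  have "idemL (k m) * ?z = idemL (k m) * constL (of_nat m)"
    using z[of m] k(2)[of m] by (metis idemL_simps(1) inf.absorb1 mult.assoc)
  then have "cval ?z V = of_nat m"
    using idem_mult_eqD[of "k m" ?z "constL (of_nat m)" V] Vk Y[of z] stone_pointI[OF V] by (simp add: C_Stone_iff del: cval_simps)
  then have "real m < real n" using c(2) Vk(2) n by fastforce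
  with m show False by simp
qed

section \<open>Derivations as subrings of the dual numbers\<close>

text \<open>The ring of pairs \<open>x + y \<epsilon>\<close> with \<open>\<epsilon>\<^sup>2 = 0\<close>. A map \<open>\<delta>\<close> is a derivation exactly if its graph,
the set of all \<open>x + \<delta> x \<epsilon>\<close>, is a subring; extending derivations means enlarging such subrings.\<close>

datatype 'a dual = Dual (dual_base: 'a) (dual_slope: 'a)

instantiation dual :: (comm_ring) comm_ring
begin

definition "0 = Dual 0 0"
definition "p + q = Dual (dual_base p + dual_base q) (dual_slope p + dual_slope q)"
definition "p - q = Dual (dual_base p - dual_base q) (dual_slope p - dual_slope q)"
definition "- p = Dual (- dual_base p) (- dual_slope p)"
definition "p * q = Dual (dual_base p * dual_base q) (dual_slope p * dual_base q + dual_base p * dual_slope q)"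

instance
  by standard (auto simp: zero_dual_def plus_dual_def minus_dual_def uminus_dual_def times_dual_def algebra_simps)

end

lemma dual_simps [simp]:
  "dual_base 0 = 0" "dual_slope 0 = 0"
  "dual_base (p + q) = dual_base p + dual_base q" "dual_slope (p + q) = dual_slope p + dual_slope q"
  "dual_base (p - q) = dual_base p - dual_base q" "dual_slope (p - q) = dual_slope p - dual_slope q"
  "dual_base (- p) = - dual_base p" "dual_slope (- p) = - dual_slope p"
  "dual_base (p * q) = dual_base p * dual_base q"
  "dual_slope (p * q) = dual_slope p * dual_base q + dual_base p * dual_slope q"
  by (simp_all add: zero_dual_def plus_dual_def minus_dual_def uminus_dual_def times_dual_def)

lemma dual_eqI: "dual_base p = dual_base q \<Longrightarrow> dual_slope p = dual_slope q \<Longrightarrow> p = q"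
  by (rule dual.expand) simp

text \<open>The last condition makes the subring single-valued. The two before it say that constants and
idempotents belong to the domain and have derivative zero.\<close>

definition derivation_graph :: "'b::{boolean_algebra,complete_lattice} L0C dual set \<Rightarrow> bool" where
  "derivation_graph G \<longleftrightarrow>
     (\<forall>p\<in>G. \<forall>q\<in>G. p + q \<in> G \<and> p * q \<in> G) \<and>
     (\<forall>c. Dual (constL c) 0 \<in> G) \<and> (\<forall>e. Dual (idemL e) 0 \<in> G) \<and> (\<forall>y. Dual 0 y \<in> G \<longrightarrow> y = 0)"

locale graph_extension =
  fixes G :: "'b::{boolean_algebra,complete_lattice} L0C dual set" and b :: "'b L0C"
  assumes graph: "derivation_graph G"
begin

lemma G_add: "p \<in> G \<Longrightarrow> q \<in> G \<Longrightarrow> p + q \<in> G"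
  and G_mult: "p \<in> G \<Longrightarrow> q \<in> G \<Longrightarrow> p * q \<in> G"
  and G_const: "Dual (constL c) 0 \<in> G"
  and G_idem: "Dual (idemL e) 0 \<in> G"
  and G_slope_zero: "Dual 0 y \<in> G \<Longrightarrow> y = 0"
  using graph unfolding derivation_graph_def by blast+

lemma G_zero: "0 \<in> G"
  using G_const[of 0] by (simp add: zero_dual_def constL_simps)

lemma G_diff: "p \<in> G \<Longrightarrow> q \<in> G \<Longrightarrow> p - q \<in> G"
proof -
  assume "p \<in> G" "q \<in> G"
  then have "p + Dual (constL (-1)) 0 * q \<in> G" by (intro G_add G_mult G_const)
  moreover have "constL (-1) = - (1 :: 'b L0C)"
    using constL_simps(1)[of "-1" 1, where 'a='b] by (simp add: constL_simps eq_neg_iff_add_eq_0)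
  then have "p + Dual (constL (-1)) 0 * q = p - q" by (intro dual_eqI) simp_all
  ultimately show ?thesis by simp
qed

lemma idem_slope_zero: "p \<in> G \<Longrightarrow> idemL e * dual_base p = 0 \<Longrightarrow> idemL e * dual_slope p = 0"
proof -
  assume "p \<in> G" and z: "idemL e * dual_base p = 0"
  then have "Dual (idemL e) 0 * p \<in> G" by (intro G_mult G_idem)
  moreover have "Dual (idemL e) 0 * p = Dual 0 (idemL e * dual_slope p)"
    by (rule dual_eqI) (simp_all add: z)
  ultimately show ?thesis using G_slope_zero by metis
qed

definition G_poly :: "'b L0C dual poly \<Rightarrow> bool" where
  "G_poly P \<longleftrightarrow> (\<forall>i. coeff P i \<in> G)"

text \<open>Polynomials over the domain of the partial derivation that vanish at \<open>b\<close>, each carrying the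
derivatives of its coefficients. Evaluated at \<open>b + d \<epsilon>\<close>, the slope is what the derivative of the
value would be if \<open>b\<close> had derivative \<open>d\<close>; so \<open>d\<close> is admissible if it has slope zero on all relations.\<close>

definition relation :: "'b L0C dual poly \<Rightarrow> bool" where
  "relation P \<longleftrightarrow> G_poly P \<and> dual_base (poly P (Dual b 0)) = 0"

definition slope_at :: "'b L0C \<Rightarrow> 'b L0C dual poly \<Rightarrow> 'b L0C" where
  "slope_at d P = dual_slope (poly P (Dual b d))"

lemma G_poly_smult: "p \<in> G \<Longrightarrow> G_poly P \<Longrightarrow> G_poly (smult p P)"
  by (simp add: G_poly_def G_mult)

lemma G_poly_pCons: "p \<in> G \<Longrightarrow> G_poly P \<Longrightarrow> G_poly (pCons p P)"
  by (auto simp: G_poly_def coeff_pCons split: nat.split)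

lemma G_poly_pConsD: "G_poly (pCons p P) \<Longrightarrow> p \<in> G \<and> G_poly P"
  unfolding G_poly_def by (metis coeff_pCons_0 coeff_pCons_Suc)

lemma G_poly_add: "G_poly P \<Longrightarrow> G_poly Q \<Longrightarrow> G_poly (P + Q)"
  by (simp add: G_poly_def G_add)

lemma G_poly_diff: "G_poly P \<Longrightarrow> G_poly Q \<Longrightarrow> G_poly (P - Q)"
  by (simp add: G_poly_def G_diff)

lemma G_poly_mult: "G_poly P \<Longrightarrow> G_poly Q \<Longrightarrow> G_poly (P * Q)"
proof (induction P)
  case 0
  then show ?case by (simp add: G_poly_def G_zero)
next
  case (pCons p P)
  then have "G_poly (smult p Q + pCons 0 (P * Q))"
    using G_poly_pConsD by (intro G_poly_add G_poly_smult G_poly_pCons G_zero) blast+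
  then show ?case by simp
qed

text \<open>The slope at \<open>b + d \<epsilon>\<close> is affine in \<open>d\<close>, with linear coefficient the value at \<open>b\<close> of the formal
derivative. The coefficients show that the latter has smaller degree and a top coefficient that
vanishes only where that of \<open>P\<close> does.\<close>

lemma formal_derivative:
  fixes P :: "'b L0C dual poly"
  obtains P' where "\<And>i. coeff P' i = Dual (constL (of_nat (Suc i))) 0 * coeff P (Suc i)"
    "\<And>d. poly P (Dual b d) =
       Dual (dual_base (poly P (Dual b 0))) (slope_at 0 P + dual_base (poly P' (Dual b 0)) * d)"
proof -
  have "\<exists>P'. (\<forall>i. coeff P' i = Dual (constL (of_nat (Suc i))) 0 * coeff P (Suc i)) \<and>
    (\<forall>d. poly P (Dual b d) =
       Dual (dual_base (poly P (Dual b 0))) (slope_at 0 P + dual_base (poly P' (Dual b 0)) * d))"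
  proof (induction P)
    case 0
    show ?case by (intro exI[of _ 0]) (simp add: slope_at_def, metis zero_dual_def mult_zero_right dual_simps(1,2))
  next
    case (pCons a P)
    then obtain P' where c: "\<And>i. coeff P' i = Dual (constL (of_nat (Suc i))) 0 * coeff P (Suc i)"
      and v: "\<And>d. poly P (Dual b d) =
         Dual (dual_base (poly P (Dual b 0))) (slope_at 0 P + dual_base (poly P' (Dual b 0)) * d)"
      by blast
    have "coeff (P + pCons 0 P') i = Dual (constL (of_nat (Suc i))) 0 * coeff (pCons a P) (Suc i)" for i
    proof (cases i)
      case 0
      then show ?thesis by (intro dual_eqI) (simp_all add: constL_simps)
    next
      case (Suc j)
      have "constL (of_nat (Suc (Suc j))) = 1 + (constL (of_nat (Suc j)) :: 'b L0C)"
        by (simp flip: constL_simps(4) add: constL_simps(1))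
      then show ?thesis using Suc c[of j] by (intro dual_eqI) (simp_all add: algebra_simps)
    qed
    moreover have "poly (pCons a P) (Dual b d) =
       Dual (dual_base (poly (pCons a P) (Dual b 0)))
         (slope_at 0 (pCons a P) + dual_base (poly (P + pCons 0 P') (Dual b 0)) * d)" for d
      by (rule dual_eqI) (simp_all add: v[of d] slope_at_def algebra_simps)
    ultimately show ?case by blast
  qed
  with that show thesis by blast
qed

lemma base_at: "dual_base (poly P (Dual b d)) = dual_base (poly P (Dual b 0))"
  by (rule formal_derivative[of P]) (metis dual.sel(1))

text \<open>On \<open>e\<close> the coefficients vanish together with their derivatives, so the whole polynomial does.\<close>

lemma vanishing_on:
  assumes P: "G_poly P" and z: "\<And>i. idemL e * dual_base (coeff P i) = 0"
  shows "idemL e * slope_at d P = 0" "idemL e * dual_base (poly P (Dual b d)) = 0"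
proof -
  have "smult (Dual (idemL e) 0) P = 0"
    using P z idem_slope_zero by (intro poly_eqI dual_eqI) (simp_all add: G_poly_def)
  then have "poly (smult (Dual (idemL e) 0) P) (Dual b d) = 0" by simp
  then have "Dual (idemL e) 0 * poly P (Dual b d) = 0" by simp
  then have "dual_slope (Dual (idemL e) 0 * poly P (Dual b d)) = 0" "dual_base (Dual (idemL e) 0 * poly P (Dual b d)) = 0"
    by simp_all
  then show "idemL e * slope_at d P = 0" "idemL e * dual_base (poly P (Dual b d)) = 0"
    by (simp_all add: slope_at_def)
qed

lemma relation_idem_smult: "relation P \<Longrightarrow> relation (smult (Dual (idemL e) 0) P)"
  by (simp add: relation_def G_poly_smult G_idem)

text \<open>Multiply by a local inverse of \<open>x\<close>.\<close>

lemma support_cancel: "e \<le> support x \<Longrightarrow> idemL e * (x * y) = 0 \<Longrightarrow> idemL e * y = 0"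
proof -
  assume e: "e \<le> support x" and z: "idemL e * (x * y) = 0"
  obtain w where w: "x * w = idemL (support x)" by (rule L0C_local_inverse)
  have "idemL e * y = idemL e * idemL (support x) * y"
    using e by (simp add: idemL_simps inf.absorb1)
  also have "\<dots> = w * (idemL e * (x * y))" by (simp only: w[symmetric] ac_simps)
  finally show ?thesis using z by simp
qed

text \<open>As the domain is not a field, the degree of a relation depends on the piece \<open>e\<close>: what counts is that
its top coefficient does not vanish on \<open>e\<close>.\<close>

definition leading_on :: "'b \<Rightarrow> nat \<Rightarrow> 'b L0C dual poly \<Rightarrow> bool" where
  "leading_on e n P \<longleftrightarrow> relation P \<and> degree P \<le> n \<and> idemL e * dual_base (coeff P n) \<noteq> 0"

text \<open>Multiplication by \<open>e\<close> removes the coefficients that vanish on \<open>e\<close>, and this lowers the degree to the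
largest index that survives.\<close>

lemma leading_on_exists:
  assumes P: "relation P" and i: "idemL e * dual_base (coeff P i) \<noteq> 0"
  obtains n Q where "leading_on e n Q" "idemL e * dual_base (coeff P n) \<noteq> 0"
proof -
  let ?S = "{j. idemL e * dual_base (coeff P j) \<noteq> 0}"
  have fin: "finite ?S"
  proof (rule finite_subset)
    show "?S \<subseteq> {..degree P}"
      by (metis (mono_tags, lifting) atMost_iff coeff_eq_0 dual_simps(1) linorder_not_le mem_Collect_eq mult_zero_right subsetI)
  qed simp
  let ?n = "Max ?S" and ?Q = "smult (Dual (idemL e) 0) P"
  have n: "?n \<in> ?S" using fin i by (intro Max_in) auto
  have "coeff ?Q j = 0" if "j > ?n" for j
  proof (rule dual_eqI)
    have z: "idemL e * dual_base (coeff P j) = 0"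
      using that Max_ge[OF fin, of j] by auto
    then show "dual_base (coeff ?Q j) = dual_base 0" by simp
    show "dual_slope (coeff ?Q j) = dual_slope 0"
      using idem_slope_zero[OF _ z] P by (simp add: relation_def G_poly_def)
  qed
  then have "degree ?Q \<le> ?n" by (intro degree_le) blast
  moreover have "idemL e * dual_base (coeff ?Q ?n) \<noteq> 0"
    using n by (simp add: idemL_simps flip: mult.assoc)
  ultimately have "leading_on e ?n ?Q" using relation_idem_smult[OF P] by (simp add: leading_on_def)
  with n that show thesis by blast
qed

text \<open>If no relation is non-trivial on \<open>e\<close>, every \<open>d\<close> is admissible there. Otherwise take a relation \<open>P\<close> of
minimal degree \<open>n\<close> on \<open>e\<close> and let \<open>e'\<close> be the part of \<open>e\<close> where its top coefficient \<open>k\<close> is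
invertible. By minimality the value \<open>g\<close> of the formal derivative is invertible on \<open>e'\<close>, so exactly one
\<open>d\<close> gives \<open>P\<close> slope zero there. Every other relation then has slope zero on \<open>e'\<close> by division with
remainder: multiplying by \<open>k\<close> and subtracting a multiple of \<open>P\<close> lowers its degree.\<close>

lemma local_slope:
  assumes "e \<noteq> bot"
  obtains e' d where "e' \<noteq> bot" "e' \<le> e" "\<And>P. relation P \<Longrightarrow> idemL e' * slope_at d P = 0"
proof (cases "\<exists>n P. leading_on e n P")
  case False
  have "idemL e * slope_at 0 P = 0" if P: "relation P" for P
  proof (rule vanishing_on)
    show "G_poly P" using P by (simp add: relation_def)
    show "idemL e * dual_base (coeff P i) = 0" for i
      using leading_on_exists[OF P] False by blast
  qed
  then show ?thesis using that[of e 0] assms by blast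
next
  case True
  define n where "n = (LEAST n. \<exists>P. leading_on e n P)"
  have "\<exists>P. leading_on e n P" unfolding n_def using True by (rule LeastI_ex)
  then obtain P where P: "relation P" "degree P \<le> n" "idemL e * dual_base (coeff P n) \<noteq> 0"
    unfolding leading_on_def by blast
  have minimal: "\<not> leading_on e j Q" if "j < n" for j Q
    using not_less_Least[of j "\<lambda>n. \<exists>P. leading_on e n P"] that by (auto simp: n_def)
  define k where "k = coeff P n"
  have kG: "k \<in> G" using P(1) by (simp add: k_def relation_def G_poly_def)
  define e' where "e' = inf e (support (dual_base k))"
  have ne: "e' \<noteq> bot" using P(3) by (simp add: e'_def k_def idem_mult_zero_iff)
  have "e' \<le> e" and e'k: "e' \<le> support (dual_base k)" by (simp_all add: e'_def)
  have ee: "idemL e * idemL e' = idemL e'" using \<open>e' \<le> e\<close> by (simp add: idemL_simps inf.absorb2)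
  \<comment> \<open>Minimality: a relation whose coefficients from index \<open>n\<close> on vanish on \<open>e'\<close> is trivial there.\<close>
  have low: "idemL e' * dual_base (coeff R i) = 0"
    if R: "relation R" and hi: "\<And>i. i \<ge> n \<Longrightarrow> idemL e' * dual_base (coeff R i) = 0" for R i
  proof (rule ccontr)
    assume nz: "idemL e' * dual_base (coeff R i) \<noteq> 0"
    let ?R = "smult (Dual (idemL e') 0) R"
    have eq: "idemL e * dual_base (coeff ?R j) = idemL e' * dual_base (coeff R j)" for j
      by (simp add: ee flip: mult.assoc)
    then have "idemL e * dual_base (coeff ?R i) \<noteq> 0" using nz by simp
    then obtain j Q where "leading_on e j Q" "idemL e * dual_base (coeff ?R j) \<noteq> 0"
      using leading_on_exists[OF relation_idem_smult[OF R]] by blast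
    moreover from this have "j < n" using hi[of j] eq[of j] by (metis linorder_not_le)
    ultimately show False using minimal by blast
  qed
  have "0 < n"
  proof (rule ccontr)
    assume "\<not> 0 < n"
    then have "degree P = 0" using P(2) by simp
    then obtain a where "P = [:a:]" by (rule degree_eq_zeroE)
    then have "P = [:k:]" using \<open>\<not> 0 < n\<close> by (simp add: k_def)
    then have "dual_base k = 0" using P(1) by (auto simp: relation_def)
    with P(3) show False by (simp add: k_def)
  qed
  obtain P' where P': "\<And>i. coeff P' i = Dual (constL (of_nat (Suc i))) 0 * coeff P (Suc i)"
    and Pd: "\<And>d. poly P (Dual b d) =
       Dual (dual_base (poly P (Dual b 0))) (slope_at 0 P + dual_base (poly P' (Dual b 0)) * d)"
    by (rule formal_derivative[of P]) blast
  have GP': "G_poly P'" using P(1) P' by (simp add: G_poly_def relation_def G_mult G_const)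
  define g where "g = dual_base (poly P' (Dual b 0))"
  have "e' \<le> support g"
  proof -
    \<comment> \<open>On \<open>e3\<close> the formal derivative is a relation of degree below \<open>n\<close>, hence trivial; its top coefficient
      is \<open>n\<close> times the top coefficient of \<open>P\<close>, which is invertible there.\<close>
    define e3 where "e3 = inf e' (- support g)"
    let ?R = "smult (Dual (idemL e3) 0) P'"
    have "inf e3 (support g) = bot" by (simp add: e3_def inf.assoc)
    then have "idemL e3 * g = 0" by (simp add: idem_mult_zero_iff)
    then have relR: "relation ?R" using GP' by (simp add: relation_def G_poly_smult G_idem g_def)
    have coeffR: "coeff ?R i = 0" if "i \<ge> n" for i
      using that P(2) by (simp add: P' coeff_eq_0)
    have "idemL e' * dual_base (coeff ?R (n - 1)) = 0"
      by (rule low[OF relR]) (simp add: coeffR del: coeff_smult)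
    then have "idemL e' * (idemL e3 * (constL (of_nat n) * dual_base k)) = 0"
      using \<open>0 < n\<close> P' by (simp add: k_def)
    moreover have "idemL e' * idemL e3 = idemL e3" by (simp add: idemL_simps e3_def inf.absorb2)
    ultimately have z: "idemL e3 * (constL (of_nat n) * dual_base k) = 0" by (simp flip: mult.assoc)
    have "constL (inverse (of_nat n)) * (idemL e3 * (constL (of_nat n) * dual_base k))
        = constL (inverse (of_nat n) * of_nat n) * (idemL e3 * dual_base k)"
      by (simp only: constL_simps(2)[symmetric] ac_simps)
    then have "idemL e3 * dual_base k = 0" using z \<open>0 < n\<close> by (simp add: constL_simps)
    then have "inf e3 (support (dual_base k)) = bot" by (simp add: idem_mult_zero_iff)
    moreover have "e3 \<le> support (dual_base k)" using e'k by (simp add: e3_def le_infI1)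
    ultimately have "e3 = bot" by (simp add: inf.absorb1)
    then show ?thesis by (simp add: e3_def inf_shunt)
  qed
  obtain w where w: "g * w = idemL (support g)" by (rule L0C_local_inverse)
  define d where "d = - (slope_at 0 P * w)"
  have dP: "idemL e' * slope_at d P = 0"
  proof -
    have "idemL e' * idemL (support g) = idemL e'" using \<open>e' \<le> support g\<close> by (simp add: idemL_simps inf.absorb1)
    moreover have "slope_at d P = slope_at 0 P - slope_at 0 P * (g * w)"
      using Pd[of d] by (simp add: slope_at_def g_def d_def ac_simps)
    then have sd: "slope_at d P = slope_at 0 P - slope_at 0 P * idemL (support g)" by (simp only: w)
    have "idemL e' * slope_at d P = idemL e' * slope_at 0 P - slope_at 0 P * (idemL e' * idemL (support g))"
      by (subst sd) (simp add: algebra_simps)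
    ultimately show ?thesis by (simp add: mult.commute)
  qed
  have "idemL e' * slope_at d R = 0" if "relation R" for R
    using that
  proof (induction "degree R" arbitrary: R rule: less_induct)
    case less
    have GR: "G_poly R" and R0: "dual_base (poly R (Dual b 0)) = 0" using less.prems by (simp_all add: relation_def)
    show ?case
    proof (cases "degree R < n")
      case True
      then have hi: "coeff R i = 0" if "i \<ge> n" for i using that by (simp add: coeff_eq_0)
      show ?thesis by (rule vanishing_on(1)[OF GR], rule low[OF less.prems]) (simp add: hi)
    next
      case False
      let ?m = "degree R"
      define T where "T j = (pCons 0 ^^ j) P" for j
      have T: "relation (T j) \<and> idemL e' * slope_at d (T j) = 0" for j
      proof (induction j)
        case 0
        then show ?case using P(1) dP by (simp add: T_def)
      next
        case (Suc j)
        have TS: "T (Suc j) = pCons 0 (T j)" by (simp add: T_def)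
        have "slope_at d (T (Suc j)) = b * slope_at d (T j)"
          using Suc base_at[of "T j" d] by (simp add: TS slope_at_def relation_def)
        then have "idemL e' * slope_at d (T (Suc j)) = 0"
          using Suc by (metis mult.left_commute mult_zero_right)
        moreover have "relation (T (Suc j))"
          using Suc by (simp add: TS relation_def G_poly_pCons G_zero)
        ultimately show ?case by blast
      qed
      have T_coeff: "coeff (T j) i = (if i < j then 0 else coeff P (i - j))" for i j
        by (induction j arbitrary: i) (auto simp: T_def coeff_pCons split: nat.split)
      define c where "c = coeff R ?m"
      \<comment> \<open>One step of division with remainder; the top coefficients cancel.\<close>
      define S where "S = smult k R - smult c (T (?m - n))"
      have cG: "c \<in> G" using GR by (simp add: c_def G_poly_def)
      have "coeff S i = 0" if "i \<ge> ?m" for i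
      proof (cases "i = ?m")
        case True
        moreover have "\<not> ?m < ?m - n" by simp
        ultimately show ?thesis using False by (simp only: S_def coeff_diff coeff_smult T_coeff c_def k_def) (simp add: mult.commute)
      next
        case False': False
        then have "coeff R i = 0" using that by (simp add: coeff_eq_0)
        moreover have "coeff P (i - (?m - n)) = 0"
          using that False False' P(2) by (intro coeff_eq_0) simp
        ultimately show ?thesis by (simp add: S_def T_coeff)
      qed
      then have deg: "degree S < ?m" using False \<open>0 < n\<close> by (intro degree_lessI) auto
      have relS: "relation S"
        using T[of "?m - n"] GR R0 kG cG by (simp add: relation_def S_def G_poly_diff G_poly_smult)
      have "idemL e' * slope_at d S = 0" using less.hyps[OF deg relS] .
      moreover have "dual_base (poly R (Dual b d)) = 0" using R0 base_at[of R d] by simp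
      moreover have "dual_base (poly (T (?m - n)) (Dual b d)) = 0"
        using T[of "?m - n"] base_at[of "T (?m - n)" d] by (simp add: relation_def)
      ultimately have "idemL e' * (dual_base k * slope_at d R) = dual_base c * (idemL e' * slope_at d (T (?m - n)))"
        by (simp add: S_def slope_at_def algebra_simps)
      then have "idemL e' * (dual_base k * slope_at d R) = 0" using T by simp
      then show ?thesis using e'k support_cancel by blast
    qed
  qed
  then show ?thesis using that[of e' d] ne \<open>e' \<le> e\<close> by blast
qed

text \<open>The local choices are mixed along a partition; since slopes are affine in \<open>d\<close>, they are zero on each
piece.\<close>

theorem global_slope: obtains d where "\<And>P. relation P \<Longrightarrow> slope_at d P = 0"
proof -
  define Q where "Q e \<longleftrightarrow> (\<exists>d. \<forall>P. relation P \<longrightarrow> idemL e * slope_at d P = 0)" for e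
  have "\<exists>e'. e' \<noteq> bot \<and> e' \<le> e \<and> Q e'" if "e \<noteq> bot" for e
    using local_slope[OF that] unfolding Q_def by metis
  then obtain D where D: "Sup D = top" "\<And>e. e \<in> D \<Longrightarrow> Q e"
    "\<And>e e'. e \<in> D \<Longrightarrow> e' \<in> D \<Longrightarrow> e \<noteq> e' \<Longrightarrow> inf e e' = bot"
    using exhaustion[of top Q] by blast
  obtain d where d: "\<And>e P. e \<in> D \<Longrightarrow> relation P \<Longrightarrow> idemL e * slope_at (d e) P = 0"
    using D(2) unfolding Q_def by metis
  obtain z where z: "\<And>e. e \<in> D \<Longrightarrow> idemL e * z = idemL e * d e"
    using mixing[OF D(3), of D d] by blast
  have "slope_at z P = 0" if P: "relation P" for P
  proof -
    obtain P' where P': "\<And>d. poly P (Dual b d) =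
       Dual (dual_base (poly P (Dual b 0))) (slope_at 0 P + dual_base (poly P' (Dual b 0)) * d)"
      by (rule formal_derivative[of P]) blast
    have "idemL e * slope_at z P = idemL e * 0" if "e \<in> D" for e
    proof -
      have s: "slope_at y P = slope_at 0 P + dual_base (poly P' (Dual b 0)) * y" for y
        using P'[of y] by (simp add: slope_at_def)
      have "idemL e * slope_at z P = idemL e * slope_at 0 P + dual_base (poly P' (Dual b 0)) * (idemL e * z)"
        by (subst s) (simp add: algebra_simps)
      also have "\<dots> = idemL e * slope_at 0 P + dual_base (poly P' (Dual b 0)) * (idemL e * d e)"
        by (simp only: z[OF that])
      also have "\<dots> = idemL e * slope_at (d e) P"
        by (subst s[of "d e"]) (simp add: algebra_simps)
      finally show ?thesis using d[OF that P] by simp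
    qed
    then have "idemL (Sup D) * slope_at z P = idemL (Sup D) * 0" by (rule idem_mult_Sup)
    then show ?thesis by (simp add: D(1) idemL_simps)
  qed
  with that show thesis by blast
qed

definition adjoin :: "'b L0C \<Rightarrow> 'b L0C dual set" where
  "adjoin d = {poly P (Dual b d) | P. G_poly P}"

lemma adjoin_superset: "G \<subseteq> adjoin d"
proof
  fix p assume "p \<in> G"
  then have "G_poly [:p:]" using G_zero by (intro G_poly_pCons) (simp_all add: G_poly_def)
  moreover have "poly [:p:] (Dual b d) = p" by simp
  ultimately show "p \<in> adjoin d" unfolding adjoin_def by (metis (mono_tags, lifting) mem_Collect_eq)
qed

lemma adjoin_generator: "Dual b d \<in> adjoin d"
proof -
  let ?P = "[:0, Dual (constL 1) 0:]"
  have "G_poly ?P" using G_zero G_const by (intro G_poly_pCons) (simp_all add: G_poly_def)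
  moreover have "poly ?P (Dual b d) = Dual b d" by (rule dual_eqI) (simp_all add: constL_simps)
  ultimately show ?thesis unfolding adjoin_def by (metis (mono_tags, lifting) mem_Collect_eq)
qed

text \<open>That the slope vanishes on all relations says exactly that the extended subring is single-valued.\<close>

lemma derivation_graph_adjoin:
  assumes d: "\<And>P. relation P \<Longrightarrow> slope_at d P = 0"
  shows "derivation_graph (adjoin d)"
  unfolding derivation_graph_def
proof (intro conjI ballI allI impI)
  fix p q assume "p \<in> adjoin d" "q \<in> adjoin d"
  then obtain P Q where PQ: "G_poly P" "G_poly Q" "p = poly P (Dual b d)" "q = poly Q (Dual b d)"
    unfolding adjoin_def by blast
  then have "p + q = poly (P + Q) (Dual b d)" "p * q = poly (P * Q) (Dual b d)" by simp_all
  then show "p + q \<in> adjoin d" "p * q \<in> adjoin d"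
    using PQ G_poly_add G_poly_mult unfolding adjoin_def by blast+
next
  fix y assume "Dual 0 y \<in> adjoin d"
  then obtain P where P: "G_poly P" "Dual 0 y = poly P (Dual b d)" unfolding adjoin_def by blast
  then have "dual_base (poly P (Dual b 0)) = 0" using base_at[of P d] by (metis dual.sel(1))
  then have "slope_at d P = 0" using P(1) by (intro d) (simp add: relation_def)
  then show "y = 0" using P(2) by (metis dual.sel(2) slope_at_def)
qed (use adjoin_superset G_const G_idem in blast)+

end

text \<open>A maximal subring of this kind has full domain, because \<open>global_slope\<close> provides an admissible
derivative for each further element.\<close>

theorem derivation_graph_total:
  fixes G :: "'b::{boolean_algebra,complete_lattice} L0C dual set"
  assumes G: "derivation_graph G"
  obtains \<delta> where "\<And>p. p \<in> G \<Longrightarrow> \<delta> (dual_base p) = dual_slope p"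
    "\<And>x y. \<delta> (x + y) = \<delta> x + \<delta> y" "\<And>x y. \<delta> (x * y) = \<delta> x * y + x * \<delta> y"
    "\<And>c. \<delta> (constL c) = 0" "\<And>e. \<delta> (idemL e) = 0"
proof -
  let ?A = "{H. derivation_graph H \<and> G \<subseteq> H}"
  have "\<exists>M\<in>?A. \<forall>X\<in>?A. M \<subseteq> X \<longrightarrow> X = M"
  proof (rule subset_Zorn_nonempty)
    show "?A \<noteq> {}" using G by blast
    fix C assume ne: "C \<noteq> {}" and C: "subset.chain ?A C"
    have sub: "derivation_graph H" "G \<subseteq> H" if "H \<in> C" for H
      using C that unfolding subset_chain_def by auto
    have "p + q \<in> \<Union>C \<and> p * q \<in> \<Union>C" if pq: "p \<in> \<Union>C" "q \<in> \<Union>C" for p q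
    proof -
      obtain H K where "p \<in> H" "q \<in> K" "H \<in> C" "K \<in> C" using pq by blast
      moreover have "H \<subseteq> K \<or> K \<subseteq> H" using C \<open>H \<in> C\<close> \<open>K \<in> C\<close> unfolding subset_chain_def by blast
      ultimately obtain L where L: "L \<in> C" "p \<in> L" "q \<in> L" by blast
      have "p + q \<in> L \<and> p * q \<in> L" using sub(1)[OF L(1)] L(2,3) unfolding derivation_graph_def by simp
      then show ?thesis using L(1) by blast
    qed
    moreover obtain H where H: "H \<in> C" using ne by blast
    have "Dual (constL c) 0 \<in> \<Union>C" "Dual (idemL e) 0 \<in> \<Union>C" for c e
      using sub(1)[OF H] H unfolding derivation_graph_def by auto
    moreover have "y = 0" if "Dual 0 y \<in> \<Union>C" for y
    proof -
      obtain K where "K \<in> C" "Dual 0 y \<in> K" using \<open>Dual 0 y \<in> \<Union>C\<close> by blast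
      then show ?thesis using sub(1)[of K] unfolding derivation_graph_def by simp
    qed
    ultimately have "derivation_graph (\<Union>C)" unfolding derivation_graph_def by simp
    then show "\<Union>C \<in> ?A" using sub(2)[OF H] H by blast
  qed
  then obtain M where M0: "M \<in> ?A" and M1: "\<forall>X\<in>?A. M \<subseteq> X \<longrightarrow> X = M" ..
  from M0 have M: "derivation_graph M" "G \<subseteq> M" by simp_all
  have total: "\<exists>y. Dual x y \<in> M" for x
  proof -
    interpret graph_extension M x by unfold_locales (rule M(1))
    obtain d where d: "\<And>P. relation P \<Longrightarrow> slope_at d P = 0" by (rule global_slope) blast
    have "adjoin d \<in> ?A" using derivation_graph_adjoin[OF d] adjoin_superset[of d] M(2) by blast
    then have "adjoin d = M" using M1[THEN bspec] adjoin_superset by meson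
    then show ?thesis using adjoin_generator by blast
  qed
  \<comment> \<open>For the closure properties of \<open>M\<close>, which hold with any element in place of \<open>0\<close>.\<close>
  interpret graph_extension M 0 by unfold_locales (rule M(1))
  have unique: "y = y'" if "Dual x y \<in> M" "Dual x y' \<in> M" for x y y'
  proof -
    have "Dual x y - Dual x y' \<in> M" using that by (rule G_diff)
    moreover have "Dual x y - Dual x y' = Dual 0 (y - y')" by (rule dual_eqI) simp_all
    ultimately have "y - y' = 0" using G_slope_zero by metis
    then show ?thesis by simp
  qed
  define \<delta> where "\<delta> x = (THE y. Dual x y \<in> M)" for x
  have \<delta>I: "\<delta> x = y" if "Dual x y \<in> M" for x y
    unfolding \<delta>_def by (rule the_equality) (use that unique in blast)+
  have \<delta>: "Dual x (\<delta> x) \<in> M" for x using total[of x] \<delta>I by metis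
  show thesis
  proof (rule that)
    show "\<delta> (dual_base p) = dual_slope p" if "p \<in> G" for p using that M(2) by (intro \<delta>I) auto
    show "\<delta> (constL c) = 0" for c by (rule \<delta>I) (rule G_const)
    show "\<delta> (idemL e) = 0" for e by (rule \<delta>I) (rule G_idem)
    have "Dual x (\<delta> x) + Dual y (\<delta> y) \<in> M" for x y by (intro G_add \<delta>)
    then show "\<delta> (x + y) = \<delta> x + \<delta> y" for x y by (intro \<delta>I) (simp add: plus_dual_def)
    have "Dual x (\<delta> x) * Dual y (\<delta> y) \<in> M" for x y by (intro G_mult \<delta>)
    then show "\<delta> (x * y) = \<delta> x * y + x * \<delta> y" for x y by (intro \<delta>I) (simp add: times_dual_def)
  qed
qed

section \<open>A derivation that is not zero\<close>

definition locally_constant :: "'b::{boolean_algebra,complete_lattice} L0C \<Rightarrow> bool" where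
  "locally_constant z \<longleftrightarrow> (\<forall>e. e \<noteq> bot \<longrightarrow> (\<exists>e'. e' \<noteq> bot \<and> e' \<le> e \<and> const_on e' z))"

lemma const_on_mono: "e' \<le> e \<Longrightarrow> const_on e z \<Longrightarrow> const_on e' z"
  unfolding const_on_def using idem_mult_mono by blast

lemma const_on_add: "const_on e z \<Longrightarrow> const_on e w \<Longrightarrow> const_on e (z + w)"
  unfolding const_on_def by (metis constL_simps(1) distrib_left)

lemma const_on_mult: "const_on e z \<Longrightarrow> const_on e w \<Longrightarrow> const_on e (z * w)"
proof -
  assume "const_on e z" "const_on e w"
  then obtain c d where cd: "idemL e * z = idemL e * constL c" "idemL e * w = idemL e * constL d"
    unfolding const_on_def by blast
  have ii: "idemL e * idemL e = idemL e" by (simp add: idemL_simps)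
  have "(idemL e * idemL e) * (z * w) = (idemL e * z) * (idemL e * w)" by (simp only: ac_simps)
  also have "\<dots> = (idemL e * constL c) * (idemL e * constL d)" by (simp only: cd)
  also have "\<dots> = (idemL e * idemL e) * (constL c * constL d)" by (simp only: ac_simps)
  finally have "idemL e * (z * w) = idemL e * constL (c * d)" by (simp only: ii constL_simps)
  then show ?thesis unfolding const_on_def by blast
qed

lemma locally_constant_combine:
  assumes z: "locally_constant z" and w: "locally_constant w"
    and f: "\<And>e. const_on e z \<Longrightarrow> const_on e w \<Longrightarrow> const_on e (f z w)"
  shows "locally_constant (f z w)"
  unfolding locally_constant_def
proof (intro allI impI)
  fix e :: 'a assume "e \<noteq> bot"
  then obtain e1 where e1: "e1 \<noteq> bot" "e1 \<le> e" "const_on e1 z" using z unfolding locally_constant_def by blast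
  obtain e2 where e2: "e2 \<noteq> bot" "e2 \<le> e1" "const_on e2 w" using w e1(1) unfolding locally_constant_def by blast
  have "const_on e2 (f z w)" using f const_on_mono[OF e2(2) e1(3)] e2(3) by blast
  moreover have "e2 \<le> e" using e1(2) e2(2) by (rule order_trans[rotated])
  ultimately show "\<exists>e'. e' \<noteq> bot \<and> e' \<le> e \<and> const_on e' (f z w)" using e2(1) by blast
qed

lemma locally_constant_add: "locally_constant z \<Longrightarrow> locally_constant w \<Longrightarrow> locally_constant (z + w)"
  by (rule locally_constant_combine[of z w "(+)"]) (auto intro: const_on_add)

lemma locally_constant_mult: "locally_constant z \<Longrightarrow> locally_constant w \<Longrightarrow> locally_constant (z * w)"
  by (rule locally_constant_combine[of z w "(*)"]) (auto intro: const_on_mult)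

lemma locally_constant_constL: "locally_constant (constL c)"
  unfolding locally_constant_def const_on_def by blast

lemma locally_constant_idemL: "locally_constant (idemL a)"
  unfolding locally_constant_def
proof (intro allI impI)
  fix e :: 'a assume e: "e \<noteq> bot"
  show "\<exists>e'. e' \<noteq> bot \<and> e' \<le> e \<and> const_on e' (idemL a)"
  proof (cases "inf e a = bot")
    case True
    then have "idemL e * idemL a = idemL e * constL 0" by (simp add: idemL_simps constL_simps)
    then show ?thesis using e unfolding const_on_def by blast
  next
    case False
    have "idemL (inf e a) * idemL a = idemL (inf e a) * constL 1" by (simp add: idemL_simps constL_simps inf.assoc)
    then show ?thesis using False unfolding const_on_def by (metis inf_le1)
  qed
qed

definition polyL :: "complex poly \<Rightarrow> 'b::{boolean_algebra,complete_lattice} L0C \<Rightarrow> 'b L0C" where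
  "polyL q b = poly (map_poly constL q) b"

lemma polyL_simps [simp]: "polyL 0 b = 0" "polyL (pCons c q) b = constL c + b * polyL q b"
  unfolding polyL_def by (simp_all add: map_poly_pCons constL_simps)

lemma cval_polyL: "U \<in> fin_dom b \<Longrightarrow> U \<in> fin_dom (polyL q b) \<and> cval (polyL q b) U = poly q (cval b U)"
proof (induction q)
  case 0
  show ?case using fin_dom_point[OF 0] by simp
next
  case (pCons c q)
  then show ?case using fin_dom_point[OF pCons.prems] by simp
qed

text \<open>The values of \<open>b\<close> are roots of \<open>q\<close>. There are finitely many, so by continuity \<open>b\<close> stays at one of
them near a given point.\<close>

lemma algebraic_locally_constant:
  assumes e: "e \<noteq> bot" and q: "q \<noteq> 0" and z: "idemL e * polyL q b = 0"
  obtains e' where "e' \<noteq> bot" "e' \<le> e" "const_on e' b"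
proof -
  obtain U where U: "U \<in> stone_clopen e" "U \<in> fin_dom b"
    using open_dense_fin_dom[of b] e unfolding open_dense_def by blast
  have root: "poly q (cval b V) = 0" if "V \<in> stone_clopen e" "V \<in> fin_dom b" for V
  proof -
    have "idemL e * polyL q b = idemL e * 0" using z by simp
    from idem_mult_eqD[OF this that(1)] show ?thesis
      using cval_polyL[OF that(2), of q] fin_dom_point[OF that(2)] by simp
  qed
  let ?S = "{x. poly q x = 0} - {cval b U}"
  have "open (- ?S)" using poly_roots_finite[OF q] by (intro open_Compl finite_imp_closed) simp
  then have "\<forall>\<^sub>F V in nhdsin stone_space U. cval b V \<in> - ?S"
    by (rule topological_tendstoD[OF cval_tendsto[OF U(2)]]) simp
  then obtain a where a: "U \<in> stone_clopen a" "\<forall>V\<in>stone_clopen a. cval b V \<in> - ?S"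
    unfolding eventually_nhdsin_stone[OF fin_dom_point[OF U(2)]] by blast
  have "idemL (inf a e) * b = idemL (inf a e) * constL (cval b U)"
  proof (rule idem_mult_eqI[OF open_dense_fin_dom[of b]])
    fix V assume V: "V \<in> fin_dom b" "V \<in> stone_clopen (inf a e)"
    then have "cval b V = cval b U" using a(2) root[of V] by (auto simp: stone_clopen_inf)
    then show "cval b V = cval (constL (cval b U)) V" using fin_dom_point[OF V(1)] by simp
  qed
  moreover have "U \<in> stone_clopen (inf a e)" using a(1) U(1) by (simp add: stone_clopen_inf)
  then have "inf a e \<noteq> bot" by auto
  ultimately show thesis using that[of "inf a e"] unfolding const_on_def by auto
qed

text \<open>The finitely many coefficients become constant one after the other on smaller and smaller pieces, which
turns the polynomial into an ordinary complex one.\<close>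

lemma locally_constant_coefficients:
  assumes "e \<noteq> bot" "\<And>i. locally_constant (dual_base (coeff P i))"
  shows "\<exists>e' q. e' \<noteq> bot \<and> e' \<le> e \<and> (\<forall>i. idemL e' * dual_base (coeff P i) = idemL e' * constL (coeff q i)) \<and>
    idemL e' * dual_base (poly P (Dual b 0)) = idemL e' * polyL q b"
  using assms(2)
proof (induction P)
  case 0
  show ?case by (rule exI[of _ e], rule exI[of _ 0]) (simp add: assms(1) constL_simps)
next
  case (pCons a P)
  have "locally_constant (dual_base (coeff P i))" for i using pCons.prems[of "Suc i"] by simp
  then obtain e1 q where e1: "e1 \<noteq> bot" "e1 \<le> e"
    "\<And>i. idemL e1 * dual_base (coeff P i) = idemL e1 * constL (coeff q i)"
    "idemL e1 * dual_base (poly P (Dual b 0)) = idemL e1 * polyL q b"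
    using pCons.IH by blast
  have "locally_constant (dual_base a)" using pCons.prems[of 0] by simp
  then obtain e2 c where e2: "e2 \<noteq> bot" "e2 \<le> e1" "idemL e2 * dual_base a = idemL e2 * constL c"
    using e1(1) unfolding locally_constant_def const_on_def by metis
  have "idemL e2 * dual_base (coeff (pCons a P) i) = idemL e2 * constL (coeff (pCons c q) i)" for i
    using e2(3) idem_mult_mono[OF e2(2) e1(3)] by (simp add: coeff_pCons split: nat.split)
  moreover have "idemL e2 * dual_base (poly (pCons a P) (Dual b 0)) = idemL e2 * polyL (pCons c q) b"
    using e2(3) idem_mult_mono[OF e2(2) e1(4)] by (simp add: distrib_left mult.left_commute)
  moreover have "e2 \<le> e" using e2(2) e1(2) by (rule order_trans)
  ultimately show ?case using e2(1) by blast
qed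

text \<open>Start from the zero derivation on the locally constant elements. A relation for \<open>b\<close> becomes, on some
piece, a complex polynomial with \<open>b\<close> as a root. It must be zero, since \<open>b\<close> would otherwise be constant
somewhere; so on \<open>e\<close> the formal derivative vanishes at \<open>b\<close>, and \<open>idemL e\<close> is an admissible derivative
of \<open>b\<close>.\<close>

theorem derivation_exists:
  fixes b :: "'b::{boolean_algebra,complete_lattice} L0C"
  assumes nc: "\<And>e'. e' \<noteq> bot \<Longrightarrow> e' \<le> e \<Longrightarrow> \<not> const_on e' b"
  obtains \<delta> where "\<delta> b = idemL e"
    "\<And>x y. \<delta> (x + y) = \<delta> x + \<delta> y" "\<And>x y. \<delta> (x * y) = \<delta> x * y + x * \<delta> y"
    "\<And>c. \<delta> (constL c) = 0" "\<And>e. \<delta> (idemL e) = 0"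
proof -
  define G where "G = {Dual s 0 | s :: 'b L0C. locally_constant s}"
  have G_iff: "p \<in> G \<longleftrightarrow> locally_constant (dual_base p) \<and> dual_slope p = 0" for p
    unfolding G_def by (cases p) auto
  have "derivation_graph G"
    unfolding derivation_graph_def
  proof (intro conjI ballI allI impI)
    fix p q assume "p \<in> G" "q \<in> G"
    then show "p + q \<in> G" "p * q \<in> G"
      by (simp_all add: G_iff locally_constant_add locally_constant_mult)
  qed (simp_all add: G_iff locally_constant_constL locally_constant_idemL)
  then interpret graph_extension G b by unfold_locales
  have "slope_at (idemL e) P = 0" if P: "relation P" for P
  proof -
    have GP: "G_poly P" and P0: "dual_base (poly P (Dual b 0)) = 0" using P by (simp_all add: relation_def)
    have coeffs: "locally_constant (dual_base (coeff P i))" for i using GP by (simp add: G_poly_def G_iff)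
    have "slope_at 0 P = 0" using GP
    proof (induction P)
      case (pCons a P)
      then show ?case using G_poly_pConsD[OF pCons.prems] by (simp add: slope_at_def G_iff)
    qed (simp add: slope_at_def)
    obtain P' where P': "\<And>i. coeff P' i = Dual (constL (of_nat (Suc i))) 0 * coeff P (Suc i)"
      and Pd: "\<And>d. poly P (Dual b d) =
         Dual (dual_base (poly P (Dual b 0))) (slope_at 0 P + dual_base (poly P' (Dual b 0)) * d)"
      by (rule formal_derivative[of P]) blast
    let ?g = "dual_base (poly P' (Dual b 0))"
    have "idemL e * ?g = 0"
    proof (rule ccontr)
      assume "idemL e * ?g \<noteq> 0"
      then have "inf e (support ?g) \<noteq> bot" by (simp add: idem_mult_zero_iff)
      then obtain e2 q where e2: "e2 \<noteq> bot" "e2 \<le> inf e (support ?g)"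
        "\<And>i. idemL e2 * dual_base (coeff P i) = idemL e2 * constL (coeff q i)"
        "idemL e2 * dual_base (poly P (Dual b 0)) = idemL e2 * polyL q b"
        using locally_constant_coefficients[OF _ coeffs, of _ b] by meson
      show False
      proof (cases "q = 0")
        case True
        have "idemL e2 * dual_base (coeff P' i) = 0" for i
        proof -
          have "idemL e2 * dual_base (coeff P (Suc i)) = 0"
            using e2(3)[of "Suc i"] True by (simp add: constL_simps)
          then have "constL (of_nat (Suc i)) * (idemL e2 * dual_base (coeff P (Suc i))) = 0" by simp
          then show ?thesis by (simp add: P' mult.left_commute)
        qed
        moreover have "G_poly P'" using GP P' by (simp add: G_poly_def G_mult G_const)
        ultimately have "idemL e2 * ?g = 0" by (intro vanishing_on(2))
        then have "inf e2 (support ?g) = bot" by (simp add: idem_mult_zero_iff)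
        then show False using e2(1,2) by (simp add: inf.absorb1)
      next
        case False
        have "idemL e2 * polyL q b = 0" using e2(4) P0 by simp
        then obtain e3 where "e3 \<noteq> bot" "e3 \<le> e2" "const_on e3 b"
          using algebraic_locally_constant[OF e2(1) False] by blast
        then show False using nc[of e3] e2(2) by (meson le_inf_iff order_trans)
      qed
    qed
    then show ?thesis using Pd[of "idemL e"] \<open>slope_at 0 P = 0\<close> by (simp add: slope_at_def mult.commute)
  qed
  then have "derivation_graph (adjoin (idemL e))" by (rule derivation_graph_adjoin)
  then obtain \<delta> where \<delta>: "\<And>p. p \<in> adjoin (idemL e) \<Longrightarrow> \<delta> (dual_base p) = dual_slope p"
    "\<And>x y. \<delta> (x + y) = \<delta> x + \<delta> y" "\<And>x y. \<delta> (x * y) = \<delta> x * y + x * \<delta> y"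
    "\<And>c. \<delta> (constL c) = 0" "\<And>e. \<delta> (idemL e) = 0"
    by (rule derivation_graph_total) blast
  have "\<delta> b = idemL e" using \<delta>(1)[OF adjoin_generator] by simp
  with \<delta>(2-5) that show thesis by blast
qed

section \<open>The characterisation\<close>

lemma full_band_subset:
  assumes solid: "solid_space Y" and full: "(\<lambda>z. idemL e * z) ` Y = (\<lambda>z. idemL e * z) ` UNIV"
  shows "idemL e * z \<in> Y"
proof -
  obtain y where y: "y \<in> Y" "idemL e * z = idemL e * y" using full by blast
  have "modulusL (idemL e * y) \<le> modulusL y"
    by (rule modulusL_leI[OF open_dense_fin_dom[of y]]) (auto dest: fin_dom_point simp: norm_mult)
  then show ?thesis using y solid unfolding solid_space_def by metis
qed

text \<open>Multiplied by \<open>e\<close>, the derivation of \<open>derivation_exists\<close> takes values in the band. It cannot vanish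
on the ideal: for \<open>a\<close> in the ideal whose support meets \<open>e0\<close>, vanishing at both
\<open>a\<close> and \<open>b a\<close> would give \<open>e0 a = 0\<close>.\<close>

theorem derivation_into_full_band:
  fixes X Y :: "'b::{boolean_algebra,complete_lattice} L0C set"
  assumes ideal: "ideal_C_Stone X" and Y: "\<And>z. idemL e * z \<in> Y"
    and e: "e \<le> support_set X" and nd: "\<not> sigma_distributive_below e"
  obtains \<delta> x where "derivation_on X Y \<delta>" "band_preserving_on X \<delta>" "x \<in> X" "\<delta> x \<noteq> 0"
proof -
  obtain b :: "'b L0C" and e0 where b: "b \<in> C_Stone" and e0: "e0 \<noteq> bot" "e0 \<le> e"
    and nc: "\<And>e'. e' \<noteq> bot \<Longrightarrow> e' \<le> e0 \<Longrightarrow> \<not> const_on e' b"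
    by (rule nowhere_constant_element[OF nd]) blast
  obtain \<delta> where \<delta>b: "\<delta> b = idemL e0" and add: "\<And>x y. \<delta> (x + y) = \<delta> x + \<delta> y"
    and mult: "\<And>x y. \<delta> (x * y) = \<delta> x * y + x * \<delta> y"
    and const: "\<And>c. \<delta> (constL c) = 0" and idem: "\<And>q. \<delta> (idemL q) = 0"
    by (rule derivation_exists[OF nc]) blast+
  define \<delta>' where "\<delta>' z = idemL e * \<delta> z" for z
  have "derivation_on X Y \<delta>'"
    unfolding derivation_on_def
    by (auto simp: \<delta>'_def Y add mult const scaleL_eq_const algebra_simps)
  moreover have "band_preserving_on X \<delta>'"
    unfolding band_preserving_on_def support_le_iff
  proof (intro ballI allI impI)
    fix x :: "'b L0C" and q :: 'b assume "idemL q * x = 0"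
    then have "\<delta> (idemL q * x) = 0" using const[of 0] by (simp add: constL_simps)
    then have "idemL q * \<delta> x = 0" by (simp add: mult idem)
    then show "idemL q * \<delta>' x = 0" unfolding \<delta>'_def by (metis mult.left_commute mult_zero_right)
  qed
  moreover have "\<exists>x\<in>X. \<delta>' x \<noteq> 0"
  proof (rule ccontr)
    assume "\<not> ?thesis"
    then have zero: "\<delta>' x = 0" if "x \<in> X" for x using that by blast
    have "inf (Sup (support ` X)) e0 \<noteq> bot"
      using e0 e unfolding support_set_def by (metis inf.absorb2 order_trans)
    then obtain a where a: "a \<in> X" "inf (support a) e0 \<noteq> bot" unfolding Sup_disjoint by blast
    then have "idemL e0 * a \<noteq> 0" by (simp add: idem_mult_zero_iff inf.commute)
    have "b * a \<in> X" using ideal a(1) b unfolding ideal_C_Stone_def by blast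
    then have "0 = \<delta>' (b * a)" by (simp add: zero)
    also have "\<dots> = idemL e * idemL e0 * a + b * \<delta>' a"
      by (simp add: \<delta>'_def mult \<delta>b algebra_simps)
    also have "\<dots> = idemL e0 * a" using zero[OF a(1)] e0(2) by (simp add: idemL_simps inf.absorb2)
    finally show False using \<open>idemL e0 * a \<noteq> 0\<close> by simp
  qed
  ultimately show thesis using that by blast
qed

theorem corollary5p5:
  fixes X Y :: "'b::{boolean_algebra,complete_lattice} L0C set"
  assumes "ideal_C_Stone X" and "solid_space Y"
  shows "((\<exists>\<delta>. derivation_on X Y \<delta> \<and> band_preserving_on X \<delta> \<and> (\<exists>x\<in>X. \<delta> x \<noteq> 0)) \<longleftrightarrow>
          (\<exists>e::'b. e \<noteq> bot \<and> e \<le> inf (support_set X) (support_set Y) \<and>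
             (\<lambda>z. idemL e * z) ` Y = (\<lambda>z. idemL e * z) ` UNIV \<and>
             \<not> sigma_distributive_below e)) \<and>
         ((\<exists>N. quasi_norm_on Y N \<and> monotone_norm_on Y N) \<or> Y \<subseteq> C_Stone \<longrightarrow>
          (\<forall>\<delta>. derivation_on X Y \<delta> \<and> band_preserving_on X \<delta> \<longrightarrow> (\<forall>x\<in>X. \<delta> x = 0)))"
proof -
  have band: "\<exists>e. e \<noteq> bot \<and> e \<le> inf (support_set X) (support_set Y) \<and> (\<forall>y. idemL e * y \<in> Y) \<and>
      \<not> sigma_distributive_below e"
    if \<delta>: "derivation_on X Y \<delta>" "band_preserving_on X \<delta>" and x: "x \<in> X" "\<delta> x \<noteq> 0" for \<delta> x
  proof -
    interpret band_preserving_derivation X Y \<delta> using assms \<delta> by unfold_locales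
    obtain e where e: "e \<noteq> bot" "e \<le> support (\<delta> x)" "\<And>y. idemL e * y \<in> Y"
      by (rule values_fill_band[OF x]) blast
    have "support (\<delta> x) \<le> support_set Y" "support x \<le> support_set X"
      unfolding support_set_def using x(1) \<delta>_Y[OF x(1)] by (auto intro: SUP_upper)
    moreover have "support (\<delta> x) \<le> support x" using \<delta>(2) x(1) unfolding band_preserving_on_def by blast
    ultimately have "e \<le> inf (support_set X) (support_set Y)" using e(2) by (meson le_infI order_trans)
    then show ?thesis using e support_not_sigma_distributive[OF x(1) e(1,2)] by blast
  qed
  show ?thesis
  proof (intro conjI iffI impI allI ballI)
    assume "\<exists>\<delta>. derivation_on X Y \<delta> \<and> band_preserving_on X \<delta> \<and> (\<exists>x\<in>X. \<delta> x \<noteq> 0)"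
    then obtain e where e: "e \<noteq> bot" "e \<le> inf (support_set X) (support_set Y)" "\<And>y. idemL e * y \<in> Y"
      "\<not> sigma_distributive_below e"
      using band by blast
    have "(\<lambda>z. idemL e * z) ` Y = (\<lambda>z. idemL e * z) ` UNIV"
    proof (intro equalityI subsetI)
      fix w assume "w \<in> (\<lambda>z. idemL e * z) ` UNIV"
      then obtain z where "w = idemL e * z" by blast
      then have "w = idemL e * (idemL e * z)" by (simp add: idemL_simps flip: mult.assoc)
      then show "w \<in> (\<lambda>z. idemL e * z) ` Y" using e(3)[of z] by blast
    qed blast
    with e show "\<exists>e. e \<noteq> bot \<and> e \<le> inf (support_set X) (support_set Y) \<and>
        (\<lambda>z. idemL e * z) ` Y = (\<lambda>z. idemL e * z) ` UNIV \<and> \<not> sigma_distributive_below e" by blast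
  next
    assume "\<exists>e. e \<noteq> bot \<and> e \<le> inf (support_set X) (support_set Y) \<and>
        (\<lambda>z. idemL e * z) ` Y = (\<lambda>z. idemL e * z) ` UNIV \<and> \<not> sigma_distributive_below e"
    then obtain e where e: "e \<le> support_set X" "\<not> sigma_distributive_below e"
      and full: "(\<lambda>z. idemL e * z) ` Y = (\<lambda>z. idemL e * z) ` UNIV"
      by (metis le_inf_iff)
    obtain \<delta> x where "derivation_on X Y \<delta>" "band_preserving_on X \<delta>" "x \<in> X" "\<delta> x \<noteq> 0"
      by (rule derivation_into_full_band[OF assms(1) full_band_subset[OF assms(2) full] e]) blast
    then show "\<exists>\<delta>. derivation_on X Y \<delta> \<and> band_preserving_on X \<delta> \<and> (\<exists>x\<in>X. \<delta> x \<noteq> 0)" by blast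
  next
    fix \<delta> x
    assume Y: "(\<exists>N. quasi_norm_on Y N \<and> monotone_norm_on Y N) \<or> Y \<subseteq> C_Stone"
      and \<delta>: "derivation_on X Y \<delta> \<and> band_preserving_on X \<delta>" and x: "x \<in> X"
    show "\<delta> x = 0"
    proof (rule ccontr)
      assume "\<delta> x \<noteq> 0"
      then obtain e where e: "\<And>y. idemL e * y \<in> Y" "\<not> sigma_distributive_below e"
        using band[of \<delta> x] \<delta> x by blast
      from Y show False
      proof
        assume "\<exists>N. quasi_norm_on Y N \<and> monotone_norm_on Y N"
        then show False using full_band_no_quasi_norm e by blast
      next
        assume "Y \<subseteq> C_Stone"
        then have "idemL e * y \<in> C_Stone" for y using e(1) by blast
        then show False using full_band_unbounded e(2) by blast
      qed
    qed
  qed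
qed

end
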